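(* Every $n$-dimensional Riemannian manifold $M$ can be isometrically embedded into some $(n+1)$-dimensional Riemannian manifold $\overline M$ as a biharmonic hypersurface which is not minimal.
   Context: For a map $\varphi:(M,g)\to(\overline M,\overline g)$ between Riemannian manifolds, the tension field is $\tau(\varphi)=\operatorname{tr}_g\big(\overline\nabla_{X}(\varphi_*Y)-\varphi_*(\nabla_XY)\big)$, and $\varphi$ is biharmonic if it is a critical point of the bienergy $E_2(\varphi)=\frac12\int_M|\tau(\varphi)|^2\,v_g$ (compactly supported variations). A submanifold is biharmonic if its inclusion, with respect to the induced metric, is biharmonic; it is minimal if $\tau\equiv0$. *)

theory Defs
  imports "HOL-Analysis.Analysis"
begin

section \<open>Smooth maps between open subsets of normed spaces\<close>

fun k_smooth_on :: "nat \<Rightarrow> 'a::real_normed_vector set \<Rightarrow> ('a \<Rightarrow> 'b::real_normed_vector) \<Rightarrow> bool"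
  where
    "k_smooth_on 0 S f \<longleftrightarrow> continuous_on S f"
  | "k_smooth_on (Suc k) S f \<longleftrightarrow>
       (\<forall>x\<in>S. f differentiable (at x)) \<and>
       (\<forall>v. k_smooth_on k S (\<lambda>x. frechet_derivative f (at x) v))"

text \<open>This is the usual notion of a \<open>C\<^sup>\<infinity>\<close> map for open \<open>S\<close> in a Euclidean space; it is only used
  there.\<close>

definition smooth_on :: "'a::real_normed_vector set \<Rightarrow> ('a \<Rightarrow> 'b::real_normed_vector) \<Rightarrow> bool"
  where "smooth_on S f \<longleftrightarrow> (\<forall>k. k_smooth_on k S f)"


section \<open>Smooth manifolds and Riemannian metrics\<close>

text \<open>A chart is a pair of a domain and a coordinate map. Its inverse is meaningful only on the image
  of the domain.\<close>

type_synonym ('a, 'n) chart = "'a set \<times> ('a \<Rightarrow> real ^ 'n)"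

definition cdom :: "('a, 'n) chart \<Rightarrow> 'a set"
  where "cdom c = fst c"

definition cmap :: "('a, 'n) chart \<Rightarrow> 'a \<Rightarrow> real ^ 'n"
  where "cmap c = snd c"

definition cinv :: "('a, 'n) chart \<Rightarrow> real ^ 'n \<Rightarrow> 'a"
  where "cinv c = inv_into (cdom c) (cmap c)"

definition smooth_atlas :: "'a topology \<Rightarrow> ('a, 'n::finite) chart set \<Rightarrow> bool"
  where "smooth_atlas X A \<longleftrightarrow>
    (\<Union>c\<in>A. cdom c) = topspace X \<and>
    (\<forall>c\<in>A. openin X (cdom c) \<and> open (cmap c ` cdom c) \<and>
       homeomorphic_map (subtopology X (cdom c)) (top_of_set (cmap c ` cdom c)) (cmap c)) \<and>
    (\<forall>c\<in>A. \<forall>c'\<in>A. smooth_on (cmap c ` (cdom c \<inter> cdom c')) (cmap c' \<circ> cinv c))"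

text \<open>A Riemannian metric is given by its component matrices: the matrix \<open>metric M c p\<close> represents
  the inner product on the tangent space at \<open>p\<close> with respect to the coordinate frame of the
  chart \<open>c\<close>.\<close>

record ('a, 'n::finite) riem =
  space_of :: "'a topology"
  atlas :: "('a, 'n) chart set"
  metric :: "('a, 'n) chart \<Rightarrow> 'a \<Rightarrow> real ^ 'n ^ 'n"

definition local_metric :: "('a, 'n::finite) riem \<Rightarrow> ('a, 'n) chart \<Rightarrow> real ^ 'n \<Rightarrow> real ^ 'n ^ 'n"
  where "local_metric M c x = metric M c (cinv c x)"

definition inner_at :: "('a, 'n::finite) riem \<Rightarrow> ('a, 'n) chart \<Rightarrow> 'a \<Rightarrow> real ^ 'n \<Rightarrow> real ^ 'n \<Rightarrow> real"
  where "inner_at M c p u v = u \<bullet> (metric M c p *v v)"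

text \<open>The last condition says that the components in two overlapping charts represent the same inner
  product on tangent spaces.\<close>

definition riemannian_manifold :: "('a, 'n::finite) riem \<Rightarrow> bool"
  where "riemannian_manifold M \<longleftrightarrow>
    Hausdorff_space (space_of M) \<and> second_countable (space_of M) \<and>
    smooth_atlas (space_of M) (atlas M) \<and>
    (\<forall>c\<in>atlas M.
       smooth_on (cmap c ` cdom c) (local_metric M c) \<and>
       (\<forall>p\<in>cdom c. transpose (metric M c p) = metric M c p \<and>
                    (\<forall>v. v \<noteq> 0 \<longrightarrow> inner_at M c p v v > 0))) \<and>
    (\<forall>c\<in>atlas M. \<forall>c'\<in>atlas M. \<forall>p\<in>cdom c \<inter> cdom c'. \<forall>u v.
       let J = frechet_derivative (cmap c' \<circ> cinv c) (at (cmap c p))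
       in inner_at M c p u v = inner_at M c' p (J u) (J v))"

definition local_rep ::
    "('a, 'n) chart \<Rightarrow> ('b, 'm) chart \<Rightarrow> ('a \<Rightarrow> 'b) \<Rightarrow> real ^ 'n \<Rightarrow> real ^ 'm"
  where "local_rep c d \<phi> = cmap d \<circ> \<phi> \<circ> cinv c"

definition smooth_map ::
    "('a, 'n::finite) riem \<Rightarrow> ('b, 'm::finite) riem \<Rightarrow> ('a \<Rightarrow> 'b) \<Rightarrow> bool"
  where "smooth_map M N \<phi> \<longleftrightarrow>
    continuous_map (space_of M) (space_of N) \<phi> \<and>
    (\<forall>c\<in>atlas M. \<forall>d\<in>atlas N.
       smooth_on (cmap c ` (cdom c \<inter> \<phi> -` cdom d)) (local_rep c d \<phi>))"

text \<open>The last condition is that the metric of \<open>M\<close> is the pullback of that of \<open>N\<close>. It implies that the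
  map is an immersion.\<close>

definition isometric_embedding ::
    "('a, 'n::finite) riem \<Rightarrow> ('b, 'm::finite) riem \<Rightarrow> ('a \<Rightarrow> 'b) \<Rightarrow> bool"
  where "isometric_embedding M N \<phi> \<longleftrightarrow>
    smooth_map M N \<phi> \<and>
    embedding_map (space_of M) (space_of N) \<phi> \<and>
    (\<forall>c\<in>atlas M. \<forall>d\<in>atlas N. \<forall>p \<in> cdom c \<inter> \<phi> -` cdom d. \<forall>u v.
       let D = frechet_derivative (local_rep c d \<phi>) (at (cmap c p))
       in inner_at M c p u v = inner_at N d (\<phi> p) (D u) (D v))"


section \<open>The Levi-Civita connection and the tension field\<close>

text \<open>In this section \<open>g\<close> and \<open>h\<close> are metrics on open subsets of coordinate spaces.\<close>

definition partial :: "'n \<Rightarrow> (real ^ 'n::finite \<Rightarrow> 'b::real_normed_vector) \<Rightarrow> real ^ 'n \<Rightarrow> 'b"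
  where "partial i f x = frechet_derivative f (at x) (axis i 1)"

text \<open>The Christoffel symbol \<open>\<Gamma>\<^sup>k\<^sub>i\<^sub>j\<close> of \<open>g\<close> at \<open>x\<close>.\<close>

definition christoffel ::
    "(real ^ 'n \<Rightarrow> real ^ 'n ^ 'n) \<Rightarrow> real ^ 'n \<Rightarrow> 'n::finite \<Rightarrow> 'n \<Rightarrow> 'n \<Rightarrow> real"
  where "christoffel g x k i j =
    (\<Sum>l\<in>UNIV. matrix_inv (g x) $ k $ l *
       (partial i (\<lambda>y. g y $ j $ l) x + partial j (\<lambda>y. g y $ i $ l) x
         - partial l (\<lambda>y. g y $ i $ j) x)) / 2"

text \<open>The covariant derivative at \<open>x\<close>, in the direction \<open>v\<close>, of a vector field \<open>W\<close> along the
  map \<open>f\<close>, with respect to the Levi-Civita connection of the metric \<open>h\<close> on the codomain of \<open>f\<close>. For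
  \<open>f = id\<close> it is the Levi-Civita connection itself.\<close>

definition cov_deriv_along ::
    "(real ^ 'm \<Rightarrow> real ^ 'm ^ 'm) \<Rightarrow> (real ^ 'n \<Rightarrow> real ^ 'm) \<Rightarrow> real ^ 'n \<Rightarrow>
     (real ^ 'n \<Rightarrow> real ^ 'm) \<Rightarrow> real ^ 'n::finite \<Rightarrow> real ^ 'm::finite"
  where "cov_deriv_along h f v W x =
    frechet_derivative W (at x) v +
    (\<chi> k. \<Sum>i\<in>UNIV. \<Sum>j\<in>UNIV.
       christoffel h (f x) k i j * (frechet_derivative f (at x) v $ i) * (W x $ j))"

definition levi_civita ::
    "(real ^ 'n \<Rightarrow> real ^ 'n ^ 'n) \<Rightarrow> (real ^ 'n \<Rightarrow> real ^ 'n) \<Rightarrow> (real ^ 'n \<Rightarrow> real ^ 'n) \<Rightarrow>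
     real ^ 'n::finite \<Rightarrow> real ^ 'n"
  where "levi_civita g X Y x = cov_deriv_along g id (X x) Y x"

definition pushforward ::
    "(real ^ 'n \<Rightarrow> real ^ 'm) \<Rightarrow> (real ^ 'n \<Rightarrow> real ^ 'n) \<Rightarrow> real ^ 'n::finite \<Rightarrow> real ^ 'm::finite"
  where "pushforward f Y x = frechet_derivative f (at x) (Y x)"

definition second_fundamental_form ::
    "(real ^ 'n \<Rightarrow> real ^ 'n ^ 'n) \<Rightarrow> (real ^ 'm \<Rightarrow> real ^ 'm ^ 'm) \<Rightarrow> (real ^ 'n \<Rightarrow> real ^ 'm) \<Rightarrow>
     (real ^ 'n \<Rightarrow> real ^ 'n) \<Rightarrow> (real ^ 'n \<Rightarrow> real ^ 'n) \<Rightarrow> real ^ 'n::finite \<Rightarrow> real ^ 'm::finite"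
  where "second_fundamental_form g h f X Y x =
    cov_deriv_along h f (X x) (pushforward f Y) x - pushforward f (levi_civita g X Y) x"

text \<open>The trace with respect to \<open>g\<close>, computed in the coordinate frame.\<close>

definition local_tension ::
    "(real ^ 'n \<Rightarrow> real ^ 'n ^ 'n) \<Rightarrow> (real ^ 'm \<Rightarrow> real ^ 'm ^ 'm) \<Rightarrow> (real ^ 'n \<Rightarrow> real ^ 'm) \<Rightarrow>
     real ^ 'n::finite \<Rightarrow> real ^ 'm::finite"
  where "local_tension g h f x =
    (\<Sum>i\<in>UNIV. \<Sum>j\<in>UNIV. (matrix_inv (g x) $ i $ j) *\<^sub>R
       second_fundamental_form g h f (\<lambda>_. axis i 1) (\<lambda>_. axis j 1) x)"

text \<open>The components, in the chart \<open>d\<close> around \<open>\<phi> p\<close>, of the tension field of \<open>\<phi>\<close> at \<open>p\<close>, computed in the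
  chart \<open>c\<close> around \<open>p\<close>.\<close>

definition tension ::
    "('a, 'n::finite) riem \<Rightarrow> ('b, 'm::finite) riem \<Rightarrow> ('a \<Rightarrow> 'b) \<Rightarrow>
     ('a, 'n) chart \<Rightarrow> ('b, 'm) chart \<Rightarrow> 'a \<Rightarrow> real ^ 'm"
  where "tension M N \<phi> c d p =
    local_tension (local_metric M c) (local_metric N d) (local_rep c d \<phi>) (cmap c p)"

definition chart_at :: "('a, 'n::finite) riem \<Rightarrow> 'a \<Rightarrow> ('a, 'n) chart"
  where "chart_at M p = (SOME c. c \<in> atlas M \<and> p \<in> cdom c)"

text \<open>The squared norm of the tension field does not depend on the charts, so any choice will do.\<close>

definition tension_norm_sq ::
    "('a, 'n::finite) riem \<Rightarrow> ('b, 'm::finite) riem \<Rightarrow> ('a \<Rightarrow> 'b) \<Rightarrow> 'a \<Rightarrow> real"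
  where "tension_norm_sq M N \<phi> p =
    (let c = chart_at M p; d = chart_at N (\<phi> p); t = tension M N \<phi> c d p
     in inner_at N d (\<phi> p) t t)"

definition minimal :: "('a, 'n::finite) riem \<Rightarrow> ('b, 'm::finite) riem \<Rightarrow> ('a \<Rightarrow> 'b) \<Rightarrow> bool"
  where "minimal M N \<phi> \<longleftrightarrow>
    (\<forall>c\<in>atlas M. \<forall>d\<in>atlas N. \<forall>p \<in> cdom c \<inter> \<phi> -` cdom d. tension M N \<phi> c d p = 0)"


section \<open>The bienergy and biharmonic maps\<close>

text \<open>The Riemannian volume measure is the unique Borel measure with density \<open>sqrt (det g)\<close> in every
  chart.\<close>

definition is_volume_measure :: "('a, 'n::finite) riem \<Rightarrow> 'a measure \<Rightarrow> bool"
  where "is_volume_measure M \<mu> \<longleftrightarrow>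
    space \<mu> = topspace (space_of M) \<and>
    sets \<mu> = sigma_sets (topspace (space_of M)) {U. openin (space_of M) U} \<and>
    (\<forall>c\<in>atlas M. \<forall>A\<in>sets \<mu>. A \<subseteq> cdom c \<longrightarrow>
       emeasure \<mu> A =
         (\<integral>\<^sup>+x\<in>cmap c ` A. ennreal (sqrt (det (local_metric M c x))) \<partial>lborel))"

definition volume_measure :: "('a, 'n::finite) riem \<Rightarrow> 'a measure"
  where "volume_measure M = (THE \<mu>. is_volume_measure M \<mu>)"

definition bienergy_on ::
    "('a, 'n::finite) riem \<Rightarrow> ('b, 'm::finite) riem \<Rightarrow> 'a set \<Rightarrow> ('a \<Rightarrow> 'b) \<Rightarrow> real"
  where "bienergy_on M N K \<phi> = (LINT p:K|volume_measure M. tension_norm_sq M N \<phi> p) / 2"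

text \<open>Variations of \<open>\<phi>\<close> through maps \<open>\<Phi> t\<close>, smooth in \<open>(p, t)\<close> jointly, that agree with \<open>\<phi>\<close> outside
  the set \<open>K\<close>.\<close>

definition smooth_variation ::
    "('a, 'n::finite) riem \<Rightarrow> ('b, 'm::finite) riem \<Rightarrow> ('a \<Rightarrow> 'b) \<Rightarrow> 'a set \<Rightarrow> real \<Rightarrow>
     (real \<Rightarrow> 'a \<Rightarrow> 'b) \<Rightarrow> bool"
  where "smooth_variation M N \<phi> K \<epsilon> \<Phi> \<longleftrightarrow>
    continuous_map (prod_topology (space_of M) (top_of_set {-\<epsilon><..<\<epsilon>})) (space_of N)
      (\<lambda>(p, t). \<Phi> t p) \<and>
    (\<forall>c\<in>atlas M. \<forall>d\<in>atlas N.
       smooth_on {(x, t). x \<in> cmap c ` cdom c \<and> t \<in> {-\<epsilon><..<\<epsilon>} \<and> \<Phi> t (cinv c x) \<in> cdom d}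
         (\<lambda>(x, t). local_rep c d (\<Phi> t) x)) \<and>
    (\<forall>p\<in>topspace (space_of M). \<Phi> 0 p = \<phi> p) \<and>
    (\<forall>t\<in>{-\<epsilon><..<\<epsilon>}. \<forall>p\<in>topspace (space_of M) - K. \<Phi> t p = \<phi> p)"

text \<open>On a noncompact manifold the bienergy over the whole manifold may be infinite. As usual, the
  criticality condition then refers to the bienergy over compact sets outside of which the variation
  is constant, where the integrand does not change.\<close>

definition biharmonic :: "('a, 'n::finite) riem \<Rightarrow> ('b, 'm::finite) riem \<Rightarrow> ('a \<Rightarrow> 'b) \<Rightarrow> bool"
  where "biharmonic M N \<phi> \<longleftrightarrow>
    smooth_map M N \<phi> \<and>
    (\<forall>K \<epsilon> \<Phi>. compactin (space_of M) K \<longrightarrow> \<epsilon> > 0 \<longrightarrow> smooth_variation M N \<phi> K \<epsilon> \<Phi> \<longrightarrow>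
       ((\<lambda>t. bienergy_on M N K (\<Phi> t)) has_real_derivative 0) (at 0))"

end

theory Submission
  imports Defs
begin

text \<open>Take \<open>N = M \<times> \<real>\<close> with the metric \<open>\<phi>(s) g + ds\<^sup>2\<close>, where \<open>\<phi>(s) = 1 + s + s\<^sup>4\<close>, and embed \<open>M\<close> as the
  slice \<open>s = 0\<close>. A map \<open>(y, s)\<close> into \<open>N\<close> has the vertical tension \<open>\<Delta>s - \<phi>'(s) |dy|\<^sup>2 / 2\<close>. On the slice the
  tension is vertical, and it is the nonzero constant \<open>- n / 2\<close>. Along a variation with initial velocity
  \<open>(V, v)\<close> the derivative of \<open>|\<tau>|\<^sup>2\<close> comes from the vertical part alone, since the horizontal part is
  nonnegative and starts at \<open>0\<close>. As \<open>\<phi>''(0) = 0\<close>, this derivative is \<open>- n div (grad v - V)\<close>, and its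
  integral vanishes by the divergence theorem.\<close>

section \<open>Calculus of \<open>C\<^sup>\<infinity>\<close> and \<open>C\<^sup>1\<close> maps\<close>

text \<open>Deriving the bitension equation would bring in curvature. Because the tension of the
  slice is vertical of constant length, the first variation depends on one scalar only, the vertical
  tension, and no curvature appears. The warping function has three tasks. Its value 1 at 0 makes
  the slice isometric, its nonzero first derivative there prevents minimality, and its zero second
  derivative removes the only term, a multiple of v, that is not a divergence. The function 1 + s
  has the right 2-jet but is not positive everywhere; adding s^4 repairs this without changing the
  2-jet, and a polynomial keeps the smoothness of the metric elementary. Variations need not be
  normal, so the tangential velocity V is carried along. It enters through the Lie derivative of g
  along V, whose trace is 2 div V. Criticality is tested on an arbitrary compact set K, whose
  boundary may be irregular. The divergence theorem is therefore proved for C1 fields that vanish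
  outside K, by integrating over single charts.\<close>

abbreviation fderiv :: "('a::real_normed_vector \<Rightarrow> 'b::real_normed_vector) \<Rightarrow> 'a \<Rightarrow> 'a \<Rightarrow> 'b"
  where "fderiv f x \<equiv> frechet_derivative f (at x)"

lemma fderiv_eq: "(f has_derivative f') (at x) \<Longrightarrow> fderiv f x = f'"
  by (simp add: frechet_derivative_at[symmetric])

lemma has_fderiv: "f differentiable (at x) \<Longrightarrow> (f has_derivative fderiv f x) (at x)"
  by (simp add: frechet_derivative_works)

lemma linear_fderiv: "f differentiable (at x) \<Longrightarrow> linear (fderiv f x)"
  by (simp add: linear_frechet_derivative)

lemma has_derivative_cong_open:
  assumes "(f has_derivative f') (at x)" "open S" "x \<in> S" "\<And>y. y \<in> S \<Longrightarrow> f y = g y"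
  shows "(g has_derivative f') (at x)"
  by (meson assms has_derivative_transform_within_open)

lemma differentiable_cong_open:
  assumes "open S" "x \<in> S" "\<And>y. y \<in> S \<Longrightarrow> f y = g y" "f differentiable (at x)"
  shows "g differentiable (at x)"
  by (meson assms has_derivative_cong_open differentiable_def)

lemma fderiv_cong_open:
  assumes "open S" "x \<in> S" "\<And>y. y \<in> S \<Longrightarrow> f y = g y"
  shows "fderiv f x = fderiv g x"
proof -
  have "(f has_derivative f') (at x) \<longleftrightarrow> (g has_derivative f') (at x)" for f'
    by (metis assms has_derivative_cong_open)
  then show ?thesis by (simp add: frechet_derivative_def)
qed

lemma k_smooth_on_cong:
  assumes "open S" "\<And>x. x \<in> S \<Longrightarrow> f x = g x" "k_smooth_on k S f"
  shows "k_smooth_on k S g"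
  using assms(2,3)
proof (induction k arbitrary: f g)
  case 0
  then show ?case using continuous_on_cong[of S S f g] by auto
next
  case (Suc k)
  have "g differentiable (at x)" if "x \<in> S" for x
    by (rule differentiable_cong_open[of S x f]) (use assms(1) that Suc.prems in auto)
  moreover have "k_smooth_on k S (\<lambda>x. fderiv g x v)" for v
    by (rule Suc.IH[of "\<lambda>x. fderiv f x v"])
      (use fderiv_cong_open[OF assms(1), of _ f g] Suc.prems in auto)
  ultimately show ?case by simp
qed

lemma smooth_on_cong:
  "open S \<Longrightarrow> (\<And>x. x \<in> S \<Longrightarrow> f x = g x) \<Longrightarrow> smooth_on S f \<Longrightarrow> smooth_on S g"
  unfolding smooth_on_def using k_smooth_on_cong by blast

lemma k_smooth_on_Suc_imp: "k_smooth_on (Suc k) S f \<Longrightarrow> k_smooth_on k S f"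
proof (induction k arbitrary: f)
  case 0
  then show ?case
    by (auto intro!: continuous_at_imp_continuous_on differentiable_imp_continuous_within)
qed auto


text \<open>The induction step of the closure rules below: an explicit formula for the derivative
  may replace \<open>frechet_derivative\<close>, and the induction hypothesis then applies to the
  formula.\<close>

lemma k_smooth_on_fderiv_cong:
  assumes "open S" "\<And>x. x \<in> S \<Longrightarrow> (f has_derivative F x) (at x)" "\<And>v. k_smooth_on k S (\<lambda>x. F x v)"
  shows "k_smooth_on (Suc k) S f"
proof -
  have "k_smooth_on k S (\<lambda>x. fderiv f x v)" for v
    by (rule k_smooth_on_cong[OF assms(1) _ assms(3)[of v]]) (simp add: fderiv_eq[OF assms(2)])
  then show ?thesis using assms(2) by (auto simp: differentiable_def)
qed

text \<open>The direction \<open>v\<close> becomes the fixed direction \<open>l v\<close>, so the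
  derivative is again a function composed with the same affine map and the induction closes. Affine
  maps cover the projections of product coordinates and the restriction to a time slice.\<close>

lemma k_smooth_on_compose_affine:
  assumes "bounded_linear l" "open S" "(\<lambda>x. a + l x) ` S \<subseteq> T" "k_smooth_on k T f"
  shows "k_smooth_on k S (\<lambda>x. f (a + l x))"
  using assms(4)
proof (induction k arbitrary: f)
  case 0
  have "continuous_on S (\<lambda>x. a + l x)"
    using assms(1) by (intro continuous_intros linear_continuous_on)
  with 0 show ?case using continuous_on_compose2[of T f S] assms(3) by auto
next
  case (Suc k)
  show ?case
  proof (rule k_smooth_on_fderiv_cong[OF assms(2)])
    fix x assume "x \<in> S"
    then have "(f has_derivative fderiv f (a + l x)) (at (a + l x))"
      using Suc.prems assms(3) by (intro has_fderiv) auto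
    moreover have "((\<lambda>x. a + l x) has_derivative l) (at x)"
      using assms(1) by (auto intro!: derivative_eq_intros bounded_linear_imp_has_derivative)
    ultimately show "((\<lambda>x. f (a + l x)) has_derivative (\<lambda>v. fderiv f (a + l x) (l v))) (at x)"
      using has_derivative_compose by blast
  next
    fix v
    show "k_smooth_on k S (\<lambda>x. fderiv f (a + l x) (l v))"
      by (rule Suc.IH[of "\<lambda>x. fderiv f x (l v)"]) (use Suc.prems in auto)
  qed
qed

lemma k_smooth_on_const: "k_smooth_on k S (\<lambda>x. c)"
  by (induction k arbitrary: c) auto

lemma k_smooth_on_bounded_linear:
  assumes "bounded_linear l" "open S"
  shows "k_smooth_on k S l"
proof (cases k)
  case 0 then show ?thesis using assms by (auto intro: linear_continuous_on)
next
  case (Suc j)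
  show ?thesis unfolding Suc
    by (rule k_smooth_on_fderiv_cong[OF assms(2)])
      (use assms(1) in \<open>auto intro: bounded_linear_imp_has_derivative k_smooth_on_const\<close>)
qed

lemma k_smooth_on_linear_compose:
  assumes "bounded_linear l" "open S" "k_smooth_on k S f"
  shows "k_smooth_on k S (\<lambda>x. l (f x))"
  using assms(3)
proof (induction k arbitrary: f)
  case 0
  then show ?case using assms(1) by (auto intro: bounded_linear.continuous_on)
next
  case (Suc k)
  show ?case
  proof (rule k_smooth_on_fderiv_cong[OF assms(2)])
    fix x assume "x \<in> S"
    then show "((\<lambda>x. l (f x)) has_derivative (\<lambda>v. l (fderiv f x v))) (at x)"
      using Suc.prems by (intro bounded_linear.has_derivative[OF assms(1)] has_fderiv) auto
  next
    fix v show "k_smooth_on k S (\<lambda>x. l (fderiv f x v))"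
      by (rule Suc.IH[of "\<lambda>x. fderiv f x v"]) (use Suc.prems in auto)
  qed
qed

lemma k_smooth_on_add:
  assumes "open S" "k_smooth_on k S f" "k_smooth_on k S g"
  shows "k_smooth_on k S (\<lambda>x. f x + g x)"
  using assms(2,3)
proof (induction k arbitrary: f g)
  case 0
  then show ?case by (auto intro: continuous_intros)
next
  case (Suc k)
  show ?case
  proof (rule k_smooth_on_fderiv_cong[OF assms(1)])
    fix x assume "x \<in> S"
    then show "((\<lambda>x. f x + g x) has_derivative (\<lambda>v. fderiv f x v + fderiv g x v)) (at x)"
      using Suc.prems by (intro has_derivative_add has_fderiv) auto
  next
    fix v show "k_smooth_on k S (\<lambda>x. fderiv f x v + fderiv g x v)"
      by (rule Suc.IH) (use Suc.prems in auto)
  qed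
qed

lemma k_smooth_on_bilinear:
  assumes "bounded_bilinear pr" "open S" "k_smooth_on k S f" "k_smooth_on k S g"
  shows "k_smooth_on k S (\<lambda>x. pr (f x) (g x))"
  using assms(3,4)
proof (induction k arbitrary: f g)
  case 0
  then show ?case by (auto intro: bounded_bilinear.continuous_on[OF assms(1)])
next
  case (Suc k)
  show ?case
  proof (rule k_smooth_on_fderiv_cong[OF assms(2)])
    fix x assume "x \<in> S"
    then show "((\<lambda>x. pr (f x) (g x)) has_derivative
        (\<lambda>v. pr (f x) (fderiv g x v) + pr (fderiv f x v) (g x))) (at x)"
      using Suc.prems by (intro bounded_bilinear.FDERIV[OF assms(1)] has_fderiv) auto
  next
    fix v
    have "k_smooth_on k S f" "k_smooth_on k S g"
      using Suc.prems k_smooth_on_Suc_imp by auto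
    then show "k_smooth_on k S (\<lambda>x. pr (f x) (fderiv g x v) + pr (fderiv f x v) (g x))"
      by (intro k_smooth_on_add assms Suc.IH) (use Suc.prems in auto)
  qed
qed

lemma smooth_on_compose_affine:
  "bounded_linear l \<Longrightarrow> open S \<Longrightarrow> (\<lambda>x. a + l x) ` S \<subseteq> T \<Longrightarrow> smooth_on T f \<Longrightarrow> smooth_on S (\<lambda>x. f (a + l x))"
  unfolding smooth_on_def using k_smooth_on_compose_affine by blast

lemma smooth_on_compose_linear:
  "bounded_linear l \<Longrightarrow> open S \<Longrightarrow> l ` S \<subseteq> T \<Longrightarrow> smooth_on T f \<Longrightarrow> smooth_on S (\<lambda>x. f (l x))"
  using smooth_on_compose_affine[of l S 0 T f] by simp

lemma smooth_on_const: "smooth_on S (\<lambda>x. c)"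
  unfolding smooth_on_def using k_smooth_on_const by blast

lemma smooth_on_bounded_linear: "bounded_linear l \<Longrightarrow> open S \<Longrightarrow> smooth_on S l"
  unfolding smooth_on_def using k_smooth_on_bounded_linear by blast

lemma smooth_on_linear_compose:
  "bounded_linear l \<Longrightarrow> open S \<Longrightarrow> smooth_on S f \<Longrightarrow> smooth_on S (\<lambda>x. l (f x))"
  unfolding smooth_on_def using k_smooth_on_linear_compose by blast

lemma smooth_on_add:
  "open S \<Longrightarrow> smooth_on S f \<Longrightarrow> smooth_on S g \<Longrightarrow> smooth_on S (\<lambda>x. f x + g x)"
  unfolding smooth_on_def using k_smooth_on_add by blast

lemma smooth_on_bilinear:
  "bounded_bilinear pr \<Longrightarrow> open S \<Longrightarrow> smooth_on S f \<Longrightarrow> smooth_on S g \<Longrightarrow> smooth_on S (\<lambda>x. pr (f x) (g x))"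
  unfolding smooth_on_def using k_smooth_on_bilinear by blast

lemma smooth_on_power:
  fixes f :: "'a::real_normed_vector \<Rightarrow> real"
  shows "open S \<Longrightarrow> smooth_on S f \<Longrightarrow> smooth_on S (\<lambda>x. f x ^ n)"
  by (induction n) (auto intro: smooth_on_const smooth_on_bilinear[OF bounded_bilinear_mult])

lemma k_smooth_on_subset: "T \<subseteq> S \<Longrightarrow> k_smooth_on k S f \<Longrightarrow> k_smooth_on k T f"
  by (induction k arbitrary: f) (auto intro: continuous_on_subset)

lemma smooth_on_subset: "T \<subseteq> S \<Longrightarrow> smooth_on S f \<Longrightarrow> smooth_on T f"
  unfolding smooth_on_def using k_smooth_on_subset by blast

lemma smooth_on_differentiable: "smooth_on S f \<Longrightarrow> x \<in> S \<Longrightarrow> f differentiable (at x)"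
  unfolding smooth_on_def by (metis k_smooth_on.simps(2))

lemma smooth_on_fderiv: "smooth_on S f \<Longrightarrow> smooth_on S (\<lambda>x. fderiv f x v)"
  unfolding smooth_on_def by (metis k_smooth_on.simps(2))

lemma smooth_on_continuous_on: "smooth_on S f \<Longrightarrow> continuous_on S f"
  unfolding smooth_on_def by (metis k_smooth_on.simps(1))

text \<open>Inverse matrices, square roots and the tension field are needed to first order only,
  where composition with arbitrary C1 maps is easy. Testing the derivative on fixed directions makes
  this notion coincide with \<open>k_smooth_on 1\<close>, from which several closure rules are
  inherited.\<close>

definition C1_on :: "'a::real_normed_vector set \<Rightarrow> ('a \<Rightarrow> 'b::real_normed_vector) \<Rightarrow> bool"
  where "C1_on S f \<longleftrightarrow> (\<forall>x\<in>S. f differentiable (at x)) \<and> (\<forall>v. continuous_on S (\<lambda>x. fderiv f x v))"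

lemma C1_onI:
  assumes "open S" "\<And>x. x \<in> S \<Longrightarrow> (f has_derivative F x) (at x)" "\<And>v. continuous_on S (\<lambda>x. F x v)"
  shows "C1_on S f"
proof -
  have "continuous_on S (\<lambda>x. fderiv f x v)" for v
    using assms(3)[of v] continuous_on_cong[of S S "\<lambda>x. fderiv f x v" "\<lambda>x. F x v"]
      fderiv_eq[OF assms(2)] by simp
  then show ?thesis using assms(2) by (auto simp: differentiable_def C1_on_def)
qed

lemma C1_on_has_derivative: "C1_on S f \<Longrightarrow> x \<in> S \<Longrightarrow> (f has_derivative fderiv f x) (at x)"
  by (simp add: C1_on_def has_fderiv)

lemma C1_on_fderiv: "C1_on S f \<Longrightarrow> continuous_on S (\<lambda>x. fderiv f x v)"
  by (simp add: C1_on_def)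

lemma C1_on_continuous_on: "C1_on S f \<Longrightarrow> continuous_on S f"
  by (auto simp: C1_on_def intro!: continuous_at_imp_continuous_on differentiable_imp_continuous_within)

lemma smooth_on_C1: "smooth_on S f \<Longrightarrow> C1_on S f"
  by (simp add: C1_on_def smooth_on_continuous_on smooth_on_differentiable smooth_on_fderiv)

lemma C1_on_cong: "open S \<Longrightarrow> (\<And>x. x \<in> S \<Longrightarrow> f x = g x) \<Longrightarrow> C1_on S f \<Longrightarrow> C1_on S g"
  using k_smooth_on_cong[of S f g 1] by (simp add: C1_on_def)

lemma C1_on_subset: "T \<subseteq> S \<Longrightarrow> C1_on S f \<Longrightarrow> C1_on T f"
  using k_smooth_on_subset[of T S 1 f] by (simp add: C1_on_def)

lemma C1_on_Un:
  assumes "open S" "open T" "C1_on S f" "C1_on T f"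
  shows "C1_on (S \<union> T) f"
  using assms by (auto simp: C1_on_def intro: continuous_on_open_Un)

lemma C1_on_const: "C1_on S (\<lambda>x. c)"
  by (rule smooth_on_C1[OF smooth_on_const])

lemma C1_on_linear: "bounded_linear l \<Longrightarrow> open S \<Longrightarrow> C1_on S l"
  by (rule smooth_on_C1[OF smooth_on_bounded_linear])

lemma C1_on_linear_compose: "bounded_linear l \<Longrightarrow> open S \<Longrightarrow> C1_on S f \<Longrightarrow> C1_on S (\<lambda>x. l (f x))"
  using k_smooth_on_linear_compose[of l S 1 f] by (simp add: C1_on_def)

lemma C1_on_add: "open S \<Longrightarrow> C1_on S f \<Longrightarrow> C1_on S g \<Longrightarrow> C1_on S (\<lambda>x. f x + g x)"
  using k_smooth_on_add[of S 1 f g] by (simp add: C1_on_def)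

lemma C1_on_bilinear:
  "bounded_bilinear pr \<Longrightarrow> open S \<Longrightarrow> C1_on S f \<Longrightarrow> C1_on S g \<Longrightarrow> C1_on S (\<lambda>x. pr (f x) (g x))"
  using k_smooth_on_bilinear[of pr S 1 f g] by (simp add: C1_on_def)

lemma C1_on_minus: "open S \<Longrightarrow> C1_on S f \<Longrightarrow> C1_on S (\<lambda>x. - f x)"
  by (rule C1_on_linear_compose[OF bounded_linear_minus[OF bounded_linear_ident]])

lemma C1_on_diff: "open S \<Longrightarrow> C1_on S f \<Longrightarrow> C1_on S g \<Longrightarrow> C1_on S (\<lambda>x. f x - g x)"
  using C1_on_add[of S f "\<lambda>x. - g x"] C1_on_minus by auto

lemma C1_on_mult:
  fixes f g :: "'a::real_normed_vector \<Rightarrow> real"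
  shows "open S \<Longrightarrow> C1_on S f \<Longrightarrow> C1_on S g \<Longrightarrow> C1_on S (\<lambda>x. f x * g x)"
  by (rule C1_on_bilinear[OF bounded_bilinear_mult])

lemma C1_on_sum:
  "open S \<Longrightarrow> (\<And>i. i \<in> I \<Longrightarrow> C1_on S (f i)) \<Longrightarrow> C1_on S (\<lambda>x. \<Sum>i\<in>I. f i x)"
  by (induction I rule: infinite_finite_induct) (auto intro: C1_on_const C1_on_add)

lemma C1_on_prod:
  fixes f :: "'i \<Rightarrow> 'a::real_normed_vector \<Rightarrow> real"
  shows "open S \<Longrightarrow> (\<And>i. i \<in> I \<Longrightarrow> C1_on S (f i)) \<Longrightarrow> C1_on S (\<lambda>x. \<Prod>i\<in>I. f i x)"
  by (induction I rule: infinite_finite_induct) (auto intro: C1_on_const C1_on_mult)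

lemma C1_on_compose:
  fixes f :: "'b::euclidean_space \<Rightarrow> 'c::real_normed_vector"
  assumes "open S" "C1_on T f" "C1_on S g" "g ` S \<subseteq> T"
  shows "C1_on S (\<lambda>x. f (g x))"
proof (rule C1_onI[OF assms(1)])
  fix x assume "x \<in> S"
  then show "((\<lambda>x. f (g x)) has_derivative (\<lambda>v. fderiv f (g x) (fderiv g x v))) (at x)"
    using assms by (intro has_derivative_compose[of g _ x UNIV f, simplified] C1_on_has_derivative[of T]
       C1_on_has_derivative[of S]) auto
next
  fix v
  \<comment> \<open>The operator and its argument both vary with \<open>x\<close>. Expanding the
    argument in the basis leaves derivatives of \<open>f\<close> in fixed directions, which are
    continuous by hypothesis.\<close>
  have "continuous_on S (\<lambda>x. \<Sum>b\<in>Basis. (fderiv g x v \<bullet> b) *\<^sub>R fderiv f (g x) b)"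
    by (intro continuous_intros C1_on_fderiv[OF assms(3)]
        continuous_on_compose2[OF C1_on_fderiv[OF assms(2)] C1_on_continuous_on[OF assms(3)] assms(4)])
  moreover have "(\<Sum>b\<in>Basis. (fderiv g x v \<bullet> b) *\<^sub>R fderiv f (g x) b) = fderiv f (g x) (fderiv g x v)"
    if "x \<in> S" for x
  proof -
    interpret linear "fderiv f (g x)"
      using assms that by (intro linear_fderiv) (auto simp: C1_on_def)
    show ?thesis
      by (subst (2) euclidean_representation[of "fderiv g x v", symmetric]) (simp add: sum scaleR)
  qed
  ultimately show "continuous_on S (\<lambda>x. fderiv f (g x) (fderiv g x v))"
    by (simp cong: continuous_on_cong)
qed

lemma C1_on_real_compose:
  fixes g :: "'a::real_normed_vector \<Rightarrow> real" and f :: "real \<Rightarrow> real"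
  assumes "open S" "open T" "C1_on S g" "g ` S \<subseteq> T" "\<And>y. y \<in> T \<Longrightarrow> (f has_real_derivative f' y) (at y)"
    "continuous_on T f'"
  shows "C1_on S (\<lambda>x. f (g x))"
proof (rule C1_on_compose[OF assms(1) _ assms(3,4)])
  show "C1_on T f"
    by (rule C1_onI[OF assms(2), of _ "\<lambda>y v. f' y * v"])
      (use assms(5,6) in \<open>auto simp: has_field_derivative_def intro: continuous_intros\<close>)
qed

lemma C1_on_inverse:
  fixes f :: "'a::real_normed_vector \<Rightarrow> real"
  assumes "open S" "C1_on S f" "\<And>x. x \<in> S \<Longrightarrow> f x \<noteq> 0"
  shows "C1_on S (\<lambda>x. inverse (f x))"
  by (rule C1_on_real_compose[where T="- {0}" and f'="\<lambda>y. - (inverse y * inverse y)"])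
    (use assms in \<open>auto intro!: derivative_eq_intros continuous_intros\<close>)

lemma C1_on_divide:
  fixes f :: "'a::real_normed_vector \<Rightarrow> real"
  assumes "open S" "C1_on S f" "C1_on S g" "\<And>x. x \<in> S \<Longrightarrow> g x \<noteq> 0"
  shows "C1_on S (\<lambda>x. f x / g x)"
  unfolding divide_inverse using assms by (intro C1_on_mult C1_on_inverse) auto

lemma C1_on_sqrt:
  fixes f :: "'a::real_normed_vector \<Rightarrow> real"
  assumes "open S" "C1_on S f" "\<And>x. x \<in> S \<Longrightarrow> f x > 0"
  shows "C1_on S (\<lambda>x. sqrt (f x))"
  by (rule C1_on_real_compose[where T="{0<..}" and f'="\<lambda>y. inverse (sqrt y) / 2"])
    (use assms in \<open>auto intro!: derivative_eq_intros continuous_intros\<close>)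

lemma C1_on_vec_nth:
  "open S \<Longrightarrow> C1_on S f \<Longrightarrow> C1_on S (\<lambda>x. f x $ i)"
  by (rule C1_on_linear_compose[OF bounded_linear_vec_nth])

lemma C1_on_vec_lambda:
  fixes f :: "'a::real_normed_vector \<Rightarrow> 'n::finite \<Rightarrow> real"
  assumes "open S" "\<And>i. C1_on S (\<lambda>x. f x i)"
  shows "C1_on S (\<lambda>x. \<chi> i. f x i)"
proof -
  have eq: "(\<chi> i. f x i) = (\<Sum>i\<in>UNIV. f x i *\<^sub>R axis i 1)" for x
    by (simp add: vec_eq_iff axis_def if_distrib[of "\<lambda>z. _ * z"] cong: if_cong)
  show ?thesis unfolding eq
    by (intro C1_on_sum assms C1_on_bilinear[OF bounded_bilinear_scaleR] C1_on_const)
qed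

lemmas C1_intros = C1_on_const C1_on_add C1_on_diff C1_on_minus C1_on_mult C1_on_sum C1_on_prod C1_on_vec_nth
  C1_on_inverse C1_on_divide C1_on_sqrt C1_on_vec_lambda C1_on_bilinear[OF bounded_bilinear_scaleR]
  C1_on_bilinear[OF bounded_bilinear_inner]

section \<open>Second derivatives, determinants and inverse matrices\<close>

lemma fderiv_inner_left:
  fixes f :: "'a::real_normed_vector \<Rightarrow> 'b::real_inner"
  assumes "f differentiable (at x)"
  shows "fderiv (\<lambda>y. f y \<bullet> b) x v = fderiv f x v \<bullet> b"
  using fderiv_eq[OF has_derivative_inner_left[OF has_fderiv[OF assms]]] by simp

text \<open>The mean value theorem is applied twice to the second difference over a parallelogram,
  first along \<open>u\<close>, then along \<open>v\<close>. The second difference is symmetric in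
  \<open>u\<close> and \<open>v\<close>, so exchanging them expresses the same number by the other
  mixed derivative.\<close>

lemma mean_value_second_difference:
  fixes f :: "'a::real_normed_vector \<Rightarrow> real"
  assumes S: "\<And>s t. \<lbrakk>0 \<le> s; s \<le> h; 0 \<le> t; t \<le> h\<rbrakk> \<Longrightarrow> x + s *\<^sub>R u + t *\<^sub>R v \<in> S"
    and f: "\<And>y. y \<in> S \<Longrightarrow> f differentiable (at y)"
    and fu: "\<And>y. y \<in> S \<Longrightarrow> (\<lambda>y. fderiv f y u) differentiable (at y)"
    and h: "h > 0"
  obtains s t where "0 < s" "s < h" "0 < t" "t < h"
    "f (x + h *\<^sub>R u + h *\<^sub>R v) - f (x + h *\<^sub>R u) - f (x + h *\<^sub>R v) + f x
      = h * h * fderiv (\<lambda>y. fderiv f y u) (x + s *\<^sub>R u + t *\<^sub>R v) v"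
proof -
  have d1: "((\<lambda>s. f (x + s *\<^sub>R u + t *\<^sub>R v)) has_real_derivative fderiv f (x + s *\<^sub>R u + t *\<^sub>R v) u) (at s)"
    if "0 \<le> s" "s \<le> h" "0 \<le> t" "t \<le> h" for s t
  proof -
    have "(f has_derivative fderiv f (x + s *\<^sub>R u + t *\<^sub>R v)) (at (x + s *\<^sub>R u + t *\<^sub>R v))"
      by (intro has_fderiv f S that)
    moreover have "((\<lambda>s. x + s *\<^sub>R u + t *\<^sub>R v) has_derivative (\<lambda>d. d *\<^sub>R u)) (at s)"
      by (auto intro!: derivative_eq_intros)
    ultimately have "((\<lambda>s. f (x + s *\<^sub>R u + t *\<^sub>R v)) has_derivative
        (\<lambda>d. fderiv f (x + s *\<^sub>R u + t *\<^sub>R v) (d *\<^sub>R u))) (at s)"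
      using has_derivative_compose by blast
    moreover have "fderiv f (x + s *\<^sub>R u + t *\<^sub>R v) (d *\<^sub>R u) = fderiv f (x + s *\<^sub>R u + t *\<^sub>R v) u * d" for d
      using linear_cmul[OF linear_fderiv[OF f[OF S[OF that]]]] by simp
    ultimately show ?thesis by (simp add: has_field_derivative_def)
  qed
  have "\<exists>s. 0 < s \<and> s < h \<and> (f (x + h *\<^sub>R u + h *\<^sub>R v) - f (x + h *\<^sub>R u + 0 *\<^sub>R v)) -
      (f (x + 0 *\<^sub>R u + h *\<^sub>R v) - f (x + 0 *\<^sub>R u + 0 *\<^sub>R v)) =
      (h - 0) * (fderiv f (x + s *\<^sub>R u + h *\<^sub>R v) u - fderiv f (x + s *\<^sub>R u + 0 *\<^sub>R v) u)"
    using h by (intro MVT2 DERIV_diff d1) auto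
  then obtain s where s: "0 < s" "s < h" and 1: "f (x + h *\<^sub>R u + h *\<^sub>R v) - f (x + h *\<^sub>R u) -
      (f (x + h *\<^sub>R v) - f x) =
      h * (fderiv f (x + s *\<^sub>R u + h *\<^sub>R v) u - fderiv f (x + s *\<^sub>R u) u)" by auto
  have d2: "((\<lambda>t. fderiv f (x + s *\<^sub>R u + t *\<^sub>R v) u) has_real_derivative
      fderiv (\<lambda>y. fderiv f y u) (x + s *\<^sub>R u + t *\<^sub>R v) v) (at t)"
    if "0 \<le> t" "t \<le> h" for t
  proof -
    let ?y = "x + s *\<^sub>R u + t *\<^sub>R v"
    have yS: "?y \<in> S" using s that by (intro S) auto
    have "((\<lambda>y. fderiv f y u) has_derivative fderiv (\<lambda>y. fderiv f y u) ?y) (at ?y)"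
      by (intro has_fderiv fu yS)
    moreover have "((\<lambda>t. x + s *\<^sub>R u + t *\<^sub>R v) has_derivative (\<lambda>d. d *\<^sub>R v)) (at t)"
      by (auto intro!: derivative_eq_intros)
    ultimately have "((\<lambda>t. fderiv f (x + s *\<^sub>R u + t *\<^sub>R v) u) has_derivative
        (\<lambda>d. fderiv (\<lambda>y. fderiv f y u) ?y (d *\<^sub>R v))) (at t)"
      using has_derivative_compose[of "\<lambda>t. x + s *\<^sub>R u + t *\<^sub>R v" _ t UNIV "\<lambda>y. fderiv f y u"] by blast
    moreover have "fderiv (\<lambda>y. fderiv f y u) ?y (d *\<^sub>R v) = fderiv (\<lambda>y. fderiv f y u) ?y v * d" for d
      using linear_cmul[OF linear_fderiv[OF fu[OF yS]]] by simp
    ultimately show ?thesis by (simp add: has_field_derivative_def)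
  qed
  have "\<exists>t. 0 < t \<and> t < h \<and> fderiv f (x + s *\<^sub>R u + h *\<^sub>R v) u - fderiv f (x + s *\<^sub>R u + 0 *\<^sub>R v) u =
      (h - 0) * fderiv (\<lambda>y. fderiv f y u) (x + s *\<^sub>R u + t *\<^sub>R v) v"
    using h by (intro MVT2 d2) auto
  then obtain t where t: "0 < t" "t < h" "fderiv f (x + s *\<^sub>R u + h *\<^sub>R v) u - fderiv f (x + s *\<^sub>R u) u =
      h * fderiv (\<lambda>y. fderiv f y u) (x + s *\<^sub>R u + t *\<^sub>R v) v" by auto
  show ?thesis using that[OF s t(1,2)] 1 t(3) by (simp add: algebra_simps)
qed

text \<open>Both mixed derivatives, taken at suitable points near \<open>x\<close>, equal the same
  second difference quotient. Continuity at \<open>x\<close> then leaves no room for a gap between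
  them.\<close>

lemma second_derivative_symmetric_real:
  fixes f :: "'a::real_normed_vector \<Rightarrow> real"
  assumes "open S" "x \<in> S" and f: "\<And>y. y \<in> S \<Longrightarrow> f differentiable (at y)"
    and fu: "C1_on S (\<lambda>y. fderiv f y u)" and fv: "C1_on S (\<lambda>y. fderiv f y v)"
  shows "fderiv (\<lambda>y. fderiv f y u) x v = fderiv (\<lambda>y. fderiv f y v) x u" (is "?F x = ?G x")
proof (rule ccontr)
  let ?F = "\<lambda>x. fderiv (\<lambda>y. fderiv f y u) x v" and ?G = "\<lambda>x. fderiv (\<lambda>y. fderiv f y v) x u"
  assume ne: "?F x \<noteq> ?G x"
  define e where "e = \<bar>?F x - ?G x\<bar> / 2"
  have e: "e > 0" using ne by (simp add: e_def)
  have "isCont ?F x" "isCont ?G x"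
    using C1_on_fderiv[OF fu, of v] C1_on_fderiv[OF fv, of u] assms(1,2)
    by (auto simp: continuous_on_eq_continuous_at)
  then obtain r1 r2 where r12: "r1 > 0" "r2 > 0" "\<And>y. dist y x < r1 \<Longrightarrow> dist (?F y) (?F x) < e"
      "\<And>y. dist y x < r2 \<Longrightarrow> dist (?G y) (?G x) < e"
    using e unfolding continuous_at_eps_delta by metis
  obtain r3 where r3: "r3 > 0" "ball x r3 \<subseteq> S" using assms(1,2) openE by blast
  define r where "r = min r1 (min r2 r3)"
  \<comment> \<open>Shrinks the parallelogram into the ball of radius \<open>r\<close>. The summand
    1 keeps the denominator positive when \<open>u\<close> and \<open>v\<close> are zero.\<close>
  define h where "h = r / (norm u + norm v + 1)"
  have h: "h > 0" using r12 r3 by (auto simp: h_def r_def intro!: divide_pos_pos add_nonneg_pos)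
  have hr: "h * (norm u + norm v + 1) = r"
    unfolding h_def by (simp add: add_nonneg_eq_0_iff)
  have near: "norm (s *\<^sub>R u + t *\<^sub>R v) < r" if "0 \<le> s" "s \<le> h" "0 \<le> t" "t \<le> h" for s t
  proof -
    have "norm (s *\<^sub>R u + t *\<^sub>R v) \<le> s * norm u + t * norm v"
      using norm_triangle_ineq[of "s *\<^sub>R u" "t *\<^sub>R v"] that by simp
    also have "\<dots> \<le> h * norm u + h * norm v" using that by (intro add_mono mult_right_mono) auto
    also have "\<dots> < r" using hr h by (simp add: algebra_simps)
    finally show ?thesis .
  qed
  have near': "dist (x + s *\<^sub>R u + t *\<^sub>R v) x < r" if "0 \<le> s" "s \<le> h" "0 \<le> t" "t \<le> h" for s t
    using near[OF that] by (simp add: dist_norm algebra_simps)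
  have S: "x + s *\<^sub>R u + t *\<^sub>R v \<in> S" if "0 \<le> s" "s \<le> h" "0 \<le> t" "t \<le> h" for s t
    using near'[OF that] r3 by (auto simp: r_def dist_commute subset_iff)
  have S': "x + s *\<^sub>R v + t *\<^sub>R u \<in> S" if "0 \<le> s" "s \<le> h" "0 \<le> t" "t \<le> h" for s t
    using S[of t s] that by (simp add: algebra_simps)
  have dif: "(\<lambda>y. fderiv f y u) differentiable (at y)" "(\<lambda>y. fderiv f y v) differentiable (at y)"
    if "y \<in> S" for y using fu fv that by (auto simp: C1_on_def)
  obtain s t where 1: "0 < s" "s < h" "0 < t" "t < h"
    "f (x + h *\<^sub>R u + h *\<^sub>R v) - f (x + h *\<^sub>R u) - f (x + h *\<^sub>R v) + f x
      = h * h * ?F (x + s *\<^sub>R u + t *\<^sub>R v)"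
    by (rule mean_value_second_difference[OF S f dif(1) h])
  obtain s' t' where 2: "0 < s'" "s' < h" "0 < t'" "t' < h"
    "f (x + h *\<^sub>R v + h *\<^sub>R u) - f (x + h *\<^sub>R v) - f (x + h *\<^sub>R u) + f x
      = h * h * ?G (x + s' *\<^sub>R v + t' *\<^sub>R u)"
    by (rule mean_value_second_difference[OF S' f dif(2) h])
  have "?F (x + s *\<^sub>R u + t *\<^sub>R v) = ?G (x + s' *\<^sub>R v + t' *\<^sub>R u)"
    using 1(5) 2(5) h by (simp add: algebra_simps)
  moreover have "dist (?F (x + s *\<^sub>R u + t *\<^sub>R v)) (?F x) < e"
    using near'[of s t] 1 by (intro r12) (auto simp: r_def)
  moreover have "dist (?G (x + s' *\<^sub>R v + t' *\<^sub>R u)) (?G x) < e"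
    using near'[of t' s'] 2 by (intro r12) (auto simp: r_def algebra_simps)
  ultimately show False unfolding e_def dist_real_def by (simp add: field_simps abs_if split: if_splits)
qed

lemma second_derivative_symmetric:
  fixes f :: "'a::real_normed_vector \<Rightarrow> 'b::euclidean_space"
  assumes "open S" "x \<in> S" and f: "\<And>y. y \<in> S \<Longrightarrow> f differentiable (at y)"
    and fu: "C1_on S (\<lambda>y. fderiv f y u)" and fv: "C1_on S (\<lambda>y. fderiv f y v)"
  shows "fderiv (\<lambda>y. fderiv f y u) x v = fderiv (\<lambda>y. fderiv f y v) x u"
proof (rule euclidean_eqI)
  fix b :: 'b assume "b \<in> Basis"
  have eq: "fderiv (\<lambda>y. f y \<bullet> b) y w = fderiv f y w \<bullet> b" if "y \<in> S" for y w
    by (rule fderiv_inner_left[OF f[OF that]])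
  have C1: "C1_on S (\<lambda>y. fderiv (\<lambda>y. f y \<bullet> b) y w)" if "C1_on S (\<lambda>y. fderiv f y w)" for w
    by (rule C1_on_cong[OF assms(1) eq[symmetric]])
      (auto intro!: C1_on_linear_compose[OF bounded_linear_inner_left] assms that)
  have "fderiv (\<lambda>y. fderiv (\<lambda>y. f y \<bullet> b) y u) x v = fderiv (\<lambda>y. fderiv (\<lambda>y. f y \<bullet> b) y v) x u"
    by (rule second_derivative_symmetric_real[OF assms(1,2)])
      (use f fu fv C1 in \<open>auto intro!: derivative_intros\<close>)
  moreover have "fderiv (\<lambda>y. fderiv (\<lambda>y. f y \<bullet> b) y w) x w' = fderiv (\<lambda>y. fderiv f y w) x w' \<bullet> b"
    if "C1_on S (\<lambda>y. fderiv f y w)" for w w'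
    using fderiv_cong_open[OF assms(1,2), of "\<lambda>y. fderiv (\<lambda>y. f y \<bullet> b) y w" "\<lambda>y. fderiv f y w \<bullet> b"]
      fderiv_inner_left[of "\<lambda>y. fderiv f y w" x b w'] that assms(2) eq by (simp add: C1_on_def)
  ultimately show "fderiv (\<lambda>y. fderiv f y u) x v \<bullet> b = fderiv (\<lambda>y. fderiv f y v) x u \<bullet> b"
    using fu fv by simp
qed

lemma smooth_second_derivative_symmetric:
  fixes f :: "'a::real_normed_vector \<Rightarrow> 'b::euclidean_space"
  assumes "open S" "x \<in> S" "smooth_on S f"
  shows "fderiv (\<lambda>y. fderiv f y u) x v = fderiv (\<lambda>y. fderiv f y v) x u"
  using assms by (intro second_derivative_symmetric[of S]) (auto intro: smooth_on_differentiable smooth_on_C1 smooth_on_fderiv)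

section \<open>Determinants and inverse matrices depending on a parameter\<close>

lemma C1_on_det:
  fixes A :: "'a::real_normed_vector \<Rightarrow> real^'n^'n"
  assumes "open S" "\<And>i j. C1_on S (\<lambda>x. A x $ i $ j)"
  shows "C1_on S (\<lambda>x. det (A x))"
  unfolding det_def by (intro C1_intros assms)

lemma matrix_inv_works:
  fixes A :: "real^'n^'n"
  assumes "invertible A"
  shows "A ** matrix_inv A = mat 1" "matrix_inv A ** A = mat 1"
  using someI_ex[of "\<lambda>A'. A ** A' = mat 1 \<and> A' ** A = mat 1"] assms
  unfolding invertible_def matrix_inv_def by auto

lemma matrix_inv_unique:
  fixes A :: "real^'n^'n"
  assumes "A ** B = mat 1"
  shows "matrix_inv A = B"
proof -
  have "invertible A" using assms invertible_right_inverse by blast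
  then show ?thesis
    by (metis assms matrix_inv_works(2) matrix_mul_assoc matrix_mul_lid matrix_mul_rid)
qed

text \<open>Cramer's rule, applied to the columns of the inverse. It turns regularity of the inverse
  into regularity of determinants.\<close>

lemma matrix_inv_component:
  fixes A :: "real^'n^'n"
  assumes "invertible A"
  shows "matrix_inv A $ k $ l = det (\<chi> i j. if j = k then axis l 1 $ i else A $ i $ j) / det A"
proof -
  have "A *v (matrix_inv A *v axis l 1) = axis l 1"
    by (simp add: matrix_vector_mul_assoc matrix_inv_works assms)
  then have "matrix_inv A *v axis l 1 = (\<chi> k. det (\<chi> i j. if j = k then axis l 1 $ i else A $ i $ j) / det A)"
    using assms cramer[of A] by (simp add: invertible_det_nz)
  then have "(matrix_inv A *v axis l 1) $ k = det (\<chi> i j. if j = k then axis l 1 $ i else A $ i $ j) / det A"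
    by simp
  then show ?thesis by (simp add: matrix_vector_mul_component inner_axis)
qed

lemma C1_on_matrix_inv:
  fixes A :: "'a::real_normed_vector \<Rightarrow> real^'n^'n"
  assumes "open S" "\<And>i j. C1_on S (\<lambda>x. A x $ i $ j)" "\<And>x. x \<in> S \<Longrightarrow> invertible (A x)"
  shows "C1_on S (\<lambda>x. matrix_inv (A x) $ k $ l)"
proof -
  have "C1_on S (\<lambda>x. det (\<chi> i j. if j = k then axis l 1 $ i else A x $ i $ j) / det (A x))"
  proof (intro C1_on_divide C1_on_det assms)
    fix i j show "C1_on S (\<lambda>x. (\<chi> i j. if j = k then axis l 1 $ i else A x $ i $ j) $ i $ j)"
      by (cases "j = k") (auto intro: C1_on_const assms)
  qed (use assms(3) in \<open>auto simp: invertible_det_nz\<close>)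
  then show ?thesis
    by (rule C1_on_cong[OF assms(1), rotated]) (simp add: matrix_inv_component assms(3))
qed

text \<open>Only the identity permutation contributes to the derivative of the determinant at the identity:
  every other one moves two points, so its product vanishes to second order.\<close>

lemma has_derivative_det_at_1:
  fixes B :: "'a::real_normed_vector \<Rightarrow> real^'n^'n"
  assumes "\<And>i j. ((\<lambda>x. B x $ i $ j) has_derivative (\<lambda>v. B' v $ i $ j)) (at x)" "B x = mat 1"
  shows "((\<lambda>x. det (B x)) has_derivative (\<lambda>v. \<Sum>i\<in>UNIV. B' v $ i $ i)) (at x)"
proof -
  have "((\<lambda>x. det (B x)) has_derivative (\<lambda>v. \<Sum>p\<in>{p. p permutes (UNIV::'n set)}.
      of_int (sign p) * (\<Sum>i\<in>UNIV. B' v $ i $ p i * (\<Prod>j\<in>UNIV - {i}. B x $ j $ p j)))) (at x)"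
    unfolding det_def by (intro has_derivative_sum has_derivative_mult_right has_derivative_prod assms)
  moreover have "(\<Sum>i\<in>UNIV. B' v $ i $ p i * (\<Prod>j\<in>UNIV - {i}. B x $ j $ p j)) = 0"
    if p: "p permutes UNIV" "p \<noteq> id" for p :: "'n \<Rightarrow> 'n" and v
  proof (rule sum.neutral, safe)
    fix i
    obtain a where a: "p a \<noteq> a" using p(2) by fastforce
    then have "p (p a) \<noteq> p a" using permutes_inj[OF p(1)] by (metis injD)
    with a obtain j where "j \<noteq> i" "p j \<noteq> j" by metis
    then have "(\<Prod>j\<in>UNIV - {i}. B x $ j $ p j) = 0"
      by (intro prod_zero) (auto simp: assms(2) mat_def intro!: bexI[of _ j])
    then show "B' v $ i $ p i * (\<Prod>j\<in>UNIV - {i}. B x $ j $ p j) = 0" by simp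
  qed
  then have "(\<Sum>p\<in>{p. p permutes (UNIV::'n set)}.
      of_int (sign p) * (\<Sum>i\<in>UNIV. B' v $ i $ p i * (\<Prod>j\<in>UNIV - {i}. B x $ j $ p j)))
    = (\<Sum>p\<in>{id}. of_int (sign p) * (\<Sum>i\<in>UNIV. B' v $ i $ p i * (\<Prod>j\<in>UNIV - {i}. B x $ j $ p j)))" for v
    by (intro sum.mono_neutral_right) (auto simp: permutes_id finite_permutations)
  moreover have "(\<Prod>j\<in>UNIV - {i}. B x $ j $ j) = 1" for i by (simp add: assms(2) mat_def)
  ultimately show ?thesis by (simp add: sign_id)
qed

text \<open>Jacobi's formula. Factoring \<open>det (A y)\<close> as \<open>det (A x)\<close> times
  the determinant of \<open>matrix_inv (A x) ** A y\<close> moves the base point to the identity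
  matrix.\<close>

lemma has_derivative_det:
  fixes A :: "'a::real_normed_vector \<Rightarrow> real^'n^'n"
  assumes "(A has_derivative A') (at x)" "invertible (A x)"
  shows "((\<lambda>x. det (A x)) has_derivative (\<lambda>v. det (A x) * (\<Sum>i\<in>UNIV. (matrix_inv (A x) ** A' v) $ i $ i))) (at x)"
proof -
  \<comment> \<open>\<open>x0\<close> is a frozen copy of \<open>x\<close>, so the factor
    \<open>matrix_inv (A x0)\<close> is constant during the differentiation.\<close>
  have "((\<lambda>x. det (matrix_inv (A x0) ** A x)) has_derivative
      (\<lambda>v. \<Sum>i\<in>UNIV. (matrix_inv (A x0) ** A' v) $ i $ i)) (at x)" if "x0 = x" for x0
  proof (rule has_derivative_det_at_1)
    fix i j
    have "((\<lambda>x. A x $ k $ j) has_derivative (\<lambda>v. A' v $ k $ j)) (at x)" for k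
      using assms(1) by (intro bounded_linear.has_derivative[OF bounded_linear_vec_nth])
    then show "((\<lambda>x. (matrix_inv (A x0) ** A x) $ i $ j) has_derivative
        (\<lambda>v. (matrix_inv (A x0) ** A' v) $ i $ j)) (at x)"
      unfolding matrix_matrix_mult_def by (simp, intro has_derivative_sum has_derivative_mult_right)
  qed (use assms(2) matrix_inv_works that in simp)
  from has_derivative_mult_right[OF this[OF refl], of "det (A x)"]
  have "((\<lambda>y. det (A x) * det (matrix_inv (A x) ** A y)) has_derivative
      (\<lambda>v. det (A x) * (\<Sum>i\<in>UNIV. (matrix_inv (A x) ** A' v) $ i $ i))) (at x)" .
  moreover have "det (A x) * det (matrix_inv (A x) ** B) = det B" for B
    by (simp add: matrix_mul_assoc matrix_inv_works assms(2) flip: det_mul)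
  ultimately show ?thesis by simp
qed

section \<open>The tension field under changes of coordinates\<close>

definition spd :: "real^'n^'n \<Rightarrow> bool"
  where "spd A \<longleftrightarrow> transpose A = A \<and> (\<forall>v. v \<noteq> 0 \<longrightarrow> v \<bullet> (A *v v) > 0)"

lemma spd_symmetric: "spd A \<Longrightarrow> u \<bullet> (A *v v) = v \<bullet> (A *v u)"
  by (metis dot_lmul_matrix inner_commute spd_def vector_transpose_matrix)

lemma spd_nonneg: "spd A \<Longrightarrow> v \<bullet> (A *v v) \<ge> 0"
  by (cases "v = 0") (auto simp: spd_def intro: less_imp_le)

lemma spd_eq_0: "spd A \<Longrightarrow> v \<bullet> (A *v v) = 0 \<Longrightarrow> v = 0"
  by (metis less_irrefl spd_def)

lemma spd_invertible:
  fixes A :: "real^'n^'n"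
  assumes "spd A"
  shows "invertible A"
proof -
  have "\<forall>x. A *v x = 0 \<longrightarrow> x = 0" using assms by (metis inner_zero_right spd_eq_0)
  then show ?thesis using invertible_left_inverse matrix_left_invertible_ker by blast
qed

text \<open>The covariant derivative, in direction \<open>u\<close>, of the vector field with
  constant components \<open>v\<close>. As a bilinear map it allows coordinate changes to be
  computed without indices.\<close>

definition chr :: "(real^'n \<Rightarrow> real^'n^'n) \<Rightarrow> real^'n \<Rightarrow> real^'n \<Rightarrow> real^'n \<Rightarrow> real^'n"
  where "chr g x u v = (\<chi> k. \<Sum>i\<in>UNIV. \<Sum>j\<in>UNIV. christoffel g x k i j * u $ i * v $ j)"

text \<open>The Christoffel symbols of the first kind, as a trilinear form.\<close>

definition chr1 :: "(real^'n \<Rightarrow> real^'n^'n) \<Rightarrow> real^'n \<Rightarrow> real^'n \<Rightarrow> real^'n \<Rightarrow> real^'n \<Rightarrow> real"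
  where "chr1 g x u v w =
    (v \<bullet> (fderiv g x u *v w) + u \<bullet> (fderiv g x v *v w) - u \<bullet> (fderiv g x w *v v)) / 2"

lemma vec_expand: "(v::real^'n) = (\<Sum>i\<in>UNIV. v $ i *\<^sub>R axis i 1)"
  by (simp add: vec_eq_iff axis_def if_distrib[of "\<lambda>z. _ * z"] cong: if_cong)

lemma linear_expand:
  fixes f :: "real^'n \<Rightarrow> 'a::real_vector"
  assumes "linear f"
  shows "f v = (\<Sum>i\<in>UNIV. v $ i *\<^sub>R f (axis i 1))"
  by (subst vec_expand) (simp add: linear_sum[OF assms] linear_cmul[OF assms])

lemma partial_component:
  fixes g :: "real^'n \<Rightarrow> real^'m^'k"
  assumes "g differentiable (at x)"
  shows "partial i (\<lambda>y. g y $ j $ l) x = fderiv g x (axis i 1) $ j $ l"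
proof -
  have "((\<lambda>y. g y $ j $ l) has_derivative (\<lambda>v. fderiv g x v $ j $ l)) (at x)"
    by (intro bounded_linear.has_derivative[OF bounded_linear_vec_nth] has_fderiv assms)
  then show ?thesis unfolding partial_def by (simp add: fderiv_eq)
qed

lemma inner_fderiv_matrix_expand:
  fixes g :: "real^'n \<Rightarrow> real^'n^'n"
  assumes "g differentiable (at x)"
  shows "a \<bullet> (fderiv g x b *v c) =
    (\<Sum>i\<in>UNIV. \<Sum>j\<in>UNIV. \<Sum>l\<in>UNIV. b $ i * a $ j * c $ l * fderiv g x (axis i 1) $ j $ l)"
proof -
  have "a \<bullet> (fderiv g x b *v c) =
      (\<Sum>j\<in>UNIV. \<Sum>l\<in>UNIV. \<Sum>i\<in>UNIV. b $ i * a $ j * c $ l * fderiv g x (axis i 1) $ j $ l)"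
    unfolding inner_vec_def matrix_vector_mult_def
    by (subst linear_expand[OF linear_fderiv[OF assms], of b])
      (simp add: sum_distrib_left sum_distrib_right mult_ac)
  also have "\<dots> = (\<Sum>j\<in>UNIV. \<Sum>i\<in>UNIV. \<Sum>l\<in>UNIV. b $ i * a $ j * c $ l * fderiv g x (axis i 1) $ j $ l)"
    by (intro sum.cong refl sum.swap)
  also have "\<dots> = (\<Sum>i\<in>UNIV. \<Sum>j\<in>UNIV. \<Sum>l\<in>UNIV. b $ i * a $ j * c $ l * fderiv g x (axis i 1) $ j $ l)"
    by (rule sum.swap)
  finally show ?thesis .
qed

lemma sum_rot3:
  fixes F :: "'i::finite \<Rightarrow> 'j::finite \<Rightarrow> 'l::finite \<Rightarrow> real"
  shows "(\<Sum>l\<in>UNIV. \<Sum>i\<in>UNIV. \<Sum>j\<in>UNIV. F i j l) = (\<Sum>i\<in>UNIV. \<Sum>j\<in>UNIV. \<Sum>l\<in>UNIV. F i j l)"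
proof -
  have "(\<Sum>l\<in>UNIV. \<Sum>i\<in>UNIV. \<Sum>j\<in>UNIV. F i j l) = (\<Sum>i\<in>UNIV. \<Sum>l\<in>UNIV. \<Sum>j\<in>UNIV. F i j l)"
    by (rule sum.swap)
  also have "\<dots> = (\<Sum>i\<in>UNIV. \<Sum>j\<in>UNIV. \<Sum>l\<in>UNIV. F i j l)"
    by (intro sum.cong refl sum.swap)
  finally show ?thesis .
qed

text \<open>Lowering the upper index cancels the inverse metric in the Christoffel symbols, which
  leaves first derivatives of the metric only.\<close>

lemma metric_mult_chr:
  fixes g :: "real^'n \<Rightarrow> real^'n^'n"
  assumes "g differentiable (at x)" "invertible (g x)"
  shows "(g x *v chr g x u v) $ l = (\<Sum>i\<in>UNIV. \<Sum>j\<in>UNIV. u $ i * v $ j *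
    (fderiv g x (axis i 1) $ j $ l + fderiv g x (axis j 1) $ i $ l - fderiv g x (axis l 1) $ i $ j) / 2)"
proof -
  define P where "P i j m = (fderiv g x (axis i 1) $ j $ m + fderiv g x (axis j 1) $ i $ m - fderiv g x (axis m 1) $ i $ j) / 2" for i j m
  have chr: "christoffel g x k i j = (\<Sum>m\<in>UNIV. matrix_inv (g x) $ k $ m * P i j m)" for i j k
    unfolding christoffel_def P_def by (simp add: partial_component[OF assms(1)] sum_divide_distrib)
  have inv: "(\<Sum>k\<in>UNIV. g x $ l $ k * christoffel g x k i j) = P i j l" for i j
  proof -
    have "(\<Sum>k\<in>UNIV. g x $ l $ k * christoffel g x k i j)
        = (\<Sum>k\<in>UNIV. \<Sum>m\<in>UNIV. (g x $ l $ k * matrix_inv (g x) $ k $ m) * P i j m)"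
      unfolding chr by (simp add: sum_distrib_left mult.assoc)
    also have "\<dots> = (\<Sum>m\<in>UNIV. (g x ** matrix_inv (g x)) $ l $ m * P i j m)"
      by (subst sum.swap) (simp add: matrix_matrix_mult_def sum_distrib_right)
    also have "\<dots> = P i j l"
      by (simp add: matrix_inv_works[OF assms(2)] mat_def if_distrib[of "\<lambda>z. z * _"] cong: if_cong)
    finally show ?thesis .
  qed
  have "(g x *v chr g x u v) $ l
      = (\<Sum>k\<in>UNIV. \<Sum>i\<in>UNIV. \<Sum>j\<in>UNIV. u $ i * v $ j * (g x $ l $ k * christoffel g x k i j))"
    unfolding chr_def by (simp add: matrix_vector_mult_def sum_distrib_left mult_ac)
  also have "\<dots> = (\<Sum>i\<in>UNIV. \<Sum>j\<in>UNIV. u $ i * v $ j * (\<Sum>k\<in>UNIV. g x $ l $ k * christoffel g x k i j))"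
    by (subst sum_rot3) (simp add: sum_distrib_left)
  also have "\<dots> = (\<Sum>i\<in>UNIV. \<Sum>j\<in>UNIV. u $ i * v $ j * P i j l)" by (simp add: inv)
  finally show ?thesis by (simp add: P_def)
qed

text \<open>The basis-free characterisation of \<open>chr\<close>. Since the metric is nondegenerate
  wherever this is used, identities between Christoffel symbols can be checked on
  \<open>chr1\<close>, which contains no inverse matrix.\<close>

lemma inner_metric_chr:
  fixes g :: "real^'n \<Rightarrow> real^'n^'n"
  assumes "g differentiable (at x)" "invertible (g x)"
  shows "w \<bullet> (g x *v chr g x u v) = chr1 g x u v w"
proof -
  let ?G = "\<lambda>i. fderiv g x (axis i 1)"
  have "w \<bullet> (g x *v chr g x u v) = (\<Sum>l\<in>UNIV. \<Sum>i\<in>UNIV. \<Sum>j\<in>UNIV. u $ i * v $ j * w $ l *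
      (?G i $ j $ l + ?G j $ i $ l - ?G l $ i $ j) / 2)"
    unfolding inner_vec_def metric_mult_chr[OF assms] by (simp add: sum_distrib_left mult_ac)
  also have "\<dots> = (\<Sum>i\<in>UNIV. \<Sum>j\<in>UNIV. \<Sum>l\<in>UNIV. u $ i * v $ j * w $ l *
      (?G i $ j $ l + ?G j $ i $ l - ?G l $ i $ j) / 2)"
    by (rule sum_rot3)
  also have "\<dots> = ((\<Sum>i\<in>UNIV. \<Sum>j\<in>UNIV. \<Sum>l\<in>UNIV. u $ i * v $ j * w $ l * ?G i $ j $ l)
      + (\<Sum>i\<in>UNIV. \<Sum>j\<in>UNIV. \<Sum>l\<in>UNIV. u $ i * v $ j * w $ l * ?G j $ i $ l)
      - (\<Sum>i\<in>UNIV. \<Sum>j\<in>UNIV. \<Sum>l\<in>UNIV. u $ i * v $ j * w $ l * ?G l $ i $ j)) / 2"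
    by (simp add: distrib_left right_diff_distrib add_divide_distrib diff_divide_distrib
        sum.distrib sum_subtractf sum_divide_distrib)
  also have "(\<Sum>i\<in>UNIV. \<Sum>j\<in>UNIV. \<Sum>l\<in>UNIV. u $ i * v $ j * w $ l * ?G i $ j $ l) = v \<bullet> (fderiv g x u *v w)"
    by (simp add: inner_fderiv_matrix_expand[OF assms(1)])
  also have "(\<Sum>i\<in>UNIV. \<Sum>j\<in>UNIV. \<Sum>l\<in>UNIV. u $ i * v $ j * w $ l * ?G j $ i $ l) = u \<bullet> (fderiv g x v *v w)"
    by (subst sum.swap) (simp add: inner_fderiv_matrix_expand[OF assms(1)] mult_ac)
  also have "(\<Sum>i\<in>UNIV. \<Sum>j\<in>UNIV. \<Sum>l\<in>UNIV. u $ i * v $ j * w $ l * ?G l $ i $ j) = u \<bullet> (fderiv g x w *v v)"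
    by (subst sum_rot3[symmetric]) (simp add: inner_fderiv_matrix_expand[OF assms(1)] mult_ac)
  finally show ?thesis by (simp add: chr1_def)
qed

lemma bilinear_chr: "bilinear (chr g x)"
  unfolding bilinear_def linear_iff chr_def
  by (auto simp: vec_eq_iff algebra_simps sum.distrib sum_distrib_left)

definition fderiv2 :: "('a::real_normed_vector \<Rightarrow> 'b::real_normed_vector) \<Rightarrow> 'a \<Rightarrow> 'a \<Rightarrow> 'a \<Rightarrow> 'b"
  where "fderiv2 f x u v = fderiv (\<lambda>y. fderiv f y v) x u"

text \<open>In the first argument this is linearity of a derivative. In the second, linearity holds
  for the first derivative at all points of \<open>S\<close>, and that identity is differentiated at
  \<open>x\<close>.\<close>

lemma bilinear_fderiv2:
  fixes f :: "'a::real_normed_vector \<Rightarrow> 'b::real_normed_vector"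
  assumes "open S" "x \<in> S" "smooth_on S f"
  shows "bilinear (fderiv2 f x)"
  unfolding bilinear_def
proof safe
  fix v show "linear (\<lambda>u. fderiv2 f x u v)"
    unfolding fderiv2_def
    by (rule linear_fderiv) (rule smooth_on_differentiable[OF smooth_on_fderiv[OF assms(3)] assms(2)])
next
  fix u
  have d: "((\<lambda>y. fderiv f y v) has_derivative (\<lambda>u. fderiv2 f x u v)) (at x)" for v
    unfolding fderiv2_def
    by (rule has_fderiv) (rule smooth_on_differentiable[OF smooth_on_fderiv[OF assms(3)] assms(2)])
  have l: "linear (fderiv f y)" if "y \<in> S" for y
    using smooth_on_differentiable[OF assms(3) that] by (rule linear_fderiv)
  have "((\<lambda>y. fderiv f y (v + w)) has_derivative (\<lambda>u. fderiv2 f x u v + fderiv2 f x u w)) (at x)" for v w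
    by (rule has_derivative_cong_open[OF has_derivative_add[OF d d] assms(1,2)]) (simp add: l linear_add)
  moreover have "((\<lambda>y. fderiv f y (c *\<^sub>R v)) has_derivative (\<lambda>u. c *\<^sub>R fderiv2 f x u v)) (at x)" for v c
    by (rule has_derivative_cong_open[OF has_derivative_scaleR_right[OF d] assms(1,2)]) (simp add: l linear_cmul)
  ultimately show "linear (fderiv2 f x u)"
    unfolding linear_iff by (metis d has_derivative_unique)
qed

lemma fderiv_compose:
  assumes "f differentiable (at x)" "F differentiable (at (f x))"
  shows "fderiv (\<lambda>z. F (f z)) x v = fderiv F (f x) (fderiv f x v)"
  using fderiv_eq[OF has_derivative_compose[OF has_fderiv[OF assms(1)] has_fderiv[OF assms(2)]]] by simp

lemma linear_euclidean_expand:
  fixes l :: "'b::euclidean_space \<Rightarrow> 'c::real_vector"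
  assumes "linear l"
  shows "l v = (\<Sum>b\<in>Basis. (v \<bullet> b) *\<^sub>R l b)"
  by (subst euclidean_representation[of v, symmetric]) (simp add: linear_sum[OF assms] linear_cmul[OF assms])

text \<open>The second-order chain rule. The inner derivative is expanded in a basis, so that the
  product rule meets only derivatives in fixed directions.\<close>

lemma fderiv2_compose:
  fixes f :: "'a::real_normed_vector \<Rightarrow> 'b::euclidean_space" and F :: "'b \<Rightarrow> 'c::real_normed_vector"
  assumes W: "open W" "x \<in> W" "smooth_on W f" and S: "open S" "smooth_on S F" "f ` W \<subseteq> S"
  shows "fderiv2 (\<lambda>z. F (f z)) x u v =
    fderiv2 F (f x) (fderiv f x u) (fderiv f x v) + fderiv F (f x) (fderiv2 f x u v)"
proof -
  have fx: "f x \<in> S" using W S by auto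
  have fd: "f differentiable (at y)" "F differentiable (at (f y))" if "y \<in> W" for y
    using that W S by (auto intro: smooth_on_differentiable)
  have df: "((\<lambda>y. fderiv f y v) has_derivative (\<lambda>u. fderiv2 f x u v)) (at x)"
    unfolding fderiv2_def by (rule has_fderiv) (rule smooth_on_differentiable[OF smooth_on_fderiv[OF W(3)] W(2)])
  have dF: "((\<lambda>y. fderiv F (f y) b) has_derivative (\<lambda>u. fderiv2 F (f x) (fderiv f x u) b)) (at x)" for b
    unfolding fderiv2_def
    by (rule has_derivative_compose[OF has_fderiv has_fderiv])
      (use W S fx in \<open>auto intro!: smooth_on_differentiable[of W] smooth_on_differentiable[of S] smooth_on_fderiv\<close>)
  have "((\<lambda>y. \<Sum>b\<in>Basis. (fderiv f y v \<bullet> b) *\<^sub>R fderiv F (f y) b) has_derivative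
      (\<lambda>u. \<Sum>b\<in>Basis. (fderiv f x v \<bullet> b) *\<^sub>R fderiv2 F (f x) (fderiv f x u) b
        + (fderiv2 f x u v \<bullet> b) *\<^sub>R fderiv F (f x) b)) (at x)"
    by (intro has_derivative_sum has_derivative_scaleR has_derivative_inner_left df dF)
  moreover have "(\<Sum>b\<in>Basis. (fderiv f y v \<bullet> b) *\<^sub>R fderiv F (f y) b) = fderiv (\<lambda>z. F (f z)) y v"
    if "y \<in> W" for y
    unfolding fderiv_compose[OF fd[OF that]]
    by (rule linear_euclidean_expand[symmetric]) (rule linear_fderiv[OF fd(2)[OF that]])
  ultimately have "((\<lambda>y. fderiv (\<lambda>z. F (f z)) y v) has_derivative
      (\<lambda>u. \<Sum>b\<in>Basis. (fderiv f x v \<bullet> b) *\<^sub>R fderiv2 F (f x) (fderiv f x u) b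
        + (fderiv2 f x u v \<bullet> b) *\<^sub>R fderiv F (f x) b)) (at x)"
    by (rule has_derivative_cong_open[OF _ W(1,2)])
  from fderiv_eq[OF this]
  have "fderiv2 (\<lambda>z. F (f z)) x u v = (\<Sum>b\<in>Basis. (fderiv f x v \<bullet> b) *\<^sub>R fderiv2 F (f x) (fderiv f x u) b)
        + (\<Sum>b\<in>Basis. (fderiv2 f x u v \<bullet> b) *\<^sub>R fderiv F (f x) b)"
    unfolding fderiv2_def by (simp add: sum.distrib)
  moreover have "(\<Sum>b\<in>Basis. (fderiv f x v \<bullet> b) *\<^sub>R fderiv2 F (f x) (fderiv f x u) b)
      = fderiv2 F (f x) (fderiv f x u) (fderiv f x v)"
    by (rule linear_euclidean_expand[symmetric])
      (use bilinear_fderiv2[OF S(1) fx S(2)] in \<open>simp add: bilinear_def\<close>)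
  moreover have "(\<Sum>b\<in>Basis. (fderiv2 f x u v \<bullet> b) *\<^sub>R fderiv F (f x) b) = fderiv F (f x) (fderiv2 f x u v)"
    by (rule linear_euclidean_expand[symmetric]) (rule linear_fderiv[OF fd(2)[OF W(2)]])
  ultimately show ?thesis by simp
qed

section \<open>Isometric changes of coordinates\<close>

definition pullback_on :: "(real^'n) set \<Rightarrow> (real^'n \<Rightarrow> real^'m) \<Rightarrow> (real^'n \<Rightarrow> real^'n^'n) \<Rightarrow> (real^'m \<Rightarrow> real^'m^'m) \<Rightarrow> bool"
  where "pullback_on S F g h \<longleftrightarrow>
    (\<forall>x\<in>S. \<forall>u v. u \<bullet> (g x *v v) = fderiv F x u \<bullet> (h (F x) *v fderiv F x v))"

lemma has_derivative_matrix_vector: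
  fixes A :: "'a::real_normed_vector \<Rightarrow> real^'n^'m"
  assumes "(A has_derivative A') (at x)" "(b has_derivative b') (at x)"
  shows "((\<lambda>x. A x *v b x) has_derivative (\<lambda>v. A x *v b' v + A' v *v b x)) (at x)"
proof -
  have "((\<lambda>x. (A x *v b x) $ i) has_derivative (\<lambda>v. (A x *v b' v + A' v *v b x) $ i)) (at x)" for i
  proof -
    have "((\<lambda>x. \<Sum>j\<in>UNIV. A x $ i $ j * b x $ j) has_derivative
        (\<lambda>v. \<Sum>j\<in>UNIV. A x $ i $ j * b' v $ j + A' v $ i $ j * b x $ j)) (at x)"
      by (intro has_derivative_sum has_derivative_mult bounded_linear.has_derivative[OF bounded_linear_vec_nth] assms)
    then show ?thesis by (simp add: matrix_vector_mult_def sum.distrib)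
  qed
  then show ?thesis by (subst has_derivative_componentwise_within) (auto simp: Basis_vec_def inner_axis)
qed

text \<open>The inhomogeneous transformation law of the Christoffel symbols. Differentiating the
  pullback identity gives six terms with second derivatives of \<open>F\<close> in the alternating
  sum \<open>chr1\<close>; by symmetry four of them cancel and the other two are equal.\<close>

lemma chr_transform:
  fixes F :: "real^'n \<Rightarrow> real^'n"
  assumes S: "open S" "x \<in> S" "smooth_on S F" and pb: "pullback_on S F g h"
    and dg: "g differentiable (at x)" and dh: "h differentiable (at (F x))"
    and spd: "spd (g x)" "spd (h (F x))"
  shows "fderiv F x (chr g x u v) = fderiv2 F x u v + chr h (F x) (fderiv F x u) (fderiv F x v)"
proof -
  let ?D = "fderiv F x" and ?h = "h (F x)"
  have linD: "linear ?D" by (rule linear_fderiv) (rule smooth_on_differentiable[OF S(3,2)])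
  have inj: "inj ?D"
  proof (rule linear_injective_0[THEN iffD2, OF linD], safe)
    fix a assume "?D a = 0"
    then have "a \<bullet> (g x *v a) = 0" using pb S by (simp add: pullback_on_def)
    then show "a = 0" using spd_eq_0[OF spd(1)] by simp
  qed
  \<comment> \<open>The product rule for the right-hand side of the pullback identity, which holds
    on the whole open set and may therefore be differentiated.\<close>
  have key: "b \<bullet> (fderiv g x a *v c) = fderiv2 F x a b \<bullet> (?h *v ?D c) + ?D b \<bullet> (fderiv h (F x) (?D a) *v ?D c)
      + ?D b \<bullet> (?h *v fderiv2 F x a c)" for a b c
  proof -
    have dF: "((\<lambda>y. fderiv F y w) has_derivative (\<lambda>u. fderiv2 F x u w)) (at x)" for w
      unfolding fderiv2_def by (rule has_fderiv) (rule smooth_on_differentiable[OF smooth_on_fderiv[OF S(3)] S(2)])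
    have "((\<lambda>y. h (F y)) has_derivative (\<lambda>a. fderiv h (F x) (?D a))) (at x)"
      by (rule has_derivative_compose[OF has_fderiv[OF smooth_on_differentiable[OF S(3,2)]] has_fderiv[OF dh]])
    from has_derivative_inner[OF dF[of b] has_derivative_matrix_vector[OF this dF[of c]]]
    have "((\<lambda>y. fderiv F y b \<bullet> (h (F y) *v fderiv F y c)) has_derivative
      (\<lambda>a. ?D b \<bullet> (?h *v fderiv2 F x a c + fderiv h (F x) (?D a) *v ?D c) + fderiv2 F x a b \<bullet> (?h *v ?D c))) (at x)" .
    then have "((\<lambda>y. b \<bullet> (g y *v c)) has_derivative
      (\<lambda>a. ?D b \<bullet> (?h *v fderiv2 F x a c + fderiv h (F x) (?D a) *v ?D c) + fderiv2 F x a b \<bullet> (?h *v ?D c))) (at x)"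
      by (rule has_derivative_cong_open[OF _ S(1,2)]) (use pb in \<open>simp add: pullback_on_def\<close>)
    moreover have "((\<lambda>y. b \<bullet> (g y *v c)) has_derivative (\<lambda>a. b \<bullet> (fderiv g x a *v c))) (at x)"
      using has_derivative_inner_right[OF has_derivative_matrix_vector[OF has_fderiv[OF dg] has_derivative_const], of b c]
      by simp
    ultimately have "(\<lambda>a. b \<bullet> (fderiv g x a *v c)) =
      (\<lambda>a. ?D b \<bullet> (?h *v fderiv2 F x a c + fderiv h (F x) (?D a) *v ?D c) + fderiv2 F x a b \<bullet> (?h *v ?D c))"
      using has_derivative_unique by blast
    from fun_cong[OF this, of a] show ?thesis by (simp add: inner_add_right)
  qed
  have sym2: "fderiv2 F x a b = fderiv2 F x b a" for a b
    unfolding fderiv2_def by (rule smooth_second_derivative_symmetric[OF S])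
  \<comment> \<open>The error of the claimed identity is orthogonal to every \<open>?D w\<close>. As
    \<open>?D\<close> is injective between spaces of equal dimension, these vectors fill the space
    and the error is 0.\<close>
  let ?d = "?D (chr g x u v) - (fderiv2 F x u v + chr h (F x) (?D u) (?D v))"
  have "?D w \<bullet> (?h *v ?d) = 0" for w
  proof -
    have 1: "?D w \<bullet> (?h *v ?D (chr g x u v)) = chr1 g x u v w"
      using inner_metric_chr[OF dg spd_invertible[OF spd(1)], of w u v] pb S by (simp add: pullback_on_def)
    have 2: "?D w \<bullet> (?h *v chr h (F x) (?D u) (?D v)) = chr1 h (F x) (?D u) (?D v) (?D w)"
      by (rule inner_metric_chr[OF dh spd_invertible[OF spd(2)]])
    have 3: "chr1 g x u v w = chr1 h (F x) (?D u) (?D v) (?D w) + ?D w \<bullet> (?h *v fderiv2 F x u v)"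
      unfolding chr1_def key
      by (simp add: sym2[of v u] sym2[of w u] sym2[of w v] field_simps
          spd_symmetric[OF spd(2), of "?D w"] spd_symmetric[OF spd(2), of "?D v"] spd_symmetric[OF spd(2), of "?D u"])
    show ?thesis using 1 2 3 by (simp add: matrix_vector_mult_diff_distrib matrix_vector_right_distrib inner_simps)
  qed
  moreover obtain w where "?D w = ?d"
    using linear_injective_imp_surjective[OF linD inj] by (metis surjD)
  ultimately have "?d \<bullet> (?h *v ?d) = 0" by metis
  then have "?d = 0" using spd_eq_0[OF spd(2)] by blast
  then show ?thesis by simp
qed

text \<open>The Hessian \<open>nabla df\<close> in coordinates, as a bilinear form on vectors
  instead of fields. Traces and coordinate changes become algebra in this form.\<close>

definition sff :: "(real^'n \<Rightarrow> real^'n^'n) \<Rightarrow> (real^'m \<Rightarrow> real^'m^'m) \<Rightarrow> (real^'n \<Rightarrow> real^'m) \<Rightarrow>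
    real^'n \<Rightarrow> real^'n \<Rightarrow> real^'n \<Rightarrow> real^'m"
  where "sff g h f x u v =
    fderiv2 f x u v + chr h (f x) (fderiv f x u) (fderiv f x v) - fderiv f x (chr g x u v)"

lemma local_tension_sff:
  "local_tension g h f x =
    (\<Sum>i\<in>UNIV. \<Sum>j\<in>UNIV. matrix_inv (g x) $ i $ j *\<^sub>R sff g h f x (axis i 1) (axis j 1))"
proof -
  have id: "fderiv id x v = v" for x v :: "real^'n"
    using fderiv_eq[OF has_derivative_id] by (simp add: id_def)
  have 1: "cov_deriv_along h f u (pushforward f (\<lambda>_. v)) x
      = fderiv2 f x u v + chr h (f x) (fderiv f x u) (fderiv f x v)" for u v
    unfolding cov_deriv_along_def fderiv2_def chr_def pushforward_def by simp
  have 2: "levi_civita g (\<lambda>_. u) (\<lambda>_. v) x = chr g x u v" for u v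
    unfolding levi_civita_def cov_deriv_along_def chr_def by (simp add: id)
  show ?thesis
    unfolding local_tension_def second_fundamental_form_def sff_def by (simp add: 1 2 pushforward_def)
qed

lemma bilinear_sff:
  assumes "open S" "x \<in> S" "smooth_on S f"
  shows "bilinear (sff g h f x)"
proof -
  have l: "linear (fderiv f x)" by (rule linear_fderiv) (rule smooth_on_differentiable[OF assms(3,2)])
  note b = bilinear_fderiv2[OF assms] bilinear_chr[of h "f x"] bilinear_chr[of g x]
  show ?thesis
    unfolding bilinear_def linear_iff sff_def
    by (simp add: bilinear_ladd[OF b(1)] bilinear_ladd[OF b(2)] bilinear_ladd[OF b(3)]
      bilinear_radd[OF b(1)] bilinear_radd[OF b(2)] bilinear_radd[OF b(3)]
      bilinear_lmul[OF b(1)] bilinear_lmul[OF b(2)] bilinear_lmul[OF b(3)]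
      bilinear_rmul[OF b(1)] bilinear_rmul[OF b(2)] bilinear_rmul[OF b(3)]
      linear_add[OF l] linear_cmul[OF l] algebra_simps)
qed

text \<open>The chain rule produces a second derivative of \<open>F\<close>. It is exactly the
  inhomogeneous term in the transformation law of the target Christoffel symbols, so the Hessian is
  mapped by the differential of \<open>F\<close>.\<close>

lemma sff_target_change:
  fixes F :: "real^'m \<Rightarrow> real^'m" and f :: "real^'n \<Rightarrow> real^'m"
  assumes W: "open W" "x \<in> W" "smooth_on W f" and S: "open S" "smooth_on S F" "f ` W \<subseteq> S"
    and pb: "pullback_on S F h h'"
    and d: "h differentiable (at (f x))" "h' differentiable (at (F (f x)))"
    and spd: "spd (h (f x))" "spd (h' (F (f x)))"
  shows "sff g h' (\<lambda>z. F (f z)) x u v = fderiv F (f x) (sff g h f x u v)"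
proof -
  have fx: "f x \<in> S" using W S by auto
  have dd: "f differentiable (at x)" "F differentiable (at (f x))"
    using W S fx by (auto intro: smooth_on_differentiable)
  note lin = linear_fderiv[OF dd(2)]
  show ?thesis
    unfolding sff_def fderiv2_compose[OF W S] fderiv_compose[OF dd]
    by (simp add: linear_diff[OF lin] linear_add[OF lin] chr_transform[OF S(1) fx S(2) pb d spd])
qed

text \<open>Here the inhomogeneous term comes from the source Christoffel symbols and cancels the
  second derivative of \<open>F\<close> after application of \<open>fderiv f (F x)\<close>.\<close>

lemma sff_source_change:
  fixes F :: "real^'n \<Rightarrow> real^'n" and f :: "real^'n \<Rightarrow> real^'m"
  assumes W: "open W" "x \<in> W" "smooth_on W F" and S: "open S" "smooth_on S f" "F ` W \<subseteq> S"
    and pb: "pullback_on W F g g'"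
    and d: "g differentiable (at x)" "g' differentiable (at (F x))"
    and spd: "spd (g x)" "spd (g' (F x))"
  shows "sff g h (\<lambda>z. f (F z)) x u v = sff g' h f (F x) (fderiv F x u) (fderiv F x v)"
proof -
  have Fx: "F x \<in> S" using W S by auto
  have dd: "F differentiable (at x)" "f differentiable (at (F x))"
    using W S Fx by (auto intro: smooth_on_differentiable)
  note lin = linear_fderiv[OF dd(2)]
  show ?thesis
    unfolding sff_def fderiv2_compose[OF W S] fderiv_compose[OF dd]
    by (simp add: linear_diff[OF lin] linear_add[OF lin] chr_transform[OF W pb d spd])
qed

text \<open>The hypothesis makes \<open>B ** J ** matrix_inv A\<close> a right inverse of
  \<open>transpose J\<close>; for square matrices it is also a left inverse, and this is the claim
  up to bracketing.\<close>

lemma matrix_inv_transform: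
  fixes A B J :: "real^'n^'n"
  assumes inv: "invertible A" and eq: "transpose J ** B ** J = A"
  shows "J ** matrix_inv A ** transpose J = matrix_inv B"
proof -
  have "transpose J ** (B ** J ** matrix_inv A) = mat 1"
    using eq by (simp add: matrix_mul_assoc matrix_inv_works inv)
  then have "(B ** J ** matrix_inv A) ** transpose J = mat 1"
    by (rule matrix_left_right_inverse[THEN iffD1])
  then show ?thesis by (metis matrix_inv_unique matrix_mul_assoc)
qed

lemma matrix_pullback:
  fixes A B :: "real^'n^'n"
  assumes J: "linear J" and eq: "\<And>u v. u \<bullet> (A *v v) = J u \<bullet> (B *v J v)"
  shows "transpose (matrix J) ** B ** matrix J = A"
proof -
  have Jv: "matrix J *v v = J v" for v using matrix_vector_mul(2)[OF J] by metis
  have "u \<bullet> ((transpose (matrix J) ** B ** matrix J) *v v) = u \<bullet> (A *v v)" for u v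
  proof -
    have "u \<bullet> (transpose C *v w) = (C *v u) \<bullet> w" for C :: "real^'n^'n" and w
      by (metis dot_lmul_matrix inner_commute transpose_matrix_vector)
    then show ?thesis by (simp only: eq matrix_vector_mul_assoc[symmetric] Jv)
  qed
  then show ?thesis by (metis matrix_eq vector_eq_ldot)
qed

lemma matrix_inv_pullback:
  fixes A B :: "real^'n^'n"
  assumes inv: "invertible A" and J: "linear J" and eq: "\<And>u v. u \<bullet> (A *v v) = J u \<bullet> (B *v J v)"
  shows "matrix_inv B $ a $ b = (\<Sum>i\<in>UNIV. \<Sum>j\<in>UNIV. matrix_inv A $ i $ j * J (axis i 1) $ a * J (axis j 1) $ b)"
proof -
  from matrix_inv_transform[OF inv matrix_pullback[OF J eq]]
  have "matrix_inv B $ a $ b = (matrix J ** matrix_inv A ** transpose (matrix J)) $ a $ b" by simp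
  also have "\<dots> = (\<Sum>j\<in>UNIV. \<Sum>i\<in>UNIV. matrix_inv A $ i $ j * J (axis i 1) $ a * J (axis j 1) $ b)"
    by (simp add: matrix_matrix_mult_def transpose_def matrix_def sum_distrib_left sum_distrib_right mult_ac)
  finally show ?thesis by (subst sum.swap)
qed

text \<open>The trace of a bilinear form does not depend on the frame. After expanding the form in
  coordinates, the two copies of \<open>J\<close> are absorbed by the transformation of the inverse
  metric.\<close>

lemma trace_pullback:
  fixes A B :: "real^'n^'n" and \<beta> :: "real^'n \<Rightarrow> real^'n \<Rightarrow> 'a::real_vector"
  assumes inv: "invertible A" and J: "linear J" and eq: "\<And>u v. u \<bullet> (A *v v) = J u \<bullet> (B *v J v)"
    and \<beta>: "bilinear \<beta>"
  shows "(\<Sum>i\<in>UNIV. \<Sum>j\<in>UNIV. matrix_inv A $ i $ j *\<^sub>R \<beta> (J (axis i 1)) (J (axis j 1)))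
    = (\<Sum>a\<in>UNIV. \<Sum>b\<in>UNIV. matrix_inv B $ a $ b *\<^sub>R \<beta> (axis a 1) (axis b 1))"
proof -
  let ?A = "matrix_inv A" and ?J = "\<lambda>i a. J (axis i 1) $ a" and ?\<beta> = "\<lambda>a b. \<beta> (axis a 1) (axis b 1)"
  have exp: "\<beta> u v = (\<Sum>a\<in>UNIV. \<Sum>b\<in>UNIV. (u $ a * v $ b) *\<^sub>R ?\<beta> a b)" for u v
  proof -
    have "\<beta> u v = (\<Sum>a\<in>UNIV. u $ a *\<^sub>R \<beta> (axis a 1) v)"
      by (rule linear_expand[of "\<lambda>u. \<beta> u v"]) (use \<beta> in \<open>simp add: bilinear_def\<close>)
    also have "\<dots> = (\<Sum>a\<in>UNIV. u $ a *\<^sub>R (\<Sum>b\<in>UNIV. v $ b *\<^sub>R ?\<beta> a b))"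
      by (intro sum.cong refl arg_cong[of _ _ "\<lambda>z. _ *\<^sub>R z"] linear_expand) (use \<beta> in \<open>simp add: bilinear_def\<close>)
    finally show ?thesis by (simp add: scaleR_sum_right)
  qed
  have "(\<Sum>i\<in>UNIV. \<Sum>j\<in>UNIV. ?A $ i $ j *\<^sub>R \<beta> (J (axis i 1)) (J (axis j 1)))
      = (\<Sum>(i,j)\<in>UNIV. \<Sum>(a,b)\<in>UNIV. (?A $ i $ j * ?J i a * ?J j b) *\<^sub>R ?\<beta> a b)"
    unfolding UNIV_Times_UNIV[symmetric] sum.cartesian_product[symmetric] exp[of "J _"]
    by (simp add: scaleR_sum_right mult.assoc)
  also have "\<dots> = (\<Sum>(a,b)\<in>UNIV. \<Sum>(i,j)\<in>UNIV. (?A $ i $ j * ?J i a * ?J j b) *\<^sub>R ?\<beta> a b)"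
    by (simp add: case_prod_beta) (rule sum.swap)
  also have "\<dots> = (\<Sum>a\<in>UNIV. \<Sum>b\<in>UNIV. matrix_inv B $ a $ b *\<^sub>R ?\<beta> a b)"
    unfolding UNIV_Times_UNIV[symmetric] sum.cartesian_product[symmetric]
    by (simp add: matrix_inv_pullback[OF inv J eq] scaleR_sum_left)
  finally show ?thesis .
qed

lemma local_tension_target_change:
  fixes F :: "real^'m \<Rightarrow> real^'m" and f :: "real^'n \<Rightarrow> real^'m"
  assumes W: "open W" "x \<in> W" "smooth_on W f" and S: "open S" "smooth_on S F" "f ` W \<subseteq> S"
    and pb: "pullback_on S F h h'"
    and d: "h differentiable (at (f x))" "h' differentiable (at (F (f x)))"
    and spd: "spd (h (f x))" "spd (h' (F (f x)))"
  shows "local_tension g h' (\<lambda>z. F (f z)) x = fderiv F (f x) (local_tension g h f x)"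
proof -
  have lin: "linear (fderiv F (f x))" using W S by (intro linear_fderiv smooth_on_differentiable[OF S(2)]) auto
  show ?thesis
    unfolding local_tension_sff sff_target_change[OF W S pb d spd]
    by (simp add: linear_sum[OF lin] linear_cmul[OF lin])
qed

lemma local_tension_source_change:
  fixes F :: "real^'n \<Rightarrow> real^'n" and f :: "real^'n \<Rightarrow> real^'m"
  assumes W: "open W" "x \<in> W" "smooth_on W F" and S: "open S" "smooth_on S f" "F ` W \<subseteq> S"
    and pb: "pullback_on W F g g'"
    and d: "g differentiable (at x)" "g' differentiable (at (F x))"
    and spd: "spd (g x)" "spd (g' (F x))"
  shows "local_tension g h (\<lambda>z. f (F z)) x = local_tension g' h f (F x)"
  unfolding local_tension_sff sff_source_change[OF assms]
  by (rule trace_pullback[OF spd_invertible[OF spd(1)]])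
    (use pb W S in \<open>auto simp: pullback_on_def intro!: linear_fderiv bilinear_sff[OF S(1) _ S(2)] smooth_on_differentiable\<close>)

section \<open>Charts of a Riemannian manifold\<close>

lemma fderiv2_cong:
  assumes "open W" "x \<in> W" "\<And>z. z \<in> W \<Longrightarrow> f z = f' z"
  shows "fderiv2 f x u v = fderiv2 f' x u v"
  unfolding fderiv2_def
  by (rule fun_cong[OF fderiv_cong_open[OF assms(1,2)]]) (rule fun_cong[OF fderiv_cong_open[OF assms(1) _ assms(3)]])

lemma sff_cong:
  assumes "open W" "x \<in> W" "\<And>z. z \<in> W \<Longrightarrow> f z = f' z"
  shows "sff g h f x u v = sff g h f' x u v"
  using fderiv2_cong[OF assms] fderiv_cong_open[OF assms] assms(2,3) by (simp add: sff_def)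

lemma local_tension_cong:
  assumes "open W" "x \<in> W" "\<And>z. z \<in> W \<Longrightarrow> f z = f' z"
  shows "local_tension g h f x = local_tension g h f' x"
  unfolding local_tension_sff using sff_cong[OF assms] by simp

lemma pullback_on_subset: "T \<subseteq> S \<Longrightarrow> pullback_on S F g h \<Longrightarrow> pullback_on T F g h"
  by (auto simp: pullback_on_def)

definition transition :: "('a, 'n) chart \<Rightarrow> ('a, 'n) chart \<Rightarrow> real^'n \<Rightarrow> real^'n"
  where "transition c c' = cmap c' \<circ> cinv c"

definition overlap :: "('a, 'n) chart \<Rightarrow> ('a, 'n) chart \<Rightarrow> (real^'n) set"
  where "overlap c c' = cmap c ` (cdom c \<inter> cdom c')"

locale riemannian =
  fixes M :: "('a, 'n::finite) riem"
  assumes rm: "riemannian_manifold M"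
begin

abbreviation X where "X \<equiv> space_of M"
abbreviation img where "img c \<equiv> cmap c ` cdom c"

lemma atlas: "smooth_atlas X (atlas M)"
  using rm by (simp add: riemannian_manifold_def)

lemma Hausdorff: "Hausdorff_space X" and second_countable: "second_countable X"
  using rm by (auto simp: riemannian_manifold_def)

lemma charts_cover: "(\<Union>c\<in>atlas M. cdom c) = topspace X"
  using atlas by (simp add: smooth_atlas_def)

lemma chart_exists: "p \<in> topspace X \<Longrightarrow> \<exists>c\<in>atlas M. p \<in> cdom c"
  using charts_cover by auto

lemma chart_at: "p \<in> topspace X \<Longrightarrow> chart_at M p \<in> atlas M \<and> p \<in> cdom (chart_at M p)"
  unfolding chart_at_def by (rule someI_ex) (use chart_exists in blast)

context
  fixes c assumes c: "c \<in> atlas M"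
begin

lemma openin_cdom: "openin X (cdom c)"
  and open_img: "open (img c)"
  and homeo: "homeomorphic_map (subtopology X (cdom c)) (top_of_set (img c)) (cmap c)"
  using atlas c by (auto simp: smooth_atlas_def)

lemma cdom_subset: "cdom c \<subseteq> topspace X"
  using openin_cdom openin_subset by blast

lemma inj_cmap: "inj_on (cmap c) (cdom c)"
  using homeo cdom_subset by (auto simp: homeomorphic_eq_everything_map Int_absorb1)

lemma cinv_cmap [simp]: "p \<in> cdom c \<Longrightarrow> cinv c (cmap c p) = p"
  unfolding cinv_def by (simp add: inv_into_f_f[OF inj_cmap])

lemma cmap_cinv [simp]: "x \<in> img c \<Longrightarrow> cmap c (cinv c x) = x"
  unfolding cinv_def by (rule f_inv_into_f)

lemma cinv_in [simp]: "x \<in> img c \<Longrightarrow> cinv c x \<in> cdom c"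
  unfolding cinv_def by (rule inv_into_into)

lemma cmap_image: "cmap c ` (cdom c \<inter> W) = {x \<in> img c. cinv c x \<in> W}"
  by force

lemma open_cmap_image: "openin X W \<Longrightarrow> open (cmap c ` (cdom c \<inter> W))"
proof -
  assume W: "openin X W"
  have "openin (subtopology X (cdom c)) (cdom c \<inter> W)"
    by (metis W inf_commute openin_subtopology_Int2)
  then have "openin (top_of_set (img c)) (cmap c ` (cdom c \<inter> W))"
    using homeo homeomorphic_imp_open_map open_map_def by blast
  then show ?thesis using open_img openin_open_eq by blast
qed

lemma openin_cmap_vimage: "open S \<Longrightarrow> openin X (cdom c \<inter> cmap c -` S)"
proof -
  assume S: "open S"
  have "continuous_map (subtopology X (cdom c)) (top_of_set (img c)) (cmap c)"
    using homeo homeomorphic_imp_continuous_map by blast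
  moreover have "openin (top_of_set (img c)) (img c \<inter> S)" using S by blast
  ultimately have "openin (subtopology X (cdom c)) {p \<in> topspace (subtopology X (cdom c)). cmap c p \<in> img c \<inter> S}"
    by (rule openin_continuous_map_preimage)
  moreover have "{p \<in> topspace (subtopology X (cdom c)). cmap c p \<in> img c \<inter> S} = cdom c \<inter> cmap c -` S"
    using cdom_subset by auto
  ultimately show ?thesis using openin_cdom openin_trans_full by metis
qed

lemma continuous_cinv: "continuous_map (top_of_set (img c)) X (cinv c)"
proof -
  have "openin (top_of_set (img c)) {x \<in> img c. cinv c x \<in> W}" if "openin X W" for W
    using open_cmap_image[OF that] unfolding cmap_image
    by (metis (no_types, lifting) mem_Collect_eq open_subset subsetI)
  then show ?thesis
    using cdom_subset cinv_in unfolding continuous_map by (auto simp: image_subset_iff)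
qed

lemma continuous_cmap: "continuous_map (subtopology X (cdom c)) euclidean (cmap c)"
  using homeo homeomorphic_imp_continuous_map continuous_map_into_fulltopology by blast

lemma smooth_local_metric: "smooth_on (img c) (local_metric M c)"
  using rm c by (auto simp: riemannian_manifold_def)

lemma spd_metric: "p \<in> cdom c \<Longrightarrow> spd (metric M c p)"
  using rm c by (auto simp: riemannian_manifold_def spd_def inner_at_def)

lemma spd_local_metric: "x \<in> img c \<Longrightarrow> spd (local_metric M c x)"
  unfolding local_metric_def by (intro spd_metric cinv_in)

lemma differentiable_local_metric: "x \<in> img c \<Longrightarrow> local_metric M c differentiable (at x)"
  by (rule smooth_on_differentiable[OF smooth_local_metric])

end


context
  fixes c c' assumes c: "c \<in> atlas M" and c': "c' \<in> atlas M"
begin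

lemma open_overlap: "open (overlap c c')"
  unfolding overlap_def by (rule open_cmap_image[OF c openin_cdom[OF c']])

lemma smooth_trans: "smooth_on (overlap c c') (transition c c')"
  using atlas c c' by (auto simp: smooth_atlas_def overlap_def transition_def)

lemma overlap_iff: "x \<in> overlap c c' \<longleftrightarrow> x \<in> img c \<and> cinv c x \<in> cdom c'"
  unfolding overlap_def using cmap_image[OF c, of "cdom c'"] by auto

lemma trans_cmap: "p \<in> cdom c \<Longrightarrow> transition c c' (cmap c p) = cmap c' p"
  by (simp add: transition_def c)

lemma trans_in: "x \<in> overlap c c' \<Longrightarrow> transition c c' x \<in> overlap c' c"
  by (auto simp: overlap_def transition_def c c')

lemma cinv_trans: "x \<in> overlap c c' \<Longrightarrow> cinv c' (transition c c' x) = cinv c x"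
  by (auto simp: overlap_def transition_def c c')

lemma pullback_trans: "pullback_on (overlap c c') (transition c c') (local_metric M c) (local_metric M c')"
  unfolding pullback_on_def
proof safe
  fix x u v assume "x \<in> overlap c c'"
  then obtain p where p: "p \<in> cdom c" "p \<in> cdom c'" "x = cmap c p" by (auto simp: overlap_def)
  have "inner_at M c p u v = inner_at M c' p (fderiv (transition c c') (cmap c p) u) (fderiv (transition c c') (cmap c p) v)"
  proof -
    have "\<forall>c\<in>atlas M. \<forall>c'\<in>atlas M. \<forall>p\<in>cdom c \<inter> cdom c'. \<forall>u v. inner_at M c p u v =
        inner_at M c' p (fderiv (cmap c' \<circ> cinv c) (cmap c p) u) (fderiv (cmap c' \<circ> cinv c) (cmap c p) v)"
      using rm unfolding riemannian_manifold_def Let_def by (elim conjE)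
    with c c' p show ?thesis unfolding transition_def by blast
  qed
  then show "u \<bullet> (local_metric M c x *v v) =
      fderiv (transition c c') x u \<bullet> (local_metric M c' (transition c c' x) *v fderiv (transition c c') x v)"
    using p by (simp add: inner_at_def local_metric_def trans_cmap c c')
qed

end

end

section \<open>Chart independence of the tension field\<close>

locale riemannian_pair = M: riemannian M + N: riemannian N
  for M :: "('a, 'n::finite) riem" and N :: "('b, 'm::finite) riem"
begin

lemma open_rep_domain:
  assumes "continuous_map (space_of M) (space_of N) \<psi>" "c \<in> atlas M" "openin (space_of N) W"
  shows "open (cmap c ` (cdom c \<inter> \<psi> -` W))"
proof -
  have "openin (space_of M) {p \<in> topspace (space_of M). \<psi> p \<in> W}"
    by (rule openin_continuous_map_preimage[OF assms(1,3)])
  from M.open_cmap_image[OF assms(2) this]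
  have "open (cmap c ` (cdom c \<inter> {p \<in> topspace (space_of M). \<psi> p \<in> W}))" .
  moreover have "cdom c \<inter> {p \<in> topspace (space_of M). \<psi> p \<in> W} = cdom c \<inter> \<psi> -` W"
    using M.cdom_subset[OF assms(2)] by auto
  ultimately show ?thesis by simp
qed

lemma tension_target_chart:
  assumes \<psi>: "smooth_map M N \<psi>" and c: "c \<in> atlas M" and d: "d \<in> atlas N" "d' \<in> atlas N"
    and p: "p \<in> cdom c" "\<psi> p \<in> cdom d" "\<psi> p \<in> cdom d'"
  shows "tension M N \<psi> c d' p = fderiv (transition d d') (cmap d (\<psi> p)) (tension M N \<psi> c d p)"
proof -
  let ?W = "cmap c ` (cdom c \<inter> \<psi> -` (cdom d \<inter> cdom d'))"
  let ?f = "local_rep c d \<psi>" and ?F = "transition d d'"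
  have "open ?W"
    using \<psi> by (intro open_rep_domain c openin_Int N.openin_cdom d) (simp add: smooth_map_def)
  moreover have x: "cmap c p \<in> ?W" using p by blast
  moreover have "smooth_on ?W ?f"
    by (rule smooth_on_subset[of _ "cmap c ` (cdom c \<inter> \<psi> -` cdom d)"])
      (use \<psi> c d in \<open>auto simp: smooth_map_def\<close>)
  moreover have "?f ` ?W \<subseteq> overlap d d'"
    by (auto simp: local_rep_def overlap_def c)
  moreover have fx: "?f (cmap c p) = cmap d (\<psi> p)" using p c by (simp add: local_rep_def)
  moreover have "cmap d (\<psi> p) \<in> cmap d ` cdom d" "?F (cmap d (\<psi> p)) \<in> cmap d' ` cdom d'"
    using p d by (auto simp: N.trans_cmap)
  ultimately have "local_tension (local_metric M c) (local_metric N d') (\<lambda>z. ?F (?f z)) (cmap c p)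
      = fderiv ?F (?f (cmap c p)) (local_tension (local_metric M c) (local_metric N d) ?f (cmap c p))"
    by (intro local_tension_target_change[OF _ _ _ N.open_overlap[OF d] N.smooth_trans[OF d] _ N.pullback_trans[OF d]])
      (simp_all add: N.differentiable_local_metric N.spd_local_metric d)
  moreover have "local_tension (local_metric M c) (local_metric N d') (\<lambda>z. ?F (?f z)) (cmap c p)
      = local_tension (local_metric M c) (local_metric N d') (local_rep c d' \<psi>) (cmap c p)"
    by (rule local_tension_cong[OF \<open>open ?W\<close> x]) (auto simp: local_rep_def transition_def c d)
  ultimately show ?thesis by (simp add: tension_def fx)
qed

text \<open>With the target chart fixed, the components themselves agree, because the tension is a
  trace over the source.\<close>

lemma tension_source_chart:
  assumes \<psi>: "smooth_map M N \<psi>" and c: "c \<in> atlas M" "c' \<in> atlas M" and d: "d \<in> atlas N"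
    and p: "p \<in> cdom c" "p \<in> cdom c'" "\<psi> p \<in> cdom d"
  shows "tension M N \<psi> c d p = tension M N \<psi> c' d p"
proof -
  let ?S = "cmap c' ` (cdom c' \<inter> \<psi> -` cdom d)"
  let ?W = "cmap c ` (cdom c \<inter> (cdom c' \<inter> \<psi> -` cdom d))"
  let ?f = "local_rep c' d \<psi>" and ?F = "transition c c'"
  have cont: "continuous_map (space_of M) (space_of N) \<psi>" using \<psi> by (simp add: smooth_map_def)
  have eqW: "?W = cmap c ` (cdom c \<inter> cdom c') \<inter> cmap c ` (cdom c \<inter> \<psi> -` cdom d)"
    using M.inj_cmap[OF c(1)] by (auto simp: inj_on_def)
  have "open ?W"
    unfolding eqW by (intro open_Int open_rep_domain[OF cont c(1) N.openin_cdom[OF d]] M.open_cmap_image c M.openin_cdom)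
  moreover have x: "cmap c p \<in> ?W" using p by blast
  moreover have "?W \<subseteq> overlap c c'" by (auto simp: overlap_def)
  moreover have "open ?S" by (rule open_rep_domain[OF cont c(2) N.openin_cdom[OF d]])
  moreover have "smooth_on ?S ?f" using \<psi> c d unfolding smooth_map_def by auto
  moreover have "?F ` ?W \<subseteq> ?S" by (auto simp: M.trans_cmap c)
  moreover have Fx: "?F (cmap c p) = cmap c' p" using p c by (simp add: M.trans_cmap)
  ultimately have "local_tension (local_metric M c) (local_metric N d) (\<lambda>z. ?f (?F z)) (cmap c p)
      = local_tension (local_metric M c') (local_metric N d) ?f (?F (cmap c p))"
    using p
    by (intro local_tension_source_change[OF _ _ smooth_on_subset[OF _ M.smooth_trans[OF c]], of ?W _ ?S])
      (auto simp: M.differentiable_local_metric M.spd_local_metric c intro: pullback_on_subset[OF _ M.pullback_trans[OF c]])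
  moreover have "local_tension (local_metric M c) (local_metric N d) (\<lambda>z. ?f (?F z)) (cmap c p)
      = local_tension (local_metric M c) (local_metric N d) (local_rep c d \<psi>) (cmap c p)"
    by (rule local_tension_cong[OF \<open>open ?W\<close> x]) (auto simp: local_rep_def transition_def c d)
  ultimately show ?thesis by (simp add: tension_def Fx)
qed

text \<open>Removes the arbitrary choice in \<open>chart_at\<close>: the density of the bienergy may
  be computed in whatever charts suit the geometry, here the product charts of the target.\<close>

theorem tension_norm_sq_chart:
  assumes \<psi>: "smooth_map M N \<psi>" and c: "c \<in> atlas M" and d: "d \<in> atlas N"
    and p: "p \<in> cdom c" "\<psi> p \<in> cdom d"
  shows "tension_norm_sq M N \<psi> p = inner_at N d (\<psi> p) (tension M N \<psi> c d p) (tension M N \<psi> c d p)"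
proof -
  define c' where "c' = chart_at M p"
  define d' where "d' = chart_at N (\<psi> p)"
  have c': "c' \<in> atlas M" "p \<in> cdom c'"
    using M.chart_at[of p] M.cdom_subset[OF c] p by (auto simp: c'_def)
  have d': "d' \<in> atlas N" "\<psi> p \<in> cdom d'"
    using N.chart_at[of "\<psi> p"] N.cdom_subset[OF d] p by (auto simp: d'_def)
  let ?t = "tension M N \<psi> c d p"
  have "tension M N \<psi> c' d' p = fderiv (transition d d') (cmap d (\<psi> p)) ?t"
    using tension_source_chart[OF \<psi> c c'(1) d'(1) p(1) c'(2) d'(2)]
      tension_target_chart[OF \<psi> c d d'(1) p d'(2)] by simp
  moreover have "cmap d (\<psi> p) \<in> overlap d d'" using p d' by (auto simp: overlap_def)
  then have "?t \<bullet> (local_metric N d (cmap d (\<psi> p)) *v ?t) = fderiv (transition d d') (cmap d (\<psi> p)) ?t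
      \<bullet> (local_metric N d' (cmap d' (\<psi> p)) *v fderiv (transition d d') (cmap d (\<psi> p)) ?t)"
    using N.pullback_trans[OF d d'(1)] p d by (simp add: pullback_on_def N.trans_cmap[OF d d'(1)])
  ultimately show ?thesis
    using p d d' unfolding tension_norm_sq_def Let_def c'_def[symmetric] d'_def[symmetric]
    by (simp add: inner_at_def local_metric_def)
qed

end

section \<open>Change of variables\<close>

text \<open>The formula for absolutely integrable functions is turned into one for nonnegative
  integrals. Integrability is equivalent on the two sides, and where it fails both integrals are
  infinite.\<close>

lemma nn_integral_change_of_variables_wellorder:
  fixes F :: "real^'m::{finite,wellorder} \<Rightarrow> real^'m::_" and r :: "real^'m::_ \<Rightarrow> real"
  assumes A: "A \<in> sets borel" "F ` A \<in> sets borel"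
    and F: "\<And>x. x \<in> A \<Longrightarrow> (F has_derivative F' x) (at x)" "inj_on F A"
    and meas: "(\<lambda>x. indicator A x * (\<bar>det (matrix (F' x))\<bar> * r (F x))) \<in> borel_measurable borel"
      "(\<lambda>y. indicator (F ` A) y * r y) \<in> borel_measurable borel"
    and r: "\<And>y. y \<in> F ` A \<Longrightarrow> r y \<ge> 0"
  shows "(\<integral>\<^sup>+x. ennreal (indicator A x * (\<bar>det (matrix (F' x))\<bar> * r (F x))) \<partial>lborel)
    = (\<integral>\<^sup>+y. ennreal (indicator (F ` A) y * r y) \<partial>lborel)"
proof -
  define a where "a x = \<bar>det (matrix (F' x))\<bar> * r (F x)" for x
  have Basis1: "(Basis :: (real^1) set) = {axis 1 1}" by (auto simp: Basis_vec_def)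
  \<comment> \<open>\<open>has_absolute_integral_change_of_variables\<close> speaks of vector-valued
    integrands, so a real function is read as a function into \<open>real^1\<close>.\<close>
  have vec1: "((\<lambda>x. vec (f x) :: real^1) absolutely_integrable_on S \<and> integral S (\<lambda>x. vec (f x) :: real^1) = vec t)
      \<longleftrightarrow> (f absolutely_integrable_on S \<and> integral S f = t)" for f :: "real^'m::_ \<Rightarrow> real" and S t
  proof -
    have 1: "(\<lambda>x. vec (f x) :: real^1) absolutely_integrable_on S \<longleftrightarrow> f absolutely_integrable_on S"
      by (subst absolutely_integrable_componentwise_iff) (simp add: Basis1 inner_axis)
    have 2: "integral S (\<lambda>x. vec (f x) :: real^1) = vec (integral S f)" if "f absolutely_integrable_on S"
    proof -
      have "((\<lambda>x. vec (f x) :: real^1) has_integral vec (integral S f)) S"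
        by (subst has_integral_componentwise_iff)
          (use that set_lebesgue_integral_eq_integral(1) in \<open>auto simp: Basis1 inner_axis\<close>)
      then show ?thesis by blast
    qed
    show ?thesis using 1 2 by (auto simp: vec_eq_iff)
  qed
  have "(\<lambda>x. \<bar>det (matrix (F' x))\<bar> *\<^sub>R (vec (r (F x)) :: real^1)) absolutely_integrable_on A \<and>
      integral A (\<lambda>x. \<bar>det (matrix (F' x))\<bar> *\<^sub>R (vec (r (F x)) :: real^1)) = vec t \<longleftrightarrow>
      (\<lambda>y. vec (r y) :: real^1) absolutely_integrable_on (F ` A) \<and> integral (F ` A) (\<lambda>y. vec (r y) :: real^1) = vec t" for t
    by (rule has_absolute_integral_change_of_variables)
      (use A F in \<open>auto intro: has_derivative_at_withinI\<close>)
  moreover have "c *\<^sub>R (vec s :: real^1) = vec (c * s)" for c s by (simp add: vec_eq_iff)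
  ultimately have key: "a absolutely_integrable_on A \<and> integral A a = t \<longleftrightarrow>
      r absolutely_integrable_on (F ` A) \<and> integral (F ` A) r = t" for t
    by (simp add: vec1 a_def[abs_def])
  \<comment> \<open>For Borel measurable integrands the integral over the completed Lebesgue measure
    agrees with the one over \<open>lborel\<close>.\<close>
  have conv: "f absolutely_integrable_on S \<longleftrightarrow> integrable lborel (\<lambda>x. indicator S x * f x)"
    "f absolutely_integrable_on S \<Longrightarrow> integral S f = integral\<^sup>L lborel (\<lambda>x. indicator S x * f x)"
    if "(\<lambda>x. indicator S x * f x) \<in> borel_measurable borel" for f :: "real^'m::_ \<Rightarrow> real" and S
  proof -
    show 1: "f absolutely_integrable_on S \<longleftrightarrow> integrable lborel (\<lambda>x. indicator S x * f x)"
      unfolding set_integrable_def using that by (simp add: integrable_completion)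
    show "integral S f = integral\<^sup>L lborel (\<lambda>x. indicator S x * f x)" if "f absolutely_integrable_on S"
      using set_lebesgue_integral_eq_integral(2)[OF that] that 1
      by (simp add: set_lebesgue_integral_def integral_completion)
  qed
  note ca = conv[OF meas(1)[folded a_def]] and cr = conv[OF meas(2)]
  have nn: "indicator A x * a x \<ge> 0" "indicator (F ` A) x * r x \<ge> 0" for x
    using r by (auto simp: indicator_def a_def)
  have ma: "(\<lambda>x. indicator A x * a x) \<in> borel_measurable lborel" "(\<lambda>y. indicator (F ` A) y * r y) \<in> borel_measurable lborel"
    using meas by (simp_all add: a_def)
  show ?thesis
  proof (cases "a absolutely_integrable_on A")
    case True
    then have r': "r absolutely_integrable_on (F ` A)" "integral (F ` A) r = integral A a"
      using key by blast+
    have "(\<integral>\<^sup>+x. ennreal (indicator A x * a x) \<partial>lborel) = ennreal (integral A a)"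
      using True ca nn by (simp add: nn_integral_eq_integral)
    moreover have "(\<integral>\<^sup>+x. ennreal (indicator (F ` A) x * r x) \<partial>lborel) = ennreal (integral A a)"
      using r' cr nn by (simp add: nn_integral_eq_integral)
    ultimately show ?thesis by (simp add: a_def)
  next
    case False
    then have F2: "\<not> r absolutely_integrable_on (F ` A)" using key by blast
    have inf: "(\<integral>\<^sup>+x. ennreal (f x) \<partial>lborel) = \<infinity>"
      if "\<not> integrable lborel f" "f \<in> borel_measurable lborel" "\<And>x. f x \<ge> 0" for f :: "real^'m::_ \<Rightarrow> real"
      using that by (auto simp: integrable_iff_bounded less_top[symmetric])
    show ?thesis
      using inf[OF _ ma(1) nn(1)] inf[OF _ ma(2) nn(2)] False F2 ca cr by (simp add: a_def)
  qed
qed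

text \<open>The library's change of variables formula needs a well-ordered index type. Every finite type has
  such a copy.\<close>

typedef 'n wo = "UNIV :: 'n set" by simp

instance wo :: (finite) finite
proof
  have "inj Rep_wo" by (simp add: inj_def Rep_wo_inject)
  then show "finite (UNIV :: 'a wo set)" by (rule finite_imageD[rotated]) simp
qed

text \<open>The order is pulled back along an injection into \<open>nat\<close>, which supplies the
  well-foundedness.\<close>

instantiation wo :: (finite) wellorder
begin

definition "a \<le> b \<longleftrightarrow> to_nat (Rep_wo a) \<le> to_nat (Rep_wo b)"
definition "a < b \<longleftrightarrow> to_nat (Rep_wo a) < to_nat (Rep_wo b)"

instance
proof
  fix P :: "'a wo \<Rightarrow> bool" and a
  assume step: "\<And>x. (\<And>y. y < x \<Longrightarrow> P y) \<Longrightarrow> P x"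
  have "\<forall>b. to_nat (Rep_wo b) = n \<longrightarrow> P b" for n
    by (induction n rule: less_induct) (metis step less_wo_def)
  then show "P a" by blast
qed (auto simp: less_eq_wo_def less_wo_def Rep_wo_inject)

end

section \<open>Transfer of the change of variables to arbitrary finite index types\<close>

lemma bij_Rep_wo: "bij (Rep_wo :: 'n wo \<Rightarrow> 'n)"
  by (metis Abs_wo_inverse Rep_wo_inject UNIV_I bijI injI surjI)

definition to_wo :: "real^'n \<Rightarrow> real^('n::finite wo)"
  where "to_wo x = (\<chi> i. x $ Rep_wo i)"

definition of_wo :: "real^('n::finite wo) \<Rightarrow> real^'n"
  where "of_wo y = (\<chi> i. y $ Abs_wo i)"

lemma to_of_wo [simp]: "to_wo (of_wo y) = y" "of_wo (to_wo x) = x"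
  by (simp_all add: to_wo_def of_wo_def vec_eq_iff Rep_wo_inverse Abs_wo_inverse)

lemma bounded_linear_to_wo: "bounded_linear to_wo"
  by (rule linear_conv_bounded_linear[THEN iffD1]) (auto simp: linear_iff to_wo_def vec_eq_iff)

lemma bounded_linear_of_wo: "bounded_linear of_wo"
  by (rule linear_conv_bounded_linear[THEN iffD1]) (auto simp: linear_iff of_wo_def vec_eq_iff)

lemma measurable_wo [measurable]: "to_wo \<in> borel_measurable borel" "of_wo \<in> borel_measurable borel"
  using bounded_linear_to_wo bounded_linear_of_wo
  by (auto intro!: borel_measurable_continuous_onI linear_continuous_on)

lemma prod_Basis_vec: "(\<Prod>b\<in>(Basis :: (real^'n) set). f \<bullet> b) = (\<Prod>i\<in>UNIV. f $ i)"
proof -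
  have B: "(Basis :: (real^'n) set) = range (\<lambda>i. axis i 1)" by (auto simp: Basis_vec_def)
  have "inj (\<lambda>i::'n. axis i (1::real))" by (simp add: inj_def axis_eq_axis)
  then show ?thesis unfolding B by (subst prod.reindex) (simp_all add: inner_axis)
qed

text \<open>Lebesgue measure is determined by the volumes of boxes, and renaming coordinates only
  permutes the factors of such a volume.\<close>

lemma distr_of_wo: "distr lborel borel of_wo = (lborel :: (real^'n::finite) measure)"
proof (rule lborel_eqI[symmetric])
  fix l u :: "real^'n" assume "\<And>b. b \<in> Basis \<Longrightarrow> l \<bullet> b \<le> u \<bullet> b"
  then have le: "l $ i \<le> u $ i" for i by (metis axis_in_Basis_iff cart_eq_inner_axis inner_real_def one_neq_zero Basis_real_def insertI1)
  have "of_wo -` box l u = box (to_wo l) (to_wo u)"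
    by (auto simp: mem_box_cart to_wo_def of_wo_def) (metis Abs_wo_inverse UNIV_I Rep_wo_inverse)+
  then have "emeasure (distr lborel borel of_wo) (box l u) = emeasure lborel (box (to_wo l) (to_wo u))"
    by (simp add: emeasure_distr)
  also have "\<dots> = ennreal (\<Prod>b\<in>Basis. (to_wo u - to_wo l) \<bullet> b)"
    by (rule emeasure_lborel_box) (use le in \<open>auto simp: Basis_vec_def inner_axis to_wo_def\<close>)
  also have "(\<Prod>b\<in>Basis. (to_wo u - to_wo l) \<bullet> b) = (\<Prod>i\<in>UNIV. (u - l) $ Rep_wo i)"
    by (simp add: prod_Basis_vec to_wo_def)
  also have "\<dots> = (\<Prod>i\<in>UNIV. (u - l) $ i)"
    by (rule prod.reindex_bij_betw[OF bij_Rep_wo])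
  finally show "emeasure (distr lborel borel of_wo) (box l u) = ennreal (\<Prod>b\<in>Basis. (u - l) \<bullet> b)"
    by (simp add: prod_Basis_vec)
qed simp

text \<open>Conjugation relabels the transpositions of a factorisation one by one, so it preserves
  their number.\<close>

lemma evenperm_conjugate:
  assumes h: "bij h" and p: "permutation p"
  shows "evenperm (h \<circ> p \<circ> inv h) = evenperm p"
proof -
  have inv: "inv h (h x) = x" "h (inv h y) = y" for x y
    using h by (simp_all add: bij_is_inj bij_is_surj surj_f_inv_f)
  have conj: "swapidseq n (h \<circ> p \<circ> inv h)" if "swapidseq n p" for n p
    using that
  proof induction
    case id
    have "h \<circ> id \<circ> inv h = id" by (simp add: fun_eq_iff inv)
    then show ?case by (simp only: swapidseq.id)
  next
    case (comp_Suc n p a b)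
    have eq: "h \<circ> (Transposition.transpose a b \<circ> p) \<circ> inv h = Transposition.transpose (h a) (h b) \<circ> (h \<circ> p \<circ> inv h)"
      using h by (auto simp: fun_eq_iff Transposition.transpose_def bij_is_inj inj_eq inv)
    have "h a \<noteq> h b" using comp_Suc h by (simp add: bij_is_inj inj_eq)
    then show ?case unfolding eq by (rule swapidseq.comp_Suc[OF comp_Suc.IH])
  qed
  obtain n where n: "swapidseq n p" using p permutation_def by blast
  show ?thesis using evenperm_unique[OF n refl] evenperm_unique[OF conj[OF n] refl] by simp
qed

text \<open>Conjugation by \<open>h\<close> matches the permutations of the two index types and
  preserves signs, so the Leibniz sums agree term by term. It shows that the Jacobian determinant
  survives the renaming of coordinates.\<close>

lemma det_reindex:
  fixes A :: "real^'n^'n" and h :: "'m::finite \<Rightarrow> 'n"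
  assumes h: "bij h"
  shows "det (\<chi> i j. A $ h i $ h j) = det A"
proof -
  have inv: "inv h (h x) = x" "h (inv h y) = y" for x y
    using h by (simp_all add: bij_is_inj bij_is_surj surj_f_inv_f)
  let ?c = "\<lambda>p. h \<circ> p \<circ> inv h" and ?d = "\<lambda>q. inv h \<circ> q \<circ> h"
  have bc: "bij_betw ?c {p. p permutes UNIV} {q. q permutes UNIV}"
  proof (rule bij_betwI[where g="?d"])
    have bi: "bij (inv h)" using h by (rule bij_imp_bij_inv)
    show "?c \<in> {p. p permutes UNIV} \<rightarrow> {q. q permutes UNIV}"
      "?d \<in> {q. q permutes UNIV} \<rightarrow> {p. p permutes UNIV}"
      using h bi by (auto intro!: bij_imp_permutes bij_comp permutes_bij)
  qed (auto simp: fun_eq_iff inv)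
  have "det A = (\<Sum>q\<in>{q. q permutes UNIV}. of_int (sign q) * (\<Prod>i\<in>UNIV. A $ i $ q i))"
    by (simp add: det_def)
  also have "\<dots> = (\<Sum>p\<in>{p. p permutes UNIV}. of_int (sign (?c p)) * (\<Prod>i\<in>UNIV. A $ i $ ?c p i))"
    by (rule sum.reindex_bij_betw[OF bc, symmetric])
  also have "\<dots> = (\<Sum>p\<in>{p. p permutes UNIV}. of_int (sign p) * (\<Prod>i\<in>UNIV. A $ h i $ h (p i)))"
  proof (rule sum.cong[OF refl])
    fix p :: "'m \<Rightarrow> 'm" assume "p \<in> {p. p permutes UNIV}"
    then have "permutation p" by (simp add: permutes_imp_permutation[of UNIV])
    then have "sign (?c p) = sign p" by (simp add: sign_def evenperm_conjugate[OF h])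
    moreover have "(\<Prod>i\<in>UNIV. A $ i $ ?c p i) = (\<Prod>i\<in>UNIV. A $ h i $ ?c p (h i))"
      by (rule prod.reindex_bij_betw[OF h, symmetric])
    ultimately show "of_int (sign (?c p)) * (\<Prod>i\<in>UNIV. A $ i $ ?c p i) = of_int (sign p) * (\<Prod>i\<in>UNIV. A $ h i $ h (p i))"
      by (simp add: inv)
  qed
  finally show ?thesis by (simp add: det_def)
qed

theorem nn_integral_change_of_variables:
  fixes F :: "real^'n \<Rightarrow> real^'n" and r :: "real^'n \<Rightarrow> real"
  assumes A: "A \<in> sets borel" "F ` A \<in> sets borel"
    and F: "\<And>x. x \<in> A \<Longrightarrow> (F has_derivative F' x) (at x)" "inj_on F A"
    and meas: "(\<lambda>x. indicator A x * (\<bar>det (matrix (F' x))\<bar> * r (F x))) \<in> borel_measurable borel"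
      "(\<lambda>y. indicator (F ` A) y * r y) \<in> borel_measurable borel"
    and r: "\<And>y. y \<in> F ` A \<Longrightarrow> r y \<ge> 0"
  shows "(\<integral>\<^sup>+x. ennreal (indicator A x * (\<bar>det (matrix (F' x))\<bar> * r (F x))) \<partial>lborel)
    = (\<integral>\<^sup>+y. ennreal (indicator (F ` A) y * r y) \<partial>lborel)"
proof -
  let ?A = "to_wo ` A" and ?F = "\<lambda>y. to_wo (F (of_wo y))" and ?F' = "\<lambda>y v. to_wo (F' (of_wo y) (of_wo v))"
  have mem: "y \<in> to_wo ` S \<longleftrightarrow> of_wo y \<in> S" for S and y :: "real^'n wo"
    by (metis (no_types) image_iff to_of_wo)
  have vim: "to_wo ` S = of_wo -` S" for S :: "(real^'n) set" using mem by auto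
  have FA: "?F ` ?A = to_wo ` (F ` A)" by (simp add: image_image)
  have ind: "indicator (to_wo ` S) y = (indicator S (of_wo y) :: real)" for S and y :: "real^'n wo"
    by (simp add: indicator_def mem)
  have det: "det (matrix (?F' y)) = det (matrix (F' (of_wo y)))" for y
  proof -
    have ax: "of_wo (axis j 1) = axis (Rep_wo j) (1::real)" for j :: "'n wo"
      by (auto simp: of_wo_def axis_def vec_eq_iff Rep_wo_inverse Abs_wo_inverse)
    have "matrix (?F' y) = (\<chi> i j. matrix (F' (of_wo y)) $ Rep_wo i $ Rep_wo j)"
      by (simp add: matrix_def vec_eq_iff to_wo_def ax)
    then show ?thesis using det_reindex[OF bij_Rep_wo] by simp
  qed
  have nn: "(\<integral>\<^sup>+y. f (of_wo y) \<partial>lborel) = (\<integral>\<^sup>+x. f x \<partial>lborel)"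
    if "f \<in> borel_measurable borel" for f :: "real^'n \<Rightarrow> ennreal"
  proof -
    have "(\<integral>\<^sup>+x. f x \<partial>lborel) = (\<integral>\<^sup>+x. f x \<partial>distr lborel borel of_wo)" by (simp add: distr_of_wo)
    also have "\<dots> = (\<integral>\<^sup>+y. f (of_wo y) \<partial>lborel)"
      using that by (intro nn_integral_distr) simp_all
    finally show ?thesis by simp
  qed
  have "(\<integral>\<^sup>+y. ennreal (indicator ?A y * (\<bar>det (matrix (?F' y))\<bar> * r (of_wo (?F y)))) \<partial>lborel)
    = (\<integral>\<^sup>+y. ennreal (indicator (?F ` ?A) y * r (of_wo y)) \<partial>lborel)"
  proof (rule nn_integral_change_of_variables_wellorder)
    have "to_wo ` S \<in> sets borel" if "S \<in> sets borel" for S :: "(real^'n) set"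
      using measurable_sets[OF measurable_wo(2) that] by (simp add: vim)
    with A show "?A \<in> sets borel" "?F ` ?A \<in> sets borel"
      unfolding FA by blast+
    show "(?F has_derivative ?F' x) (at x)" if "x \<in> ?A" for x
    proof -
      have "(of_wo has_derivative of_wo) (at x)" for x :: "real^'n wo"
        by (rule bounded_linear_imp_has_derivative[OF bounded_linear_of_wo])
      moreover have "(F has_derivative F' (of_wo x)) (at (of_wo x))" using F that mem by blast
      ultimately have "((\<lambda>y. F (of_wo y)) has_derivative (\<lambda>v. F' (of_wo x) (of_wo v))) (at x)"
        by (rule has_derivative_compose)
      then show ?thesis by (rule bounded_linear.has_derivative[OF bounded_linear_to_wo])
    qed
    show "inj_on ?F ?A"
      using F(2) by (auto simp: inj_on_def) (metis to_of_wo(2))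
    show "(\<lambda>x. indicator ?A x * (\<bar>det (matrix (?F' x))\<bar> * r (of_wo (?F x)))) \<in> borel_measurable borel"
      using measurable_compose[OF measurable_wo(2) meas(1)] by (simp add: ind det)
    show "(\<lambda>y. indicator (?F ` ?A) y * r (of_wo y)) \<in> borel_measurable borel"
      using measurable_compose[OF measurable_wo(2) meas(2)] unfolding FA by (simp add: ind)
  qed (use r in auto)
  then show ?thesis
    using nn[of "\<lambda>x. ennreal (indicator A x * (\<bar>det (matrix (F' x))\<bar> * r (F x)))"]
      nn[of "\<lambda>y. ennreal (indicator (F ` A) y * r y)"] meas
    unfolding FA by (simp add: ind det)
qed

section \<open>The Riemannian volume measure\<close>

lemma det_pullback:
  fixes A B :: "real^'n^'n"
  assumes J: "linear J" and eq: "\<And>u v. u \<bullet> (A *v v) = J u \<bullet> (B *v J v)"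
  shows "det A = (det (matrix J))\<^sup>2 * det B"
  using matrix_pullback[OF assms, symmetric] by (simp add: det_mul det_transpose power2_eq_square)

text \<open>The segment from the identity to a positive definite matrix consists of invertible matrices.\<close>

lemma spd_det_pos:
  fixes A :: "real^'n^'n"
  assumes "spd A"
  shows "det A > 0"
proof (rule ccontr)
  let ?B = "\<lambda>t. t *\<^sub>R A + (1 - t) *\<^sub>R mat 1"
  assume "\<not> det A > 0"
  then have "det (?B 1) \<le> 0" "0 \<le> det (?B 0)" by auto
  moreover have "continuous_on {0..1} (\<lambda>t. det (?B t))"
    unfolding det_def by (intro continuous_intros)
  ultimately obtain t where t: "0 \<le> t" "t \<le> 1" "det (?B t) = 0"
    using IVT2'[of "\<lambda>t. det (?B t)" 1 0 0] by auto
  have pos: "v \<bullet> (?B t *v v) > 0" if "v \<noteq> 0" for v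
  proof -
    have "v \<bullet> (A *v v) > 0" "v \<bullet> v > 0" using that assms by (auto simp: spd_def)
    moreover have "v \<bullet> (?B t *v v) = t * (v \<bullet> (A *v v)) + (1 - t) * (v \<bullet> v)"
      by (simp add: matrix_vector_mult_add_rdistrib scaleR_matrix_vector_assoc[symmetric] inner_add_right)
    ultimately show ?thesis using t
      by (cases "t = 0") (auto intro: add_pos_nonneg)
  qed
  then have "\<forall>x. ?B t *v x = 0 \<longrightarrow> x = 0" by (metis inner_zero_right less_irrefl)
  then have "invertible (?B t)" using invertible_left_inverse matrix_left_invertible_ker by blast
  then show False using t by (simp add: invertible_det_nz)
qed

lemma indicator_UN_eq_suminf:
  assumes "disjoint_family A"
  shows "indicator (\<Union>i. A i) x = (\<Sum>i. indicator (A i) x :: ennreal)"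
  using suminf_indicator[OF assms] by simp

context riemannian
begin

text \<open>The topology of \<open>X\<close> is a value and not a type class instance, so its Borel
  sets are generated explicitly.\<close>

definition borelM where "borelM = sigma (topspace X) {U. openin X U}"

lemma open_Pow: "{U. openin X U} \<subseteq> Pow (topspace X)"
  using openin_subset by auto

lemma space_borelM: "space borelM = topspace X"
  and sets_borelM: "sets borelM = sigma_sets (topspace X) {U. openin X U}"
  using open_Pow by (simp_all add: borelM_def space_measure_of_conv sets_measure_of)

lemma openin_borelM: "openin X U \<Longrightarrow> U \<in> sets borelM"
  by (simp add: sets_borelM)

definition dens where "dens c x = sqrt (det (local_metric M c x))"

context
  fixes c assumes c: "c \<in> atlas M"
begin

lemma img_borel: "img c \<in> sets borel"
  using open_img[OF c] by simp

lemma cdom_borelM: "cdom c \<in> sets borelM"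
  using openin_cdom[OF c] openin_borelM by blast

lemma cinv_measurable: "cinv c \<in> measurable (restrict_space borel (img c)) borelM"
  unfolding borelM_def
proof (rule measurable_measure_of[OF open_Pow])
  show "cinv c \<in> space (restrict_space borel (img c)) \<rightarrow> topspace X"
    using cinv_in[OF c] cdom_subset[OF c] by (auto simp: space_restrict_space)
  fix U assume "U \<in> {U. openin X U}"
  then have "open (cmap c ` (cdom c \<inter> U))" using open_cmap_image[OF c] by blast
  moreover have "cinv c -` U \<inter> space (restrict_space borel (img c)) = cmap c ` (cdom c \<inter> U)"
    unfolding cmap_image[OF c] by (auto simp: space_restrict_space)
  ultimately show "cinv c -` U \<inter> space (restrict_space borel (img c)) \<in> sets (restrict_space borel (img c))"
    using img_borel by (auto simp: sets_restrict_space_iff)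
qed

lemma borel_cmap_image: "A \<in> sets borelM \<Longrightarrow> cmap c ` (cdom c \<inter> A) \<in> sets borel"
proof -
  assume "A \<in> sets borelM"
  from measurable_sets[OF cinv_measurable this]
  have "cinv c -` A \<inter> img c \<in> sets (restrict_space borel (img c))" by (simp add: space_restrict_space)
  moreover have "cinv c -` A \<inter> img c = cmap c ` (cdom c \<inter> A)"
    unfolding cmap_image[OF c] by auto
  ultimately show ?thesis using img_borel by (auto simp: sets_restrict_space_iff)
qed

lemma borel_cmap_image': "A \<in> sets borelM \<Longrightarrow> A \<subseteq> cdom c \<Longrightarrow> cmap c ` A \<in> sets borel"
  using borel_cmap_image[of A] by (simp add: Int_absorb1)

lemma C1_local_metric: "C1_on (img c) (\<lambda>x. local_metric M c x $ i $ j)"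
  by (intro C1_on_vec_nth open_img c smooth_on_C1 smooth_local_metric)

lemma dens_pos: "x \<in> img c \<Longrightarrow> dens c x > 0"
  using spd_det_pos[OF spd_local_metric[OF c]] by (simp add: dens_def)

lemma C1_dens: "C1_on (img c) (dens c)"
  unfolding dens_def[abs_def]
  by (intro C1_on_sqrt C1_on_det open_img c C1_local_metric spd_det_pos spd_local_metric)

lemma dens_measurable:
  assumes "B \<in> sets borel" "B \<subseteq> img c"
  shows "(\<lambda>x. indicator B x * dens c x) \<in> borel_measurable borel"
proof -
  have "(\<lambda>x. indicator (img c) x *\<^sub>R dens c x) \<in> borel_measurable borel"
    by (rule borel_measurable_continuous_on_indicator[OF img_borel C1_on_continuous_on[OF C1_dens]])
  then have "(\<lambda>x. indicator B x * (indicator (img c) x *\<^sub>R dens c x)) \<in> borel_measurable borel"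
    using assms(1) by measurable
  moreover have "indicator B x * (indicator (img c) x *\<^sub>R dens c x) = indicator B x * dens c x" for x
    using assms(2) by (auto simp: indicator_def)
  ultimately show ?thesis by (simp only:)
qed

definition vol_in where "vol_in A = (\<integral>\<^sup>+x\<in>cmap c ` A. ennreal (dens c x) \<partial>lborel)"

lemma vol_in_eq: "vol_in A = (\<integral>\<^sup>+x. ennreal (indicator (cmap c ` A) x * dens c x) \<partial>lborel)"
  unfolding vol_in_def by (intro nn_integral_cong) (auto simp: indicator_def)

lemma dens_ennreal_measurable:
  "A \<in> sets borelM \<Longrightarrow> A \<subseteq> cdom c \<Longrightarrow>
   (\<lambda>x. ennreal (dens c x) * indicator (cmap c ` A) x) \<in> borel_measurable lborel"
proof -
  assume A: "A \<in> sets borelM" "A \<subseteq> cdom c"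
  then have "(\<lambda>x. ennreal (indicator (cmap c ` A) x * dens c x)) \<in> borel_measurable lborel"
    using dens_measurable[OF borel_cmap_image'[OF A]] by (simp add: image_mono)
  moreover have "ennreal (indicator (cmap c ` A) x * dens c x) = ennreal (dens c x) * indicator (cmap c ` A) x" for x
    by (auto simp: indicator_def)
  ultimately show ?thesis by simp
qed

lemma vol_in_UN:
  fixes A :: "nat \<Rightarrow> 'a set"
  assumes A: "\<And>i. A i \<in> sets borelM" "\<And>i. A i \<subseteq> cdom c" "disjoint_family A"
  shows "vol_in (\<Union>i. A i) = (\<Sum>i. vol_in (A i))"
proof -
  have d: "disjoint_family (\<lambda>i. cmap c ` A i)"
    using A(2,3) inj_on_image_Int[OF inj_cmap[OF c]] unfolding disjoint_family_on_def
    by (metis image_empty)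
  have "vol_in (\<Union>i. A i) = (\<integral>\<^sup>+x. (\<Sum>i. ennreal (dens c x) * indicator (cmap c ` A i) x) \<partial>lborel)"
    unfolding vol_in_def image_UN by (simp add: indicator_UN_eq_suminf[OF d])
  also have "\<dots> = (\<Sum>i. vol_in (A i))"
    unfolding vol_in_def by (rule nn_integral_suminf) (rule dens_ennreal_measurable[OF A(1,2)])
  finally show ?thesis .
qed

end

text \<open>The determinant of the metric picks up the squared Jacobian, so \<open>dens\<close>
  picks up its absolute value. This is the factor in the change of variables.\<close>

lemma vol_in_chart_change:
  assumes c: "c \<in> atlas M" "c' \<in> atlas M" and A: "A \<in> sets borelM" "A \<subseteq> cdom c" "A \<subseteq> cdom c'"
  shows "vol_in c A = vol_in c' A"
proof -
  let ?F = "transition c c'" and ?A = "cmap c ` A"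
  have FA: "?F ` ?A = cmap c' ` A"
    using A(2) by (force simp: image_image trans_cmap[OF c] cong: image_cong)
  have sub: "?A \<subseteq> overlap c c'" using A(2,3) by (auto simp: overlap_def)
  have dd: "\<bar>det (matrix (fderiv ?F x))\<bar> * dens c' (?F x) = dens c x" if "x \<in> overlap c c'" for x
  proof -
    have "det (local_metric M c x) = (det (matrix (fderiv ?F x)))\<^sup>2 * det (local_metric M c' (?F x))"
      by (rule det_pullback)
        (use pullback_trans[OF c] that smooth_on_differentiable[OF smooth_trans[OF c] that] in
          \<open>auto simp: pullback_on_def intro: linear_fderiv\<close>)
    then show ?thesis by (simp add: dens_def real_sqrt_mult)
  qed
  have ind: "indicator ?A x * (\<bar>det (matrix (fderiv ?F x))\<bar> * dens c' (?F x)) = indicator ?A x * dens c x" for x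
    using dd sub by (auto simp: indicator_def)
  have Fsub: "cmap c' ` A \<subseteq> img c'" using A(3) by auto
  have "(\<integral>\<^sup>+x. ennreal (indicator ?A x * (\<bar>det (matrix (fderiv ?F x))\<bar> * dens c' (?F x))) \<partial>lborel)
    = (\<integral>\<^sup>+y. ennreal (indicator (?F ` ?A) y * dens c' y) \<partial>lborel)"
  proof (rule nn_integral_change_of_variables)
    show "?A \<in> sets borel" using borel_cmap_image'[OF c(1) A(1,2)] .
    show "?F ` ?A \<in> sets borel" unfolding FA using borel_cmap_image'[OF c(2) A(1,3)] .
    show "(?F has_derivative fderiv ?F x) (at x)" if "x \<in> ?A" for x
      using smooth_on_differentiable[OF smooth_trans[OF c]] sub that by (blast intro: has_fderiv)
    show "inj_on ?F ?A"
      using A inj_cmap[OF c(2)] by (auto simp: inj_on_def trans_cmap[OF c] subset_iff) metis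
    show "(\<lambda>x. indicator ?A x * (\<bar>det (matrix (fderiv ?F x))\<bar> * dens c' (?F x))) \<in> borel_measurable borel"
      unfolding ind by (rule dens_measurable[OF c(1) borel_cmap_image'[OF c(1) A(1,2)]]) (use A in auto)
    show "(\<lambda>y. indicator (?F ` ?A) y * dens c' y) \<in> borel_measurable borel"
      unfolding FA by (rule dens_measurable[OF c(2) borel_cmap_image'[OF c(2) A(1,3)]]) (use A in auto)
    show "dens c' y \<ge> 0" if "y \<in> ?F ` ?A" for y
      using dens_pos[OF c(2), of y] that Fsub unfolding FA by (auto intro: less_imp_le)
  qed
  then show ?thesis unfolding vol_in_eq[OF c(1)] vol_in_eq[OF c(2)] ind FA by simp
qed

lemma emeasure_volume_chart:
  "is_volume_measure M \<mu> \<Longrightarrow> c \<in> atlas M \<Longrightarrow> A \<in> sets borelM \<Longrightarrow> A \<subseteq> cdom c \<Longrightarrow> emeasure \<mu> A = vol_in c A"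
  by (simp add: is_volume_measure_def vol_in_def dens_def sets_borelM)

text \<open>Second countability gives the Lindelof property, hence a countable subcover by chart
  domains. It is nonempty because the space is, so \<open>nat\<close> can enumerate it with
  repetitions.\<close>

lemma countable_charts:
  assumes "topspace X \<noteq> {}"
  obtains C :: "nat \<Rightarrow> ('a, 'n) chart" where "range C \<subseteq> atlas M" "(\<Union>k. cdom (C k)) = topspace X"
proof -
  have "Lindelof_space X" using second_countable second_countable_imp_Lindelof_space by blast
  then obtain V where V: "countable V" "V \<subseteq> cdom ` atlas M" "\<Union>V = topspace X"
    using charts_cover openin_cdom unfolding Lindelof_space_def by (metis (no_types, lifting) image_iff)
  obtain S where S: "countable S" "S \<subseteq> atlas M" "V = cdom ` S"
    using V countable_subset_image[of V cdom "atlas M"] by blast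
  have ne: "S \<noteq> {}" using assms V S by (metis Union_empty image_empty)
  have "range (from_nat_into S) = S" using S ne by (simp add: range_from_nat_into)
  then show ?thesis using that[of "from_nat_into S"] S V by (metis image_image)
qed

text \<open>Existence is by gluing the chart volumes along a countable disjoint decomposition into
  pieces of charts. Uniqueness follows because the prescribed values on these pieces determine a
  measure by countable additivity.\<close>

theorem is_volume_measure_ex1:
  assumes "topspace X \<noteq> {}"
  shows "\<exists>!\<mu>. is_volume_measure M \<mu>"
proof -
  obtain C :: "nat \<Rightarrow> ('a, 'n) chart" where C: "range C \<subseteq> atlas M" "(\<Union>k. cdom (C k)) = topspace X"
    by (rule countable_charts[OF assms])
  have Ck: "C k \<in> atlas M" for k using C by auto
  define P where "P k = disjointed (\<lambda>k. cdom (C k)) k" for k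
  have Psub: "P k \<subseteq> cdom (C k)" for k unfolding P_def by (rule disjointed_subset)
  have Pdisj: "disjoint_family P" unfolding P_def by (rule disjoint_family_disjointed)
  have Pdisj': "disjoint_family (\<lambda>k. A \<inter> P k)" for A
    by (rule disjoint_family_on_bisimulation[OF Pdisj]) auto
  have PUN: "(\<Union>k. P k) = topspace X" unfolding P_def by (simp add: UN_disjointed_eq C)
  have Pm: "P k \<in> sets borelM" for k
    using sets.range_disjointed_sets[of "\<lambda>k. cdom (C k)" borelM] cdom_borelM[OF Ck] unfolding P_def by auto
  define vol where "vol A = (\<Sum>k. vol_in (C k) (A \<inter> P k))" for A
  \<comment> \<open>All pieces of a set inside \<open>cdom c\<close> can be measured in
    \<open>c\<close> itself, so the sum does not depend on the charts that carry the
    decomposition.\<close>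
  have split: "vol A = vol_in c A" if "c \<in> atlas M" "A \<in> sets borelM" "A \<subseteq> cdom c" for c A
  proof -
    have "vol A = (\<Sum>k. vol_in c (A \<inter> P k))"
      unfolding vol_def using that Pm Psub by (intro suminf_cong vol_in_chart_change Ck) auto
    also have "\<dots> = vol_in c (\<Union>k. A \<inter> P k)"
      by (rule vol_in_UN[symmetric])
        (use that Pm Pdisj' in auto)
    also have "(\<Union>k. A \<inter> P k) = A"
      using PUN that cdom_subset[OF that(1)] by auto
    finally show ?thesis .
  qed
  define \<mu> where "\<mu> = measure_of (topspace X) (sets borelM) vol"
  have sets: "sets \<mu> = sets borelM" "space \<mu> = topspace X"
    unfolding \<mu>_def using sets.sets_into_space[of _ borelM] sets.space_closed[of borelM]
    by (auto simp: space_borelM sets_borelM sigma_sets_sigma_sets_eq[OF open_Pow] space_measure_of_conv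
         sets_measure_of sigma_sets_into_sp[OF open_Pow] subset_iff sigma_sets_sigma_sets_eq)
  have em: "emeasure \<mu> A = vol A" if "A \<in> sets borelM" for A
  proof (rule emeasure_measure_of[OF \<mu>_def])
    show "sets borelM \<subseteq> Pow (topspace X)" using sets.space_closed[of borelM] by (simp add: space_borelM)
    show "A \<in> sets \<mu>" using that sets by simp
    show "positive (sets \<mu>) vol" by (simp add: positive_def vol_def vol_in_def[OF Ck])
    show "countably_additive (sets \<mu>) vol"
      unfolding countably_additive_def
    proof safe
      fix A :: "nat \<Rightarrow> 'a set"
      assume A: "range A \<subseteq> sets \<mu>" "disjoint_family A"
      have "vol (\<Union>i. A i) = (\<Sum>k. \<Sum>i. vol_in (C k) (A i \<inter> P k))"
        unfolding vol_def Int_UN_distrib2[symmetric]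
      proof (rule suminf_cong)
        fix k
        have "vol_in (C k) (\<Union>i. A i \<inter> P k) = (\<Sum>i. vol_in (C k) (A i \<inter> P k))"
          by (rule vol_in_UN[OF Ck])
            (use A Pm Psub in \<open>auto simp: sets intro: disjoint_family_on_bisimulation[OF A(2)]\<close>)
        then show "vol_in (C k) ((\<Union>i. A i) \<inter> P k) = (\<Sum>i. vol_in (C k) (A i \<inter> P k))" by simp
      qed
      \<comment> \<open>Tonelli for double series, with one summation read as an integral against
        counting measure.\<close>
      also have "\<dots> = (\<Sum>i. \<Sum>k. vol_in (C k) (A i \<inter> P k))"
        using nn_integral_suminf[of "\<lambda>i k. vol_in (C k) (A i \<inter> P k)" "count_space UNIV"]
        by (simp add: nn_integral_count_space_nat)
      finally show "(\<Sum>i. vol (A i)) = vol (\<Union>i. A i)" by (simp add: vol_def)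
    qed
  qed
  show ?thesis
  proof (rule ex1I[of _ \<mu>])
    show "is_volume_measure M \<mu>"
      unfolding is_volume_measure_def using sets em split by (auto simp: sets_borelM vol_in_def dens_def)
    fix \<nu> assume \<nu>: "is_volume_measure M \<nu>"
    then have s: "sets \<nu> = sets borelM" by (simp add: is_volume_measure_def sets_borelM)
    show "\<nu> = \<mu>"
    proof (rule measure_eqI)
      show "sets \<nu> = sets \<mu>" using s sets by simp
      fix A assume "A \<in> sets \<nu>"
      then have A: "A \<in> sets borelM" using s by simp
      have "A = (\<Union>k. A \<inter> P k)" using PUN sets.sets_into_space[OF A] by (auto simp: space_borelM)
      then have "emeasure \<nu> A = emeasure \<nu> (\<Union>k. A \<inter> P k)" by simp
      also have "\<dots> = (\<Sum>k. emeasure \<nu> (A \<inter> P k))"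
        by (rule suminf_emeasure[symmetric]) (use A Pm s Pdisj' in auto)
      also have "\<dots> = vol A"
        unfolding vol_def using A Pm Psub
        by (intro suminf_cong emeasure_volume_chart[OF \<nu> Ck]) auto
      finally show "emeasure \<nu> A = emeasure \<mu> A" by (simp add: em A)
    qed
  qed
qed

end

section \<open>Differentiation under the integral sign\<close>

text \<open>The difference quotients are dominated by the constant \<open>C\<close> on a set of
  finite measure. The bound compares with time 0 only, so a derivative is required at time 0 and at
  no other time.\<close>

lemma has_derivative_set_integral:
  fixes e :: "real \<Rightarrow> 'a \<Rightarrow> real"
  assumes K: "K \<in> sets \<mu>" "emeasure \<mu> K < \<infinity>" and \<delta>: "\<delta> > 0"
    and int: "\<And>t. \<bar>t\<bar> < \<delta> \<Longrightarrow> set_integrable \<mu> K (e t)"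
    and lip: "\<And>q t. q \<in> K \<Longrightarrow> \<bar>t\<bar> < \<delta> \<Longrightarrow> \<bar>e t q - e 0 q\<bar> \<le> C * \<bar>t\<bar>"
    and der: "\<And>q. q \<in> K \<Longrightarrow> ((\<lambda>t. e t q) has_real_derivative e' q) (at 0)"
  shows "((\<lambda>t. LINT q:K|\<mu>. e t q) has_real_derivative (LINT q:K|\<mu>. e' q)) (at 0)"
proof -
  define E where "E t = (LINT q:K|\<mu>. e t q)" for t
  have "((\<lambda>h. (E (0 + h) - E 0) / h) \<longlongrightarrow> (LINT q:K|\<mu>. e' q)) (at 0)"
    unfolding tendsto_at_iff_sequentially
  proof (intro allI impI)
    fix T :: "nat \<Rightarrow> real" assume T: "\<forall>i. T i \<in> UNIV - {0}" "T \<longlonglongrightarrow> 0"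
    have "eventually (\<lambda>i. \<bar>T i\<bar> < \<delta>) sequentially"
      using T(2) \<delta> by (auto simp: tendsto_iff dist_real_def)
    then obtain N where N: "\<And>i. i \<ge> N \<Longrightarrow> \<bar>T i\<bar> < \<delta>" by (auto simp: eventually_sequentially)
    \<comment> \<open>The difference quotient along the tail of the sequence, where the times are
      below \<open>\<delta>\<close> and the Lipschitz bound applies.\<close>
    define s where "s i q = indicator K q * ((e (T (i + N)) q - e 0 q) / T (i + N))" for i q
    have small: "\<bar>T (i + N)\<bar> < \<delta>" "T (i + N) \<noteq> 0" for i using N T by auto
    have si: "set_integrable \<mu> K (\<lambda>q. (e (T (i + N)) q - e 0 q) / T (i + N))" for i
      using small[of i] \<delta> by (intro set_integrable_divide set_integral_diff int) auto
    then have sm: "s i \<in> borel_measurable \<mu>" for i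
      unfolding s_def set_integrable_def by (simp add: borel_measurable_integrable)
    have lim: "(\<lambda>i. s i q) \<longlonglongrightarrow> indicator K q * e' q" for q
    proof (cases "q \<in> K")
      case True
      then have "((\<lambda>h. (e h q - e 0 q) / h) \<longlongrightarrow> e' q) (at 0)"
        using der[OF True] by (simp add: DERIV_def)
      moreover have "(\<lambda>i. T (i + N)) \<longlonglongrightarrow> 0" using T(2) by (rule LIMSEQ_ignore_initial_segment)
      ultimately have "(\<lambda>i. (e (T (i + N)) q - e 0 q) / T (i + N)) \<longlonglongrightarrow> e' q"
        using T(1) unfolding tendsto_at_iff_sequentially by (auto simp: comp_def)
      then show ?thesis using True by (simp add: s_def)
    qed (simp add: s_def)
    \<comment> \<open>The derivative is measurable as a pointwise limit of measurable difference
      quotients.\<close>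
    have m': "(\<lambda>q. indicator K q * e' q) \<in> borel_measurable \<mu>"
      by (rule borel_measurable_LIMSEQ_real[OF lim sm])
    have "(\<lambda>i. LINT q|\<mu>. s i q) \<longlonglongrightarrow> (LINT q|\<mu>. indicator K q * e' q)"
    proof (rule integral_dominated_convergence[where w="\<lambda>q. indicator K q * \<bar>C\<bar>"])
      show "integrable \<mu> (\<lambda>q. indicator K q * \<bar>C\<bar>)" using K by simp
      show "AE q in \<mu>. norm (s i q) \<le> indicator K q * \<bar>C\<bar>" for i
      proof (rule AE_I2)
        fix q
        have "\<bar>(e (T (i + N)) q - e 0 q) / T (i + N)\<bar> \<le> \<bar>C\<bar>" if "q \<in> K"
        proof -
          have "\<bar>e (T (i + N)) q - e 0 q\<bar> \<le> \<bar>C\<bar> * \<bar>T (i + N)\<bar>"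
            using lip[OF that small(1)[of i]] by (meson abs_ge_self abs_ge_zero mult_right_mono order_trans)
          then show ?thesis using small(2)[of i] by (simp add: divide_simps)
        qed
        then show "norm (s i q) \<le> indicator K q * \<bar>C\<bar>" by (simp add: s_def indicator_def)
      qed
    qed (use sm m' lim in auto)
    moreover have "(LINT q|\<mu>. s i q) = (E (T (i + N)) - E 0) / T (i + N)" for i
      unfolding E_def using small[of i] \<delta>
      by (subst set_integral_diff(2)[symmetric])
        (auto intro!: int simp: s_def[abs_def] set_lebesgue_integral_def)
    ultimately have "(\<lambda>i. (E (T (i + N)) - E 0) / T (i + N)) \<longlonglongrightarrow> (LINT q:K|\<mu>. e' q)"
      by (simp add: set_lebesgue_integral_def)
    then show "((\<lambda>h. (E (0 + h) - E 0) / h) \<circ> T) \<longlonglongrightarrow> (LINT q:K|\<mu>. e' q)"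
      unfolding comp_def add_0 by (rule LIMSEQ_offset[where k=N])
  qed
  then show ?thesis by (simp add: DERIV_def E_def)
qed

text \<open>By translation invariance the integral of \<open>u (x + t v)\<close> does not depend on \<open>t\<close>.\<close>

lemma integral_fderiv_compact_support:
  fixes u :: "'v::euclidean_space \<Rightarrow> real"
  assumes u: "C1_on UNIV u" and C: "compact C" "\<And>x. x \<notin> C \<Longrightarrow> u x = 0"
  shows "integral\<^sup>L lborel (\<lambda>x. fderiv u x v) = 0"
proof -
  obtain R where R: "R > 0" "\<And>x. x \<in> C \<Longrightarrow> norm x \<le> R"
    using compact_imp_bounded[OF C(1)] bounded_pos by metis
  \<comment> \<open>The margin \<open>norm v\<close> makes room for the supports of all translates
    with \<open>\<bar>t\<bar> < 1\<close>, so integrating over \<open>K\<close> is integrating over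
    the whole space.\<close>
  define K where "K = cball (0::'v) (R + norm v)"
  have cu: "continuous_on UNIV u" by (rule C1_on_continuous_on[OF u])
  have cdu: "continuous_on UNIV (\<lambda>x. fderiv u x v)" by (rule C1_on_fderiv[OF u])
  have uz: "u x = 0" if "norm x > R" for x using C(2) R(2) that by force
  have duz: "fderiv u x v = 0" if "norm x > R" for x
  proof -
    have "open {x::'v. norm x > R}" by (intro open_Collect_less continuous_intros)
    then have "fderiv u x = fderiv (\<lambda>_. 0) x"
      by (rule fderiv_cong_open) (use uz that in auto)
    then show ?thesis by simp
  qed
  have shift: "u (x + t *\<^sub>R v) = 0" if "x \<notin> K" "\<bar>t\<bar> < 1" for x t
  proof -
    have "\<bar>t\<bar> * norm v \<le> 1 * norm v" using that by (intro mult_right_mono) auto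
    moreover have "norm x \<le> norm (x + t *\<^sub>R v) + norm (t *\<^sub>R v)"
      using norm_triangle_ineq4[of "x + t *\<^sub>R v" "t *\<^sub>R v"] by simp
    ultimately show ?thesis using that by (intro uz) (auto simp: K_def)
  qed
  have "bounded ((\<lambda>x. fderiv u x v) ` cball 0 R)"
    by (intro compact_imp_bounded compact_continuous_image continuous_on_subset[OF cdu]) auto
  then obtain B where B: "B > 0" "\<And>x. norm x \<le> R \<Longrightarrow> \<bar>fderiv u x v\<bar> \<le> B"
    unfolding bounded_pos by auto
  have B': "\<bar>fderiv u x v\<bar> \<le> B" for x
    using B duz[of x] by (cases "norm x \<le> R") auto
  have dt: "((\<lambda>t. u (x + t *\<^sub>R v)) has_real_derivative fderiv u (x + t *\<^sub>R v) v) (at t)" for x t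
  proof -
    have d: "(u has_derivative fderiv u (x + t *\<^sub>R v)) (at (x + t *\<^sub>R v))"
      using C1_on_has_derivative[OF u] by simp
    have "((\<lambda>t. x + t *\<^sub>R v) has_derivative (\<lambda>h. h *\<^sub>R v)) (at t)"
      by (auto intro!: derivative_eq_intros)
    from has_derivative_compose[OF this d]
    moreover have "(\<lambda>h. fderiv u (x + t *\<^sub>R v) (h *\<^sub>R v)) = (*) (fderiv u (x + t *\<^sub>R v) v)"
      using linear_cmul[OF has_derivative_linear[OF d]] by (simp add: fun_eq_iff mult.commute)
    ultimately show ?thesis by (simp add: has_field_derivative_def)
  qed
  have lip: "\<bar>u (x + t *\<^sub>R v) - u (x + 0 *\<^sub>R v)\<bar> \<le> B * \<bar>t\<bar>" for x t
    using field_differentiable_bound[of UNIV "\<lambda>t. u (x + t *\<^sub>R v)" "\<lambda>t. fderiv u (x + t *\<^sub>R v) v" B t 0]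
      dt B' by (simp add: has_field_derivative_at_within)
  have eq: "(LINT x:K|lborel. u (x + t *\<^sub>R v)) = integral\<^sup>L lborel u" if "\<bar>t\<bar> < 1" for t
  proof -
    have "(LINT x:K|lborel. u (x + t *\<^sub>R v)) = (LINT x|lborel. u (t *\<^sub>R v + x))"
      unfolding set_lebesgue_integral_def
      by (rule Bochner_Integration.integral_cong) (use shift[OF _ that] in \<open>auto simp: indicator_def add.commute\<close>)
    also have "\<dots> = integral\<^sup>L (distr lborel borel ((+) (t *\<^sub>R v))) u"
      by (rule integral_distr[symmetric])
        (use borel_measurable_continuous_onI[OF cu] in auto)
    finally show ?thesis by (simp add: lborel_distr_plus)
  qed
  have "((\<lambda>t. LINT x:K|lborel. u (x + t *\<^sub>R v)) has_real_derivative (LINT x:K|lborel. fderiv u x v)) (at 0)"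
  proof (rule has_derivative_set_integral[where \<delta>=1 and C=B])
    show "set_integrable lborel K (\<lambda>x. u (x + t *\<^sub>R v))" for t
      unfolding K_def set_integrable_def
      by (rule borel_integrable_compact)
        (auto intro!: continuous_on_compose2[OF cu] continuous_intros)
    show "((\<lambda>t. u (x + t *\<^sub>R v)) has_real_derivative fderiv u x v) (at 0)" for x
      using dt[of x 0] by simp
  qed (use lip emeasure_bounded_finite[OF bounded_cball] in \<open>auto simp: K_def\<close>)
  moreover have "((\<lambda>t. LINT x:K|lborel. u (x + t *\<^sub>R v)) has_real_derivative 0) (at 0)"
  proof -
    have "((\<lambda>t::real. integral\<^sup>L lborel u) has_real_derivative 0) (at 0)" by simp
    then show ?thesis
      by (rule has_field_derivative_transform_within_open[of _ _ _ "{-1<..<1}"]) (use eq in auto)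
  qed
  ultimately have "(LINT x:K|lborel. fderiv u x v) = 0" by (rule DERIV_unique)
  moreover have "(LINT x:K|lborel. fderiv u x v) = integral\<^sup>L lborel (\<lambda>x. fderiv u x v)"
    unfolding set_lebesgue_integral_def
  proof (rule Bochner_Integration.integral_cong[OF refl])
    fix x
    have "x \<notin> K \<Longrightarrow> norm x > R" using norm_ge_zero[of v] by (auto simp: K_def simp del: norm_ge_zero)
    then show "indicat_real K x *\<^sub>R fderiv u x v = fderiv u x v" using duz by (auto simp: indicator_def)
  qed
  ultimately show ?thesis by simp
qed

text \<open>The extension by zero is C1 on \<open>S\<close> and on the complement of
  \<open>C\<close>. These two open sets cover the space, which reduces the claim to functions on all
  of it.\<close>

lemma integral_fderiv_compact_support_on:
  fixes u :: "'v::euclidean_space \<Rightarrow> real"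
  assumes S: "open S" and u: "C1_on S u" and C: "compact C" "C \<subseteq> S" "\<And>x. x \<in> S - C \<Longrightarrow> u x = 0"
  shows "integrable lborel (\<lambda>x. indicator S x * fderiv u x v)"
    "integral\<^sup>L lborel (\<lambda>x. indicator S x * fderiv u x v) = 0"
proof -
  define w where "w x = (if x \<in> S then u x else 0)" for x
  have wC: "w x = 0" if "x \<notin> C" for x using C that by (auto simp: w_def)
  have oC: "open (- C)" using C(1) by (simp add: compact_imp_closed open_Compl)
  have "C1_on S w" by (rule C1_on_cong[OF S _ u]) (simp add: w_def)
  moreover have "C1_on (- C) w" by (rule C1_on_cong[OF oC _ C1_on_const[of _ 0]]) (simp add: wC)
  ultimately have "C1_on (S \<union> - C) w" by (rule C1_on_Un[OF S oC])
  moreover have "S \<union> - C = UNIV" using C by auto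
  ultimately have w: "C1_on UNIV w" by simp
  have dw: "indicator S x * fderiv u x v = fderiv w x v" for x
  proof (cases "x \<in> S")
    case True
    then have "fderiv u x = fderiv w x" by (intro fderiv_cong_open[OF S]) (auto simp: w_def)
    with True show ?thesis by simp
  next
    case False
    then have "fderiv w x = fderiv (\<lambda>_. 0) x" using C(2) by (intro fderiv_cong_open[OF oC]) (auto simp: wC)
    with False show ?thesis by simp
  qed
  show "integral\<^sup>L lborel (\<lambda>x. indicator S x * fderiv u x v) = 0"
    unfolding dw by (rule integral_fderiv_compact_support[OF w C(1) wC])
  have "fderiv w x v = 0" if "x \<notin> C" for x
  proof -
    have "fderiv w x = fderiv (\<lambda>_. 0) x" using that by (intro fderiv_cong_open[OF oC]) (auto simp: wC)
    then show ?thesis by simp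
  qed
  then have "(\<lambda>x. fderiv w x v) = (\<lambda>x. indicator C x *\<^sub>R fderiv w x v)"
    by (auto simp: fun_eq_iff indicator_def)
  moreover have "integrable lborel (\<lambda>x. indicator C x *\<^sub>R fderiv w x v)"
    using C(1) by (rule borel_integrable_compact) (rule continuous_on_subset[OF C1_on_fderiv[OF w]], simp)
  ultimately show "integrable lborel (\<lambda>x. indicator S x * fderiv u x v)" unfolding dw by simp
qed

section \<open>Integration on a Riemannian manifold\<close>

text \<open>Compactness for local data: \<open>Q\<close> will be finite volume, the existence of a
  cutoff function, and a Lipschitz bound in time.\<close>

lemma compactin_finite_cover:
  assumes "compactin X K" "\<And>p. p \<in> K \<Longrightarrow> \<exists>U. openin X U \<and> p \<in> U \<and> Q U"
  obtains F where "finite F" "\<And>U. U \<in> F \<Longrightarrow> openin X U \<and> Q U" "K \<subseteq> \<Union>F"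
proof -
  let ?U = "{U. openin X U \<and> Q U}"
  have "K \<subseteq> \<Union>?U" using assms(2) by blast
  then obtain F where "finite F" "F \<subseteq> ?U" "K \<subseteq> \<Union>F"
    using assms(1) unfolding compactin_def by (metis (no_types, lifting) mem_Collect_eq)
  then show ?thesis using that by blast
qed

text \<open>Squaring smooths the corner of \<open>max 0\<close> at 0 to first order, which yields C1
  cutoffs without exponentials.\<close>

lemma C1_on_max0_square:
  fixes f :: "'a::real_normed_vector \<Rightarrow> real"
  assumes "open S" "C1_on S f"
  shows "C1_on S (\<lambda>x. (max 0 (f x))\<^sup>2)"
proof (rule C1_on_real_compose[where T=UNIV and f="\<lambda>y. (max 0 y)\<^sup>2" and f'="\<lambda>y. 2 * max 0 y"])
  fix y :: real
  consider "y < 0" | "y = 0" | "y > 0" by linarith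
  then show "((\<lambda>y. (max 0 y)\<^sup>2) has_real_derivative 2 * max 0 y) (at y)"
  proof cases
    case 1
    have "((\<lambda>y::real. 0) has_real_derivative 2 * max 0 y) (at y)" using 1 by simp
    then show ?thesis
      by (rule has_field_derivative_transform_within_open[of _ _ _ "{..<0}"]) (use 1 in auto)
  next
    case 3
    have "((\<lambda>y::real. y\<^sup>2) has_real_derivative 2 * max 0 y) (at y)"
      using 3 by (auto intro!: derivative_eq_intros)
    then show ?thesis
      by (rule has_field_derivative_transform_within_open[of _ _ _ "{0<..}"]) (use 3 in auto)
  next
    case 2
    have "((\<lambda>h::real. (max 0 h)\<^sup>2 / h) \<longlongrightarrow> 0) (at 0)"
    proof (rule Lim_null_comparison)
      show "\<forall>\<^sub>F h::real in at 0. norm ((max 0 h)\<^sup>2 / h) \<le> \<bar>h\<bar>"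
        by (rule always_eventually) (auto simp: max_def power2_eq_square)
      show "((\<lambda>h::real. \<bar>h\<bar>) \<longlongrightarrow> 0) (at 0)" by (intro tendsto_eq_intros) auto
    qed
    then show ?thesis using 2 by (simp add: DERIV_def)
  qed
qed (use assms in \<open>auto intro!: continuous_intros\<close>)

lemma cutoff_exists:
  fixes x0 :: "'v::euclidean_space"
  assumes "r > 0"
  obtains \<theta> :: "'v \<Rightarrow> real" where "C1_on UNIV \<theta>" "\<And>x. 0 \<le> \<theta> x \<and> \<theta> x \<le> 1"
    "\<And>x. x \<in> ball x0 r \<Longrightarrow> \<theta> x = 1" "\<And>x. x \<notin> cball x0 (2 * r) \<Longrightarrow> \<theta> x = 0"
proof -
  \<comment> \<open>Affine in the squared distance, with value 1 on the sphere of radius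
    \<open>r\<close> and 0 on that of radius \<open>2 * r\<close>; the 3 is the difference 4 -
    1.\<close>
  define z where "z x = (4 * r\<^sup>2 - (x - x0) \<bullet> (x - x0)) / (3 * r\<^sup>2)" for x
  \<comment> \<open>Equal to 0 where \<open>z\<close> is at least 1, and to 1 where \<open>z\<close>
    is at most 0. The function sought is therefore \<open>1 - w\<close>.\<close>
  define w where "w x = (max 0 (1 - (max 0 (z x))\<^sup>2))\<^sup>2" for x
  have C1z: "C1_on UNIV z"
    unfolding z_def[abs_def] using assms
    by (intro C1_intros open_UNIV C1_on_linear bounded_linear_ident) auto
  have "C1_on UNIV (\<lambda>x. 1 - w x)"
    unfolding w_def[abs_def]
    by (intro C1_on_diff C1_on_const C1_on_max0_square C1z open_UNIV)
  moreover have w: "0 \<le> w x \<and> w x \<le> 1" for x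
    unfolding w_def by (auto intro!: power_le_one)
  moreover have "1 - w x = 1" if "x \<in> ball x0 r" for x
  proof -
    have "norm (x - x0) < r" using that by (simp add: dist_norm norm_minus_commute)
    then have "(x - x0) \<bullet> (x - x0) < r\<^sup>2"
      by (simp add: power2_norm_eq_inner[symmetric] power_strict_mono)
    then have "z x \<ge> 1" using assms by (simp add: z_def field_simps)
    then have "(max 0 (z x))\<^sup>2 \<ge> 1" by (simp add: max_def)
    then show ?thesis by (simp add: w_def)
  qed
  moreover have "1 - w x = 0" if "x \<notin> cball x0 (2 * r)" for x
  proof -
    have "norm (x - x0) > 2 * r" using that by (simp add: dist_norm norm_minus_commute)
    then have "(2 * r)\<^sup>2 < (x - x0) \<bullet> (x - x0)"
      using assms unfolding power2_norm_eq_inner[symmetric] by (intro power_strict_mono) auto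
    then have "z x \<le> 0" using assms by (simp add: z_def field_simps)
    then show ?thesis by (simp add: w_def)
  qed
  ultimately show ?thesis using that[of "\<lambda>x. 1 - w x"] by (simp add: algebra_simps)
qed

locale nonempty_riemannian = riemannian M for M :: "('a, 'n::finite) riem" +
  assumes nonempty: "topspace X \<noteq> {}"
begin

abbreviation vol where "vol \<equiv> volume_measure M"

lemma is_volume: "is_volume_measure M vol"
  unfolding volume_measure_def by (rule theI'[OF is_volume_measure_ex1[OF nonempty]])

lemma sets_vol: "sets vol = sets borelM" and space_vol: "space vol = topspace X"
  using is_volume by (simp_all add: is_volume_measure_def sets_borelM)

text \<open>\<open>cinv c\<close> pushes Lebesgue measure with density \<open>dens c\<close> forward
  to the part of \<open>vol\<close> inside the chart. The part is encoded as a density with an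
  indicator, so that both integrals remain over the full spaces.\<close>

lemma integral_chart:
  assumes c: "c \<in> atlas M" and f: "f \<in> borel_measurable vol" "\<And>p. p \<in> topspace X - cdom c \<Longrightarrow> f p = (0::real)"
  shows "integral\<^sup>L vol f = integral\<^sup>L lborel (\<lambda>x. indicator (img c) x * (dens c x * f (cinv c x)))"
proof -
  let ?R = "restrict_space lborel (img c)"
  let ?D = "density ?R (\<lambda>x. ennreal (dens c x))"
  let ?V = "density vol (\<lambda>p. ennreal (indicator (cdom c) p))"
  have cd: "cdom c \<in> sets vol" using cdom_borelM[OF c] sets_vol by simp
  have img: "img c \<in> sets lborel" using img_borel[OF c] by simp
  have ci: "cinv c \<in> measurable ?R vol"
  proof -
    have "measurable ?R vol = measurable (restrict_space borel (img c)) borelM"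
      by (rule measurable_cong_sets) (simp_all add: sets_vol sets_restrict_space)
    then show ?thesis using cinv_measurable[OF c] by simp
  qed
  have dm: "dens c \<in> borel_measurable ?R"
    using dens_measurable[OF c img_borel[OF c]] img
    by (subst borel_measurable_restrict_space_iff) (simp_all add: mult.commute)
  have eq: "distr ?D vol (cinv c) = ?V"
  proof (rule measure_eqI)
    fix A assume "A \<in> sets (distr ?D vol (cinv c))"
    then have A: "A \<in> sets vol" by simp
    have pre: "cinv c -` A \<inter> img c = cmap c ` (cdom c \<inter> A)" unfolding cmap_image[OF c] by auto
    have sp: "space ?R = img c" by (simp add: space_restrict_space)
    have pm: "cinv c -` A \<inter> img c \<in> sets ?R" using measurable_sets[OF ci A] by (simp add: sp)
    have "emeasure (distr ?D vol (cinv c)) A = emeasure ?D (cinv c -` A \<inter> img c)"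
      using ci A by (subst emeasure_distr) (simp_all add: sp)
    also have "\<dots> = (\<integral>\<^sup>+x. ennreal (dens c x) * indicator (cinv c -` A \<inter> img c) x \<partial>?R)"
      using dm pm by (subst emeasure_density) simp_all
    also have "\<dots> = (\<integral>\<^sup>+x. ennreal (dens c x) * indicator (cinv c -` A \<inter> img c) x * indicator (img c) x \<partial>lborel)"
      using img by (subst nn_integral_restrict_space) simp_all
    also have "\<dots> = vol_in c (cdom c \<inter> A)"
      unfolding vol_in_def[OF c] pre[symmetric] by (intro nn_integral_cong) (auto simp: indicator_def)
    also have "\<dots> = emeasure vol (cdom c \<inter> A)"
      using A cd by (intro emeasure_volume_chart[OF is_volume c, symmetric]) (auto simp: sets_vol)
    also have "\<dots> = (\<integral>\<^sup>+p. indicator (cdom c \<inter> A) p \<partial>vol)"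
      using A cd by (intro nn_integral_indicator[symmetric]) auto
    also have "\<dots> = (\<integral>\<^sup>+p. ennreal (indicator (cdom c) p) * indicator A p \<partial>vol)"
      by (intro nn_integral_cong) (auto simp: indicator_def)
    also have "\<dots> = emeasure ?V A"
      using A cd by (intro emeasure_density[symmetric]) simp_all
    finally show "emeasure (distr ?D vol (cinv c)) A = emeasure ?V A" .
  qed simp
  have fD: "(\<lambda>x. f (cinv c x)) \<in> borel_measurable ?R" using ci f(1) by (rule measurable_compose)
  have pos: "AE x in ?R. 0 \<le> dens c x"
    using dens_pos[OF c] by (intro AE_I2) (auto simp: space_restrict_space intro: less_imp_le)
  have fV: "integral\<^sup>L vol f = integral\<^sup>L ?V f"
  proof -
    have *: "indicator (cdom c) p *\<^sub>R f p = f p" if "p \<in> space vol" for p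
      using that f(2) by (auto simp: space_vol indicator_def)
    have im: "(\<lambda>p. indicator (cdom c) p :: real) \<in> borel_measurable vol" using cd by simp
    have "integral\<^sup>L ?V f = integral\<^sup>L vol (\<lambda>p. indicator (cdom c) p *\<^sub>R f p)"
      by (rule integral_density[OF f(1) im]) simp
    also have "\<dots> = integral\<^sup>L vol f"
      by (rule Bochner_Integration.integral_cong[OF refl *])
    finally show ?thesis by simp
  qed
  have "integral\<^sup>L (distr ?D vol (cinv c)) f = integral\<^sup>L ?D (\<lambda>x. f (cinv c x))"
    using ci f(1) by (intro integral_distr) simp_all
  also have "\<dots> = integral\<^sup>L ?R (\<lambda>x. dens c x *\<^sub>R f (cinv c x))"
    by (rule integral_density[OF fD dm pos])
  also have "\<dots> = integral\<^sup>L lborel (\<lambda>x. indicator (img c) x *\<^sub>R (dens c x *\<^sub>R f (cinv c x)))"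
    using img by (subst integral_restrict_space) simp_all
  finally show "integral\<^sup>L vol f = integral\<^sup>L lborel (\<lambda>x. indicator (img c) x * (dens c x * f (cinv c x)))"
    by (simp add: fV eq)
qed

section \<open>Compact sets, continuous functions and integrability\<close>

lemma compact_borelM: "compactin X K \<Longrightarrow> K \<in> sets borelM"
proof -
  assume "compactin X K"
  then have "closedin X K" using Hausdorff compactin_imp_closedin by blast
  then have "topspace X - K \<in> sets borelM" "K \<subseteq> topspace X"
    using openin_borelM by (auto simp: closedin_def)
  then have "topspace X - (topspace X - K) \<in> sets borelM"
    by (metis sets.compl_sets space_borelM)
  with \<open>K \<subseteq> topspace X\<close> show ?thesis by (simp add: double_diff)
qed

lemma chart_ball:
  assumes c: "c \<in> atlas M" and p: "p \<in> cdom c"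
  obtains r where "r > 0" "cball (cmap c p) r \<subseteq> img c" "openin X (cdom c \<inter> cmap c -` ball (cmap c p) r)"
    "p \<in> cdom c \<inter> cmap c -` ball (cmap c p) r"
proof -
  obtain r where r: "r > 0" "cball (cmap c p) r \<subseteq> img c"
    using open_contains_cball open_img[OF c] p by (metis imageI)
  show ?thesis
    by (rule that[OF r]) (use r p in \<open>auto intro!: openin_cmap_vimage c\<close>)
qed

text \<open>Over a closed ball in a chart the density is bounded, so every point has a neighbourhood
  of finite volume, and finitely many of these cover \<open>K\<close>.\<close>

lemma emeasure_compact_finite:
  assumes K: "compactin X K"
  shows "emeasure vol K < \<infinity>"
proof -
  let ?Q = "\<lambda>U. U \<in> sets vol \<and> emeasure vol U < \<infinity>"
  have "\<exists>U. openin X U \<and> p \<in> U \<and> ?Q U" if "p \<in> K" for p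
  proof -
    have "p \<in> topspace X" using K that compactin_subset_topspace by blast
    then obtain c where c: "c \<in> atlas M" "p \<in> cdom c" using chart_exists by blast
    obtain r where r: "r > 0" "cball (cmap c p) r \<subseteq> img c" "openin X (cdom c \<inter> cmap c -` ball (cmap c p) r)"
      "p \<in> cdom c \<inter> cmap c -` ball (cmap c p) r" by (rule chart_ball[OF c])
    let ?U = "cdom c \<inter> cmap c -` ball (cmap c p) r"
    have "bounded (dens c ` cball (cmap c p) r)"
      by (intro compact_imp_bounded compact_continuous_image continuous_on_subset[OF C1_on_continuous_on[OF C1_dens[OF c(1)]] r(2)]) auto
    then obtain B where B: "B > 0" "\<And>x. x \<in> cball (cmap c p) r \<Longrightarrow> \<bar>dens c x\<bar> \<le> B"
      unfolding bounded_pos by auto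
    have U: "?U \<in> sets borelM" using r openin_borelM by blast
    have "emeasure vol ?U = vol_in c ?U" by (rule emeasure_volume_chart[OF is_volume c(1) U]) simp
    also have "\<dots> \<le> (\<integral>\<^sup>+x. ennreal B * indicator (cball (cmap c p) r) x \<partial>lborel)"
      unfolding vol_in_def[OF c(1)]
    proof (rule nn_integral_mono)
      fix x show "ennreal (dens c x) * indicator (cmap c ` ?U) x \<le> ennreal B * indicator (cball (cmap c p) r) x"
        using B(2)[of x] by (auto simp: indicator_def intro!: ennreal_leI)
    qed
    also have "\<dots> = ennreal B * emeasure lborel (cball (cmap c p) r)"
      by (simp add: nn_integral_cmult_indicator)
    also have "\<dots> < \<infinity>"
      using emeasure_bounded_finite[OF bounded_cball[of "cmap c p" r]] by (simp add: ennreal_mult_less_top)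
    finally show ?thesis using r U by (auto simp: sets_vol)
  qed
  then obtain F where F: "finite F" "\<And>U. U \<in> F \<Longrightarrow> openin X U \<and> ?Q U" "K \<subseteq> \<Union>F"
    using compactin_finite_cover[OF K, of ?Q] by metis
  have "emeasure vol K \<le> emeasure vol (\<Union>F)"
    by (rule emeasure_mono[OF F(3)]) (use F in auto)
  also have "\<dots> \<le> (\<Sum>U\<in>F. emeasure vol U)"
    using emeasure_subadditive_finite[OF F(1), of "\<lambda>U. U" vol] F by auto
  also have "\<dots> < \<infinity>" using F by (auto simp: less_top[symmetric])
  finally show ?thesis .
qed

definition chart_continuous :: "('a \<Rightarrow> real) \<Rightarrow> bool"
  where "chart_continuous f \<longleftrightarrow> (\<forall>c\<in>atlas M. continuous_on (img c) (\<lambda>x. f (cinv c x)))"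

lemma chart_continuous_map:
  assumes "chart_continuous f"
  shows "continuous_map X euclideanreal f"
  unfolding continuous_map
proof (intro conjI allI impI)
  fix S :: "real set" assume "openin euclideanreal S"
  then have S: "open S" by simp
  show "openin X {p \<in> topspace X. f p \<in> S}"
  proof (subst openin_subopen, safe)
    fix p assume p: "p \<in> topspace X" "f p \<in> S"
    then obtain c where c: "c \<in> atlas M" "p \<in> cdom c" using chart_exists by blast
    have "open (img c \<inter> (\<lambda>x. f (cinv c x)) -` S)"
      using assms c by (intro continuous_open_preimage open_img S) (auto simp: chart_continuous_def)
    then have "openin X (cdom c \<inter> cmap c -` (img c \<inter> (\<lambda>x. f (cinv c x)) -` S))"
      by (rule openin_cmap_vimage[OF c(1)])
    moreover have "cdom c \<inter> cmap c -` (img c \<inter> (\<lambda>x. f (cinv c x)) -` S) \<subseteq> {p \<in> topspace X. f p \<in> S}"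
    proof
      fix q assume q: "q \<in> cdom c \<inter> cmap c -` (img c \<inter> (\<lambda>x. f (cinv c x)) -` S)"
      then have "q \<in> cdom c" by (rule IntD1)
      moreover have "f (cinv c (cmap c q)) \<in> S" using q[THEN IntD2] by simp
      ultimately show "q \<in> {p \<in> topspace X. f p \<in> S}" using c cdom_subset[OF c(1)] by auto
    qed
    moreover have "p \<in> cdom c \<inter> cmap c -` (img c \<inter> (\<lambda>x. f (cinv c x)) -` S)"
      using c p by simp
    ultimately show "\<exists>T. openin X T \<and> p \<in> T \<and> T \<subseteq> {p \<in> topspace X. f p \<in> S}" by blast
  qed
qed simp

lemma continuous_map_measurable:
  fixes f :: "'a \<Rightarrow> real"
  assumes "continuous_map X euclideanreal f"
  shows "f \<in> borel_measurable vol"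
proof (rule borel_measurableI)
  fix S :: "real set" assume "open S"
  then have "openin X {p \<in> topspace X. f p \<in> S}"
    using assms by (intro openin_continuous_map_preimage) auto
  moreover have "f -` S \<inter> space vol = {p \<in> topspace X. f p \<in> S}" by (auto simp: space_vol)
  ultimately show "f -` S \<inter> space vol \<in> sets vol" using openin_borelM by (simp add: sets_vol)
qed

lemma integrable_chart_continuous:
  assumes f: "chart_continuous f" and K: "compactin X K" "\<And>p. p \<in> topspace X - K \<Longrightarrow> f p = 0"
  shows "integrable vol f"
proof -
  have "compactin euclideanreal (f ` K)"
    by (rule image_compactin[OF K(1) chart_continuous_map[OF f]])
  then have "bounded (f ` K)" by (simp add: compact_imp_bounded)
  then obtain B where B: "\<And>p. p \<in> K \<Longrightarrow> \<bar>f p\<bar> \<le> B" unfolding bounded_iff by auto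
  show ?thesis
  proof (rule integrableI_bounded_set[where A=K and B=B])
    show "K \<in> sets vol" using compact_borelM[OF K(1)] sets_vol by simp
    show "f \<in> borel_measurable vol" by (rule continuous_map_measurable[OF chart_continuous_map[OF f]])
    show "emeasure vol K < \<infinity>" by (rule emeasure_compact_finite[OF K(1)])
  qed (use B K in \<open>auto simp: space_vol\<close>)
qed

section \<open>C1 functions and cutoffs supported in one chart\<close>

definition C1_fun :: "('a \<Rightarrow> real) \<Rightarrow> bool"
  where "C1_fun f \<longleftrightarrow> (\<forall>c\<in>atlas M. C1_on (img c) (\<lambda>x. f (cinv c x)))"

lemma C1_fun_mult: "C1_fun f \<Longrightarrow> C1_fun g \<Longrightarrow> C1_fun (\<lambda>p. f p * g p)"
  unfolding C1_fun_def using open_img by (auto intro: C1_on_mult)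

lemma C1_fun_diff: "C1_fun f \<Longrightarrow> C1_fun g \<Longrightarrow> C1_fun (\<lambda>p. f p - g p)"
  unfolding C1_fun_def using open_img by (auto intro: C1_on_diff)

lemma C1_fun_const: "C1_fun (\<lambda>p. a)"
  unfolding C1_fun_def by (auto intro: C1_on_const)

lemma C1_fun_prod: "(\<And>i. i \<in> I \<Longrightarrow> C1_fun (f i)) \<Longrightarrow> C1_fun (\<lambda>p. \<Prod>i\<in>I. f i p)"
  unfolding C1_fun_def using open_img by (auto intro!: C1_on_prod)

text \<open>The compact set lies in the coordinate image of a single chart. An integral against such
  a function is thus an integral in one coordinate space with compact support.\<close>

definition cutoff :: "('a \<Rightarrow> real) \<Rightarrow> bool"
  where "cutoff \<kappa> \<longleftrightarrow> C1_fun \<kappa> \<and> (\<forall>p. 0 \<le> \<kappa> p \<and> \<kappa> p \<le> 1) \<and>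
    (\<exists>c\<in>atlas M. \<exists>C. compact C \<and> C \<subseteq> img c \<and> (\<forall>p. p \<notin> cinv c ` C \<longrightarrow> \<kappa> p = 0))"

lemma closed_chart_compact:
  assumes c: "c \<in> atlas M" and C: "compact C" "C \<subseteq> img c"
  shows "closedin X (cinv c ` C)"
proof -
  have "compactin (top_of_set (img c)) C" using C by (simp add: compactin_subtopology)
  then have "compactin X (cinv c ` C)" by (rule image_compactin[OF _ continuous_cinv[OF c]])
  then show ?thesis using Hausdorff compactin_imp_closedin by blast
qed

lemma C1_on_chart_change:
  assumes c: "c \<in> atlas M" "c' \<in> atlas M" and f: "C1_on (img c) (\<lambda>x. f (cinv c x))"
  shows "C1_on (overlap c' c) (\<lambda>x. f (cinv c' x))"
proof (rule C1_on_cong[OF open_overlap[OF c(2,1)]])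
  show "C1_on (overlap c' c) (\<lambda>x. f (cinv c (transition c' c x)))"
  proof (rule C1_on_compose[OF open_overlap[OF c(2,1)] f smooth_on_C1[OF smooth_trans[OF c(2,1)]]])
    show "transition c' c ` overlap c' c \<subseteq> img c"
      using trans_in[OF c(2,1)] overlap_iff[OF c(1,2)] by auto
  qed
qed (simp add: cinv_trans[OF c(2,1)])

lemma cutoff_near:
  assumes p: "p \<in> topspace X"
  shows "\<exists>U. openin X U \<and> p \<in> U \<and> (\<exists>\<kappa>. cutoff \<kappa> \<and> (\<forall>q\<in>U. \<kappa> q = 1))"
proof -
  obtain c where c: "c \<in> atlas M" "p \<in> cdom c" using p chart_exists by blast
  obtain r where r: "r > 0" "cball (cmap c p) r \<subseteq> img c" by (rule chart_ball[OF c])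
  \<comment> \<open>The radius is halved because the support in \<open>cutoff_exists\<close> reaches
    twice as far; it then lies in the closed ball contained in \<open>img c\<close>.\<close>
  obtain \<theta> :: "real^'n \<Rightarrow> real" where \<theta>: "C1_on UNIV \<theta>" "\<And>x. 0 \<le> \<theta> x \<and> \<theta> x \<le> 1"
    "\<And>x. x \<in> ball (cmap c p) (r/2) \<Longrightarrow> \<theta> x = 1" "\<And>x. x \<notin> cball (cmap c p) (2 * (r/2)) \<Longrightarrow> \<theta> x = 0"
    using cutoff_exists[of "r/2" "cmap c p"] r by (metis half_gt_zero)
  let ?C = "cball (cmap c p) r"
  define \<kappa> where "\<kappa> q = (if q \<in> cdom c then \<theta> (cmap c q) else 0)" for q
  have zero: "\<kappa> q = 0" if "q \<notin> cinv c ` ?C" for q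
  proof (cases "q \<in> cdom c")
    case True
    then have "cmap c q \<notin> ?C" using that c by (metis cinv_cmap imageI)
    then show ?thesis using \<theta>(4)[of "cmap c q"] by (simp add: \<kappa>_def)
  qed (simp add: \<kappa>_def)
  have "C1_fun \<kappa>"
    unfolding C1_fun_def
  proof
    fix c' assume c': "c' \<in> atlas M"
    \<comment> \<open>The points off the support form an open set, since compact sets of a Hausdorff
      space are closed. Together with the overlap it covers \<open>img c'\<close>, and the extension
      by zero is C1 on both parts.\<close>
    let ?V = "cmap c' ` (cdom c' \<inter> (topspace X - cinv c ` ?C))"
    have V: "open ?V"
      using closed_chart_compact[OF c(1) compact_cball r(2)] by (intro open_cmap_image[OF c']) (auto simp: closedin_def)
    have "C1_on (img c) (\<lambda>x. \<kappa> (cinv c x))"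
      by (rule C1_on_cong[OF open_img[OF c(1)] _ C1_on_subset[OF _ \<theta>(1)]]) (auto simp: \<kappa>_def c)
    then have 1: "C1_on (overlap c' c) (\<lambda>x. \<kappa> (cinv c' x))" by (rule C1_on_chart_change[OF c(1) c'])
    have 2: "C1_on ?V (\<lambda>x. \<kappa> (cinv c' x))"
      by (rule C1_on_cong[OF V _ C1_on_const[of _ 0]]) (auto simp: c' zero)
    have "cinv c ` ?C \<subseteq> cdom c" using r c by auto
    then have "overlap c' c \<union> ?V = img c'"
      using cdom_subset[OF c'] unfolding overlap_def by blast
    then show "C1_on (img c') (\<lambda>x. \<kappa> (cinv c' x))"
      using C1_on_Un[OF open_overlap[OF c' c(1)] V 1 2] by simp
  qed
  moreover have "0 \<le> \<kappa> q \<and> \<kappa> q \<le> 1" for q using \<theta>(2) by (simp add: \<kappa>_def)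
  ultimately have "cutoff \<kappa>"
    unfolding cutoff_def using zero r(2) c by (blast intro: compact_cball)
  moreover have "openin X (cdom c \<inter> cmap c -` ball (cmap c p) (r/2))" by (intro openin_cmap_vimage c) simp
  moreover have "\<forall>q\<in>cdom c \<inter> cmap c -` ball (cmap c p) (r/2). \<kappa> q = 1" using \<theta>(3) by (simp add: \<kappa>_def)
  ultimately show ?thesis using c r by (intro exI[of _ "cdom c \<inter> cmap c -` ball (cmap c p) (r/2)"]) auto
qed

end

section \<open>The divergence theorem\<close>

text \<open>A C1 vector field given by its components in every chart, zero outside \<open>K\<close>,
  with divergence \<open>D\<close>. The coordinate formula for the divergence is required in all
  charts at once, which makes \<open>D\<close> a function on the manifold from the start.\<close>

locale div_field = nonempty_riemannian M for M :: "('a, 'n::finite) riem" +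
  fixes K :: "'a set" and D :: "'a \<Rightarrow> real" and Xf :: "('a, 'n) chart \<Rightarrow> real^'n \<Rightarrow> real^'n"
  assumes K: "compactin X K"
    and C1_Xf: "\<And>c. c \<in> atlas M \<Longrightarrow> C1_on (img c) (Xf c)"
    and Xf_zero: "\<And>c x. c \<in> atlas M \<Longrightarrow> x \<in> img c \<Longrightarrow> cinv c x \<notin> K \<Longrightarrow> Xf c x = 0"
    and Xf_transform: "\<And>c c' x. c \<in> atlas M \<Longrightarrow> c' \<in> atlas M \<Longrightarrow> x \<in> overlap c c' \<Longrightarrow>
      Xf c' (transition c c' x) = fderiv (transition c c') x (Xf c x)"
    and div: "\<And>c x. c \<in> atlas M \<Longrightarrow> x \<in> img c \<Longrightarrow>
      dens c x * D (cinv c x) = (\<Sum>i\<in>UNIV. fderiv (\<lambda>y. dens c y * Xf c y $ i) x (axis i 1))"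
begin

definition DX :: "('a \<Rightarrow> real) \<Rightarrow> 'a \<Rightarrow> real"
  where "DX f p = (let c = chart_at M p in fderiv (\<lambda>x. f (cinv c x)) (cmap c p) (Xf c (cmap c p)))"

lemma DX_chart:
  assumes c: "c \<in> atlas M" "p \<in> cdom c" and f: "C1_fun f"
  shows "DX f p = fderiv (\<lambda>x. f (cinv c x)) (cmap c p) (Xf c (cmap c p))"
proof -
  define c' where "c' = chart_at M p"
  have c': "c' \<in> atlas M" "p \<in> cdom c'"
    using chart_at[of p] cdom_subset[OF c(1)] c(2) by (auto simp: c'_def)
  let ?F = "transition c c'" and ?x = "cmap c p"
  have x: "?x \<in> overlap c c'" using c c' by (auto simp: overlap_def)
  have Fx: "?F ?x = cmap c' p" by (simp add: trans_cmap c c')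
  have "fderiv (\<lambda>x. f (cinv c x)) ?x = fderiv (\<lambda>x. f (cinv c' (?F x))) ?x"
    by (rule fderiv_cong_open[OF open_overlap[OF c(1) c'(1)] x]) (simp add: cinv_trans c c')
  moreover have "fderiv (\<lambda>x. f (cinv c' (?F x))) ?x v = fderiv (\<lambda>x. f (cinv c' x)) (?F ?x) (fderiv ?F ?x v)" for v
  proof (rule fderiv_compose)
    show "?F differentiable at ?x" by (rule smooth_on_differentiable[OF smooth_trans[OF c(1) c'(1)] x])
    show "(\<lambda>x. f (cinv c' x)) differentiable at (?F ?x)"
      using f c' unfolding Fx C1_fun_def C1_on_def by blast
  qed
  ultimately show ?thesis
    unfolding DX_def Let_def c'_def[symmetric] using Xf_transform[OF c(1) c'(1) x] by (simp add: Fx)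
qed

lemma DX_zero:
  assumes U: "openin X U" "p \<in> U" "\<And>q. q \<in> U \<Longrightarrow> f q = 0"
  shows "DX f p = 0"
proof -
  define c where "c = chart_at M p"
  have c: "c \<in> atlas M" "p \<in> cdom c"
    using chart_at[of p] U openin_subset by (auto simp: c_def)
  have "fderiv (\<lambda>x. f (cinv c x)) (cmap c p) = fderiv (\<lambda>x. 0) (cmap c p)"
    by (rule fderiv_cong_open[OF open_cmap_image[OF c(1) U(1)]]) (use U c in auto)
  then show ?thesis unfolding DX_def Let_def c_def[symmetric] by simp
qed

text \<open>The divergence of the product of \<open>f\<close> with the vector field.\<close>

definition integrand where "integrand f p = f p * D p + DX f p"

text \<open>The product rule. It exhibits the density times the divergence of the product field as a
  sum of partial derivatives, to which integration of compactly supported functions applies.\<close>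

lemma fderiv_component_product:
  assumes c: "c \<in> atlas M" and x: "x \<in> img c" and f: "C1_fun f"
  shows "dens c x * integrand f (cinv c x) =
    (\<Sum>i\<in>UNIV. fderiv (\<lambda>y. f (cinv c y) * (dens c y * Xf c y $ i)) x (axis i 1))"
proof -
  let ?f = "\<lambda>x. f (cinv c x)"
  have df: "?f differentiable (at x)" using f c x by (auto simp: C1_fun_def C1_on_def)
  have "C1_on (img c) (\<lambda>y. dens c y * Xf c y $ i)" for i
    by (intro C1_on_mult C1_on_vec_nth C1_dens C1_Xf open_img c)
  then have "fderiv (\<lambda>y. ?f y * (dens c y * Xf c y $ i)) x =
      (\<lambda>v. ?f x * fderiv (\<lambda>y. dens c y * Xf c y $ i) x v + fderiv ?f x v * (dens c x * Xf c x $ i))" for i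
    using x by (intro fderiv_eq has_derivative_mult has_fderiv df) (auto simp: C1_on_def)
  then have "(\<Sum>i\<in>UNIV. fderiv (\<lambda>y. ?f y * (dens c y * Xf c y $ i)) x (axis i 1)) =
      (\<Sum>i\<in>UNIV. ?f x * fderiv (\<lambda>y. dens c y * Xf c y $ i) x (axis i 1)
        + fderiv ?f x (axis i 1) * (dens c x * Xf c x $ i))" by (simp only:)
  also have "\<dots> = ?f x * (\<Sum>i\<in>UNIV. fderiv (\<lambda>y. dens c y * Xf c y $ i) x (axis i 1))
      + (\<Sum>i\<in>UNIV. fderiv ?f x (axis i 1) * (dens c x * Xf c x $ i))"
    by (simp only: sum.distrib sum_distrib_left)
  also have "(\<Sum>i\<in>UNIV. fderiv (\<lambda>y. dens c y * Xf c y $ i) x (axis i 1)) = dens c x * D (cinv c x)"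
    by (rule div[OF c x, symmetric])
  also have "(\<Sum>i\<in>UNIV. fderiv ?f x (axis i 1) * (dens c x * Xf c x $ i))
      = dens c x * (\<Sum>i\<in>UNIV. Xf c x $ i *\<^sub>R fderiv ?f x (axis i 1))"
    by (simp add: sum_distrib_left mult_ac)
  also have "(\<Sum>i\<in>UNIV. Xf c x $ i *\<^sub>R fderiv ?f x (axis i 1)) = DX f (cinv c x)"
  proof -
    have "DX f (cinv c x) = fderiv ?f x (Xf c x)" using DX_chart[OF c _ f, of "cinv c x"] c x by simp
    also have "\<dots> = (\<Sum>i\<in>UNIV. Xf c x $ i *\<^sub>R fderiv ?f x (axis i 1))"
      by (rule linear_expand[OF linear_fderiv[OF df]])
    finally show ?thesis by (rule sym)
  qed
  also have "?f x * (dens c x * D (cinv c x)) + dens c x * DX f (cinv c x) = dens c x * integrand f (cinv c x)"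
    by (simp add: integrand_def distrib_left)
  finally show ?thesis by (rule sym)
qed

text \<open>No continuity of \<open>D\<close> is assumed. It is inherited from the C1 components
  through division by the positive density.\<close>

lemma integrand_continuous:
  assumes f: "C1_fun f"
  shows "chart_continuous (integrand f)"
  unfolding chart_continuous_def
proof
  fix c assume c: "c \<in> atlas M"
  have "C1_on (img c) (\<lambda>y. f (cinv c y) * (dens c y * Xf c y $ i))" for i
    using f c by (intro C1_on_mult C1_on_vec_nth C1_dens C1_Xf open_img) (auto simp: C1_fun_def)
  then have "continuous_on (img c)
      (\<lambda>x. (\<Sum>i\<in>UNIV. fderiv (\<lambda>y. f (cinv c y) * (dens c y * Xf c y $ i)) x (axis i 1)) / dens c x)"
    using dens_pos[OF c]
    by (intro continuous_on_divide continuous_on_sum C1_on_fderiv C1_on_continuous_on[OF C1_dens[OF c]])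
      (auto simp: C1_on_def less_imp_neq[symmetric])
  moreover have "(\<Sum>i\<in>UNIV. fderiv (\<lambda>y. f (cinv c y) * (dens c y * Xf c y $ i)) x (axis i 1)) / dens c x
      = integrand f (cinv c x)" if "x \<in> img c" for x
    using fderiv_component_product[OF c that f] dens_pos[OF c that] by (simp add: field_simps)
  ultimately show "continuous_on (img c) (\<lambda>x. integrand f (cinv c x))"
    by (simp cong: continuous_on_cong)
qed

lemma D_zero:
  assumes p: "p \<in> topspace X - K"
  shows "D p = 0"
proof -
  obtain c where c: "c \<in> atlas M" "p \<in> cdom c" using p chart_exists by blast
  let ?W = "cmap c ` (cdom c \<inter> (topspace X - K))"
  have "closedin X K" using Hausdorff compactin_imp_closedin K by blast
  then have W: "open ?W" by (intro open_cmap_image[OF c(1)]) (auto simp: closedin_def)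
  have "fderiv (\<lambda>y. dens c y * Xf c y $ i) (cmap c p) = fderiv (\<lambda>y. 0) (cmap c p)" for i
    by (rule fderiv_cong_open[OF W]) (use c p in \<open>auto simp: Xf_zero\<close>)
  then have "dens c (cmap c p) * D p = 0" using div[OF c(1), of "cmap c p"] c by simp
  moreover have "dens c (cmap c p) > 0" using dens_pos[OF c(1)] c(2) by simp
  ultimately show ?thesis by simp
qed

lemma integrand_zero:
  assumes p: "p \<in> topspace X - K" and f: "C1_fun f"
  shows "integrand f p = 0"
proof -
  obtain c where c: "c \<in> atlas M" "p \<in> cdom c" using p chart_exists by blast
  have "Xf c (cmap c p) = 0" using Xf_zero[OF c(1)] c p by simp
  moreover have "linear (fderiv (\<lambda>x. f (cinv c x)) (cmap c p))"
    using f c by (intro linear_fderiv) (auto simp: C1_fun_def C1_on_def)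
  ultimately have "DX f p = 0" using DX_chart[OF c f] by (simp add: linear_0)
  then show ?thesis using D_zero[OF p] by (simp add: integrand_def)
qed

lemma integrable_integrand: "C1_fun f \<Longrightarrow> integrable vol (integrand f)"
  by (rule integrable_chart_continuous[OF integrand_continuous K integrand_zero])

text \<open>If the support lies in one chart, the integral is a sum of integrals of partial
  derivatives of compactly supported C1 functions, and each of these is 0.\<close>

lemma integral_integrand_local:
  assumes c: "c \<in> atlas M" and C: "compact C" "C \<subseteq> img c" and f: "C1_fun f" "\<And>p. p \<notin> cinv c ` C \<Longrightarrow> f p = 0"
  shows "integral\<^sup>L vol (integrand f) = 0"
proof -
  have notC: "cinv c x \<notin> cinv c ` C" if x: "x \<in> img c - C" for x
  proof
    assume "cinv c x \<in> cinv c ` C"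
    then obtain y where y: "y \<in> C" "cinv c x = cinv c y" by blast
    have "cmap c (cinv c x) = x" by (rule cmap_cinv[OF c]) (use x in blast)
    moreover have "cmap c (cinv c y) = y" by (rule cmap_cinv[OF c]) (use y C(2) in blast)
    ultimately have "x = y" using y(2) by metis
    with x y(1) show False by blast
  qed
  have "integrand f p = 0" if p: "p \<in> topspace X - cdom c" for p
  proof -
    have "cinv c ` C \<subseteq> cdom c" using C c by auto
    then have p': "p \<in> topspace X - cinv c ` C" using p by auto
    moreover have "openin X (topspace X - cinv c ` C)"
      using closed_chart_compact[OF c C] by (auto simp: closedin_def)
    ultimately have "DX f p = 0" by (intro DX_zero) (auto simp: f)
    then show ?thesis using f(2)[of p] p' by (simp add: integrand_def)
  qed
  then have "integral\<^sup>L vol (integrand f)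
      = integral\<^sup>L lborel (\<lambda>x. indicator (img c) x * (dens c x * integrand f (cinv c x)))"
    by (intro integral_chart[OF c] continuous_map_measurable chart_continuous_map integrand_continuous f) auto
  also have "\<dots> = integral\<^sup>L lborel (\<lambda>x. \<Sum>i\<in>UNIV. indicator (img c) x *
      fderiv (\<lambda>y. f (cinv c y) * (dens c y * Xf c y $ i)) x (axis i 1))"
    by (rule Bochner_Integration.integral_cong[OF refl])
      (auto simp: indicator_def fderiv_component_product[OF c _ f(1)])
  also have "\<dots> = (\<Sum>i\<in>UNIV. integral\<^sup>L lborel (\<lambda>x. indicator (img c) x *
      fderiv (\<lambda>y. f (cinv c y) * (dens c y * Xf c y $ i)) x (axis i 1)))"
  proof (rule Bochner_Integration.integral_sum)
    fix i
    show "integrable lborel (\<lambda>x. indicator (img c) x *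
        fderiv (\<lambda>y. f (cinv c y) * (dens c y * Xf c y $ i)) x (axis i 1))"
    proof (rule integral_fderiv_compact_support_on(1)[OF open_img[OF c] _ C])
      show "C1_on (img c) (\<lambda>y. f (cinv c y) * (dens c y * Xf c y $ i))"
        using f c by (intro C1_on_mult C1_on_vec_nth C1_dens C1_Xf open_img) (auto simp: C1_fun_def)
      show "f (cinv c x) * (dens c x * Xf c x $ i) = 0" if "x \<in> img c - C" for x
        by (simp add: f(2) notC[OF that])
    qed
  qed
  also have "\<dots> = 0"
  proof (rule sum.neutral, safe)
    fix i
    show "integral\<^sup>L lborel (\<lambda>x. indicator (img c) x *
        fderiv (\<lambda>y. f (cinv c y) * (dens c y * Xf c y $ i)) x (axis i 1)) = 0"
    proof (rule integral_fderiv_compact_support_on(2)[OF open_img[OF c] _ C])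
      show "C1_on (img c) (\<lambda>y. f (cinv c y) * (dens c y * Xf c y $ i))"
        using f c by (intro C1_on_mult C1_on_vec_nth C1_dens C1_Xf open_img) (auto simp: C1_fun_def)
      show "f (cinv c x) * (dens c x * Xf c x $ i) = 0" if "x \<in> img c - C" for x
        by (simp add: f(2) notC[OF that])
    qed
  qed
  finally show ?thesis .
qed

lemma DX_diff:
  assumes p: "p \<in> topspace X" and f: "C1_fun f" "C1_fun g"
  shows "DX (\<lambda>p. f p - g p) p = DX f p - DX g p"
proof -
  obtain c where c: "c \<in> atlas M" "p \<in> cdom c" using p chart_exists by blast
  have d: "(\<lambda>x. f (cinv c x)) differentiable (at (cmap c p))" "(\<lambda>x. g (cinv c x)) differentiable (at (cmap c p))"
    using f c by (auto simp: C1_fun_def C1_on_def)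
  show ?thesis
    unfolding DX_chart[OF c C1_fun_diff[OF f]] DX_chart[OF c f(1)] DX_chart[OF c f(2)]
    using fderiv_eq[OF has_derivative_diff[OF has_fderiv[OF d(1)] has_fderiv[OF d(2)]]] by simp
qed

text \<open>Multiplying the test function by \<open>1 - \<kappa>\<close> for a cutoff function \<open>\<kappa>\<close> does not change the integral.
  Doing so for finitely many cutoff functions makes it vanish on \<open>K\<close>. This replaces a partition of
  unity.\<close>

lemma integral_integrand_cutoffs:
  assumes "finite S" "\<And>\<kappa>. \<kappa> \<in> S \<Longrightarrow> cutoff \<kappa>"
  shows "integral\<^sup>L vol (integrand (\<lambda>p. 1)) = integral\<^sup>L vol (integrand (\<lambda>p. \<Prod>\<kappa>\<in>S. (1 - \<kappa> p)))"
  using assms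
proof (induction S rule: finite_induct)
  case (insert \<kappa> S)
  let ?g = "\<lambda>p. \<Prod>\<kappa>\<in>S. (1 - \<kappa> p)"
  have \<kappa>: "cutoff \<kappa>" using insert by simp
  have C1: "C1_fun \<kappa>" "C1_fun ?g"
    using insert.prems by (auto simp: cutoff_def intro!: C1_fun_prod C1_fun_diff C1_fun_const)
  obtain c C where c: "c \<in> atlas M" "compact C" "C \<subseteq> img c" "\<forall>p. p \<notin> cinv c ` C \<longrightarrow> \<kappa> p = 0"
    using \<kappa> unfolding cutoff_def by blast
  have C1': "C1_fun (\<lambda>p. \<kappa> p * ?g p)" by (intro C1_fun_mult C1)
  have "integral\<^sup>L vol (integrand (\<lambda>p. \<kappa> p * ?g p)) = 0"
    by (rule integral_integrand_local[OF c(1-3) C1']) (use c(4) in auto)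
  then have "integral\<^sup>L vol (integrand ?g)
      = integral\<^sup>L vol (\<lambda>p. integrand ?g p - integrand (\<lambda>p. \<kappa> p * ?g p) p)"
    by (subst Bochner_Integration.integral_diff) (auto intro!: integrable_integrand C1 C1')
  also have "\<dots> = integral\<^sup>L vol (integrand (\<lambda>p. ?g p - \<kappa> p * ?g p))"
    by (rule Bochner_Integration.integral_cong[OF refl])
      (simp add: space_vol integrand_def DX_diff[OF _ C1(2) C1'] algebra_simps)
  also have "(\<lambda>p. ?g p - \<kappa> p * ?g p) = (\<lambda>p. \<Prod>\<kappa>\<in>insert \<kappa> S. (1 - \<kappa> p))"
    using insert by (simp add: algebra_simps)
  finally show ?case using insert by simp
qed simp

theorem integral_divergence: "(LINT p:K|vol. D p) = 0"
proof -
  have near: "\<exists>U. openin X U \<and> p \<in> U \<and> (\<exists>\<kappa>. cutoff \<kappa> \<and> (\<forall>q\<in>U. \<kappa> q = 1))" if "p \<in> K" for p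
    using cutoff_near compactin_subset_topspace[OF K] that by blast
  obtain F where F: "finite F" "\<And>U. U \<in> F \<Longrightarrow> openin X U \<and> (\<exists>\<kappa>. cutoff \<kappa> \<and> (\<forall>q\<in>U. \<kappa> q = 1))" "K \<subseteq> \<Union>F"
    by (rule compactin_finite_cover[OF K near], assumption) (rule that)
  have "\<forall>U\<in>F. \<exists>\<kappa>. cutoff \<kappa> \<and> (\<forall>q\<in>U. \<kappa> q = 1)" using F(2) by blast
  from bchoice[OF this] obtain k where "\<forall>U\<in>F. cutoff (k U) \<and> (\<forall>q\<in>U. k U q = 1)" by blast
  then have k: "\<And>U. U \<in> F \<Longrightarrow> cutoff (k U)" "\<And>U q. U \<in> F \<Longrightarrow> q \<in> U \<Longrightarrow> k U q = 1" by auto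
  define g where "g p = (\<Prod>\<kappa>\<in>k ` F. (1 - \<kappa> p))" for p
  have C1g: "C1_fun g"
    unfolding g_def[abs_def] using k(1) by (auto simp: cutoff_def intro!: C1_fun_prod C1_fun_diff C1_fun_const)
  have g0: "g p \<ge> 0" for p
    unfolding g_def using k(1) by (intro prod_nonneg) (auto simp: cutoff_def)
  have gK: "g p = 0" if p: "p \<in> K" for p
  proof -
    obtain U where U: "U \<in> F" "p \<in> U" using F(3) p by blast
    show ?thesis
      unfolding g_def by (rule prod_zero) (use F(1) U k(2)[OF U] in auto)
  qed
  have "integrand g p = 0" if p: "p \<in> topspace X" for p
  proof (cases "p \<in> K")
    case True
    obtain c where c: "c \<in> atlas M" "p \<in> cdom c" using p chart_exists by blast
    let ?x = "cmap c p"
    \<comment> \<open>\<open>g\<close> is nonnegative and equals 0 on \<open>K\<close>, so each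
      point of \<open>K\<close> is a minimum and a critical point. Off \<open>K\<close> the
      integrand is 0 because the vector field is.\<close>
    have "fderiv (\<lambda>x. g (cinv c x)) ?x = (\<lambda>v. 0)"
    proof (rule differential_zero_maxmin[of ?x "img c" "\<lambda>x. g (cinv c x)"])
      show "((\<lambda>x. g (cinv c x)) has_derivative fderiv (\<lambda>x. g (cinv c x)) ?x) (at ?x)"
        using C1g c by (intro has_fderiv) (auto simp: C1_fun_def C1_on_def)
      show "(\<forall>y\<in>img c. g (cinv c y) \<le> g (cinv c ?x)) \<or> (\<forall>y\<in>img c. g (cinv c ?x) \<le> g (cinv c y))"
        using g0 gK[OF True] c by simp
    qed (use c open_img in auto)
    then have "DX g p = 0" using DX_chart[OF c C1g] by simp
    then show ?thesis using gK[OF True] by (simp add: integrand_def)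
  next
    case False
    then show ?thesis using p C1g by (intro integrand_zero) auto
  qed
  then have "integral\<^sup>L vol (integrand g) = integral\<^sup>L vol (\<lambda>p. 0)"
    by (intro Bochner_Integration.integral_cong) (auto simp: space_vol)
  then have "integral\<^sup>L vol (integrand (\<lambda>p. 1)) = 0"
    using integral_integrand_cutoffs[of "k ` F"] F(1) k(1) by (auto simp: g_def[abs_def])
  moreover have "integral\<^sup>L vol (integrand (\<lambda>p. 1)) = (LINT p:K|vol. D p)"
    unfolding set_lebesgue_integral_def
  proof (rule Bochner_Integration.integral_cong[OF refl])
    fix p assume "p \<in> space vol"
    moreover have "DX (\<lambda>p. 1) p = 0" by (simp add: DX_def Let_def)
    ultimately show "integrand (\<lambda>p. 1) p = indicat_real K p *\<^sub>R D p"
      using D_zero[of p] by (auto simp: integrand_def indicator_def space_vol)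
  qed
  ultimately show ?thesis by simp
qed

end

section \<open>The warped product\<close>

lemma second_countable_prod_topology:
  assumes "second_countable X" "second_countable Y"
  shows "second_countable (prod_topology X Y)"
proof -
  obtain B where B: "countable B" "\<forall>V\<in>B. openin X V" "\<forall>U x. openin X U \<and> x \<in> U \<longrightarrow> (\<exists>V\<in>B. x \<in> V \<and> V \<subseteq> U)"
    using assms(1) unfolding second_countable_def by blast
  obtain C where C: "countable C" "\<forall>V\<in>C. openin Y V" "\<forall>U y. openin Y U \<and> y \<in> U \<longrightarrow> (\<exists>V\<in>C. y \<in> V \<and> V \<subseteq> U)"
    using assms(2) unfolding second_countable_def by blast
  show ?thesis
    unfolding second_countable_def
  proof (intro exI conjI allI impI)
    show "countable ((\<lambda>(U, V). U \<times> V) ` (B \<times> C))" using B C by auto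
    show "\<forall>W\<in>(\<lambda>(U, V). U \<times> V) ` (B \<times> C). openin (prod_topology X Y) W"
      using B C by (auto simp: openin_prod_Times_iff)
    fix W z assume W: "openin (prod_topology X Y) W \<and> z \<in> W"
    obtain x y where z: "z = (x, y)" by force
    obtain U V where UV: "openin X U" "openin Y V" "x \<in> U" "y \<in> V" "U \<times> V \<subseteq> W"
      using W unfolding z openin_prod_topology_alt by blast
    obtain U' where U': "U' \<in> B" "x \<in> U'" "U' \<subseteq> U" using B UV by blast
    obtain V' where V': "V' \<in> C" "y \<in> V'" "V' \<subseteq> V" using C UV by blast
    show "\<exists>V\<in>(\<lambda>(U, V). U \<times> V) ` (B \<times> C). z \<in> V \<and> V \<subseteq> W"
      using U' V' UV z by (intro bexI[of _ "U' \<times> V'"]) auto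
  qed
qed

lemma second_countable_euclideanreal: "second_countable euclideanreal"
proof -
  obtain B :: "real set set" where B: "countable B" "\<And>C. C \<in> B \<Longrightarrow> open C" "\<And>S. open S \<Longrightarrow> \<exists>U. U \<subseteq> B \<and> S = \<Union>U"
    by (rule univ_second_countable) blast
  show ?thesis
    unfolding second_countable_def
  proof (intro exI[of _ B] conjI allI impI)
    fix U and x :: real assume "openin euclideanreal U \<and> x \<in> U"
    then obtain V where "V \<subseteq> B" "U = \<Union>V" "x \<in> U" using B(3)[of U] by auto
    then show "\<exists>V\<in>B. x \<in> V \<and> V \<subseteq> U" by blast
  qed (use B in auto)
qed

definition warp :: "real \<Rightarrow> real" where "warp s = 1 + s + s ^ 4"

lemma warp_pos: "warp s > 0"
proof -
  \<comment> \<open>A sum of squares: the two multiples of the square of \<open>s\<close> cancel,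
    and the constants add up to 1.\<close>
  have "warp s = (s\<^sup>2 - 1/2)\<^sup>2 + (s + 1/2)\<^sup>2 + 1/2"
    by (simp add: warp_def power2_eq_square power4_eq_xxxx algebra_simps)
  then show ?thesis by (simp add: add_nonneg_pos)
qed

text \<open>\<open>'m\<close> is an arbitrary index type of size one more than \<open>'n\<close>.
  The bijection marks \<open>e None\<close> as the index of the real line factor and
  \<open>e (Some i)\<close> as the indices of the coordinates on the manifold.\<close>

locale coords =
  fixes e :: "'n::finite option \<Rightarrow> 'm::finite"
  assumes bij_e: "bij e"
begin

lemma inv_e [simp]: "inv e (e k) = k"
  using bij_e by (simp add: bij_is_inj)

lemma sum_e: "(\<Sum>k\<in>UNIV. f k) = f (e None) + (\<Sum>i\<in>UNIV. f (e (Some i)))"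
  for f :: "'m \<Rightarrow> 'b::comm_monoid_add"
proof -
  have "(\<Sum>k\<in>UNIV. f k) = (\<Sum>q\<in>UNIV. f (e q))" by (rule sum.reindex_bij_betw[OF bij_e, symmetric])
  then show ?thesis by (simp add: UNIV_option_conv sum.reindex)
qed

lemma all_e: "(\<forall>k. P k) \<longleftrightarrow> P (e None) \<and> (\<forall>i. P (e (Some i)))"
  by (metis bij_e bij_pointE option.exhaust)

text \<open>\<open>emb u a\<close> is the point with horizontal part \<open>u\<close> and vertical
  part \<open>a\<close>. It is assembled from linear maps so that its regularity follows from the
  closure rules.\<close>

definition emb1 :: "real^'n \<Rightarrow> real^'m"
  where "emb1 u = (\<chi> k. case inv e k of None \<Rightarrow> 0 | Some i \<Rightarrow> u $ i)"

definition emb :: "real^'n \<Rightarrow> real \<Rightarrow> real^'m"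
  where "emb u a = emb1 u + a *\<^sub>R axis (e None) 1"

definition hor :: "real^'m \<Rightarrow> real^'n" where "hor y = (\<chi> i. y $ e (Some i))"
definition ver :: "real^'m \<Rightarrow> real" where "ver y = y $ e None"

lemma e_neq [simp]: "e (Some i) \<noteq> e None" "e None \<noteq> e (Some i)" "e (Some i) = e (Some j) \<longleftrightarrow> i = j"
  using bij_e by (auto simp: bij_is_inj inj_eq)

lemma emb_nth [simp]: "emb u a $ e None = a" "emb u a $ e (Some i) = u $ i"
  by (auto simp: emb_def emb1_def axis_def)

lemma hor_emb [simp]: "hor (emb u a) = u" and ver_emb [simp]: "ver (emb u a) = a"
  by (simp_all add: hor_def ver_def vec_eq_iff)

lemma emb_hor_ver [simp]: "emb (hor y) (ver y) = y"
  by (simp add: vec_eq_iff all_e) (simp add: hor_def ver_def)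

lemma emb_eq_iff [simp]: "emb u a = emb v b \<longleftrightarrow> u = v \<and> a = b"
  by (metis hor_emb ver_emb)

lemma bounded_linear_emb1: "bounded_linear emb1"
  by (rule linear_conv_bounded_linear[THEN iffD1])
    (auto simp: linear_iff emb1_def vec_eq_iff all_e)

lemma bounded_linear_hor: "bounded_linear hor"
  by (rule linear_conv_bounded_linear[THEN iffD1]) (auto simp: linear_iff hor_def vec_eq_iff)

lemma bounded_linear_ver: "bounded_linear ver"
  by (rule linear_conv_bounded_linear[THEN iffD1]) (auto simp: linear_iff ver_def)

lemma emb_zero: "emb 0 0 = 0"
  by (simp add: vec_eq_iff all_e)

lemma inner_emb: "emb u a \<bullet> emb v b = u \<bullet> v + a * b"
  by (simp add: inner_vec_def sum_e)

lemma has_derivative_emb: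
  assumes "(f has_derivative f') F" "(g has_derivative g') F"
  shows "((\<lambda>x. emb (f x) (g x)) has_derivative (\<lambda>v. emb (f' v) (g' v))) F"
  unfolding emb_def
  by (intro has_derivative_add bounded_linear.has_derivative[OF bounded_linear_emb1]
      has_derivative_scaleR_left assms)

lemma smooth_on_emb:
  assumes "open S" "smooth_on S f" "smooth_on S g"
  shows "smooth_on S (\<lambda>x. emb (f x) (g x))"
  unfolding emb_def
  by (intro smooth_on_add smooth_on_linear_compose[OF bounded_linear_emb1] assms
      smooth_on_linear_compose[OF bounded_linear_scaleR_left])

lemma continuous_on_emb: "continuous_on UNIV (\<lambda>z. emb (fst z) (snd z))"
  unfolding emb_def
  by (intro continuous_intros bounded_linear.continuous_on[OF bounded_linear_emb1])

definition blk1 :: "real^'n^'n \<Rightarrow> real^'m^'m"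
  where "blk1 A = (\<chi> k l. case inv e k of None \<Rightarrow> 0 | Some i \<Rightarrow> (case inv e l of None \<Rightarrow> 0 | Some j \<Rightarrow> A $ i $ j))"

definition blk0 :: "real^'m^'m"
  where "blk0 = (\<chi> k l. if k = e None \<and> l = e None then 1 else 0)"

text \<open>The block matrix of \<open>warp s\<close> times \<open>A\<close> on the horizontal part
  and 1 on the vertical part. The scalar factor and the linear map \<open>blk1\<close> are kept
  apart so that smoothness and the derivative come from the product rule.\<close>

definition blk :: "real^'n^'n \<Rightarrow> real \<Rightarrow> real^'m^'m"
  where "blk A s = warp s *\<^sub>R blk1 A + blk0"

lemma bounded_linear_blk1: "bounded_linear blk1"
  by (rule linear_conv_bounded_linear[THEN iffD1])
    (auto simp: linear_iff blk1_def vec_eq_iff all_e)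

lemma blk_nth [simp]: "blk A s $ e None $ e None = 1" "blk A s $ e (Some i) $ e None = 0"
   "blk A s $ e None $ e (Some j) = 0" "blk A s $ e (Some i) $ e (Some j) = warp s * A $ i $ j"
  by (simp_all add: blk_def blk1_def blk0_def)

lemma blk_mult_emb: "blk A s *v emb u a = emb (warp s *\<^sub>R (A *v u)) a"
  by (simp add: vec_eq_iff all_e) (simp add: matrix_vector_mult_def sum_e sum_distrib_left mult_ac)

lemma inner_blk: "emb u a \<bullet> (blk A s *v emb v b) = warp s * (u \<bullet> (A *v v)) + a * b"
  by (simp add: blk_mult_emb inner_emb)

lemma spd_blk:
  assumes "spd A"
  shows "spd (blk A s)"
  unfolding spd_def
proof (intro conjI allI impI)
  have "A $ i $ j = A $ j $ i" for i j
    using assms unfolding spd_def transpose_def by (metis (no_types, lifting) vec_lambda_beta)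
  then show "transpose (blk A s) = blk A s"
    by (simp add: transpose_def vec_eq_iff all_e)
next
  fix v :: "real^'m" assume "v \<noteq> 0"
  obtain u a where v: "v = emb u a" by (metis emb_hor_ver)
  show "v \<bullet> (blk A s *v v) > 0"
  proof (cases "u = 0")
    case True
    then have "a \<noteq> 0" using \<open>v \<noteq> 0\<close> v emb_zero by auto
    then show ?thesis unfolding v inner_blk using True by (simp add: power2_eq_square[symmetric])
  next
    case False
    then have "u \<bullet> (A *v u) > 0" using assms by (simp add: spd_def)
    then show ?thesis unfolding v inner_blk using warp_pos[of s] by (intro add_pos_nonneg) auto
  qed
qed

lemma smooth_on_blk:
  fixes A :: "'b::real_normed_vector \<Rightarrow> real^'n^'n"
  assumes "open S" "smooth_on S A" "smooth_on S s"
  shows "smooth_on S (\<lambda>x. blk (A x) (s x))"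
  unfolding blk_def warp_def
  by (intro smooth_on_add smooth_on_bilinear[OF bounded_bilinear_scaleR] smooth_on_const smooth_on_power
      smooth_on_linear_compose[OF bounded_linear_blk1] assms)

definition ext :: "('a, 'n) chart \<Rightarrow> ('a \<times> real, 'm) chart"
  where "ext c = (cdom c \<times> UNIV, \<lambda>(p, s). emb (cmap c p) s)"

text \<open>A left inverse of \<open>ext\<close>. A metric takes the chart as an argument, so the
  product metric has to recover the chart of the factor from the product chart.\<close>

definition base :: "('a \<times> real, 'm) chart \<Rightarrow> ('a, 'n) chart"
  where "base d = (fst ` cdom d, \<lambda>p. hor (cmap d (p, 0)))"

lemma cdom_ext [simp]: "cdom (ext c) = cdom c \<times> UNIV"
  and cmap_ext [simp]: "cmap (ext c) (p, s) = emb (cmap c p) s"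
  by (simp_all add: ext_def cdom_def cmap_def)

lemma base_ext [simp]: "base (ext c) = c"
  by (simp add: base_def) (simp add: cdom_def cmap_def)

definition warped :: "('a, 'n) riem \<Rightarrow> ('a \<times> real, 'm) riem"
  where "warped M = \<lparr>space_of = prod_topology (space_of M) euclideanreal, atlas = ext ` atlas M,
    metric = (\<lambda>d (p, s). blk (metric M (base d) p) s)\<rparr>"

lemma warped_simps [simp]: "space_of (warped M) = prod_topology (space_of M) euclideanreal"
  "atlas (warped M) = ext ` atlas M" "metric (warped M) (ext c) (p, s) = blk (metric M c p) s"
  by (simp_all add: warped_def)

end

section \<open>Product charts and the warped metric\<close>

locale warped_product = coords e + nonempty_riemannian M
  for e :: "'n::finite option \<Rightarrow> 'm::finite" and M :: "('a, 'n) riem"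
begin

lemma img_ext: "cmap (ext c) ` (S \<times> UNIV) = {y. hor y \<in> cmap c ` S}"
proof safe
  fix y p assume "hor y = cmap c p" "p \<in> S"
  then have "y = cmap (ext c) (p, ver y)" using emb_hor_ver[of y] by simp
  with \<open>p \<in> S\<close> show "y \<in> cmap (ext c) ` (S \<times> UNIV)" by blast
qed auto

lemma open_vimage_hor: "open S \<Longrightarrow> open {y. hor y \<in> S}"
  using open_vimage[OF _ bounded_linear.continuous_on[OF bounded_linear_hor continuous_on_id]]
  by (simp add: vimage_def)

context
  fixes c assumes c: "c \<in> atlas M"
begin

lemma cinv_ext: "hor y \<in> img c \<Longrightarrow> cinv (ext c) y = (cinv c (hor y), ver y)"
proof -
  assume y: "hor y \<in> img c"
  have inj: "inj_on (cmap (ext c)) (cdom (ext c))"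
    using inj_cmap[OF c] by (auto simp: inj_on_def)
  have "y = cmap (ext c) (cinv c (hor y), ver y)" using y c by simp
  then show ?thesis
    unfolding cinv_def[of "ext c"] using y c by (metis inv_into_f_f[OF inj] SigmaI UNIV_I cdom_ext cinv_in)
qed

lemma local_metric_ext:
  "hor y \<in> img c \<Longrightarrow> local_metric (warped M) (ext c) y = blk (local_metric M c (hor y)) (ver y)"
  by (simp add: local_metric_def cinv_ext)

lemma homeomorphic_ext:
  "homeomorphic_map (subtopology (space_of (warped M)) (cdom (ext c)))
     (top_of_set (cmap (ext c) ` cdom (ext c))) (cmap (ext c))"
proof (rule homeomorphic_maps_imp_map)
  have sub: "subtopology (space_of (warped M)) (cdom (ext c)) = prod_topology (subtopology X (cdom c)) euclideanreal"
    by (simp add: subtopology_Times)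
  have "continuous_map (prod_topology (subtopology X (cdom c)) euclideanreal) euclidean
      ((\<lambda>z. emb (fst z) (snd z)) \<circ> (\<lambda>z. (cmap c (fst z), snd z)))"
  proof (rule continuous_map_compose)
    have "continuous_map (prod_topology (subtopology X (cdom c)) euclideanreal) euclidean (cmap c \<circ> fst)"
      by (rule continuous_map_compose[OF continuous_map_fst continuous_cmap[OF c]])
    then show "continuous_map (prod_topology (subtopology X (cdom c)) euclideanreal) (prod_topology euclidean euclideanreal)
        (\<lambda>z. (cmap c (fst z), snd z))"
      by (intro continuous_map_pairedI continuous_map_snd) (simp add: comp_def)
    show "continuous_map (prod_topology euclidean euclideanreal) euclidean (\<lambda>z. emb (fst z) (snd z))"
      using continuous_on_emb by simp
  qed
  moreover have "(\<lambda>z. emb (fst z) (snd z)) \<circ> (\<lambda>z. (cmap c (fst z), snd z)) = cmap (ext c)"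
    by (auto simp: fun_eq_iff)
  ultimately have 1: "continuous_map (prod_topology (subtopology X (cdom c)) euclideanreal)
      (top_of_set (cmap (ext c) ` cdom (ext c))) (cmap (ext c))"
    using cdom_subset[OF c] by (auto simp: continuous_map_in_subtopology)
  let ?S = "{y. hor y \<in> img c}"
  have "continuous_map (top_of_set ?S) (subtopology X (cdom c)) (cinv c \<circ> hor)"
  proof (rule continuous_map_compose[of _ "top_of_set (img c)"])
    show "continuous_map (top_of_set ?S) (top_of_set (img c)) hor"
      by (auto simp: continuous_map_in_subtopology intro!: bounded_linear.continuous_on[OF bounded_linear_hor] continuous_on_id)
    show "continuous_map (top_of_set (img c)) (subtopology X (cdom c)) (cinv c)"
      using continuous_cinv[OF c] c by (auto simp: continuous_map_in_subtopology)
  qed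
  moreover have "continuous_map (top_of_set ?S) euclideanreal ver"
    by (auto intro!: bounded_linear.continuous_on[OF bounded_linear_ver] continuous_on_id)
  ultimately have 2: "continuous_map (top_of_set ?S) (prod_topology (subtopology X (cdom c)) euclideanreal)
      (\<lambda>y. (cinv c (hor y), ver y))"
    by (intro continuous_map_pairedI) (simp_all add: comp_def)
  show "homeomorphic_maps (subtopology (space_of (warped M)) (cdom (ext c)))
     (top_of_set (cmap (ext c) ` cdom (ext c))) (cmap (ext c)) (\<lambda>y. (cinv c (hor y), ver y))"
    unfolding homeomorphic_maps_def sub
    using 1 2 c by (auto simp: img_ext)
qed

end

lemma transition_ext:
  assumes c: "c \<in> atlas M" "c' \<in> atlas M" and y: "hor y \<in> overlap c c'"
  shows "(cmap (ext c') \<circ> cinv (ext c)) y = emb (transition c c' (hor y)) (ver y)"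
  using y c by (simp add: cinv_ext overlap_iff transition_def)

lemma image_overlap_ext: "cmap (ext c) ` (cdom (ext c) \<inter> cdom (ext c')) = {y. hor y \<in> overlap c c'}"
  using img_ext[of c "cdom c \<inter> cdom c'"] by (simp add: overlap_def Times_Int_Times)

lemma has_derivative_transition_ext:
  assumes c: "c \<in> atlas M" "c' \<in> atlas M" and y: "hor y \<in> overlap c c'"
  shows "((cmap (ext c') \<circ> cinv (ext c)) has_derivative
    (\<lambda>v. emb (fderiv (transition c c') (hor y) (hor v)) (ver v))) (at y)"
proof (rule has_derivative_cong_open[where S="{y. hor y \<in> overlap c c'}"])
  have "(transition c c' has_derivative fderiv (transition c c') (hor y)) (at (hor y))"
    by (rule has_fderiv[OF smooth_on_differentiable[OF smooth_trans[OF c] y]])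
  from has_derivative_compose[OF bounded_linear_imp_has_derivative[OF bounded_linear_hor] this]
  show "((\<lambda>y. emb (transition c c' (hor y)) (ver y)) has_derivative
      (\<lambda>v. emb (fderiv (transition c c') (hor y) (hor v)) (ver v))) (at y)"
    by (intro has_derivative_emb bounded_linear_imp_has_derivative[OF bounded_linear_ver])
qed (use y c open_overlap[OF c] transition_ext[OF c] in \<open>auto intro: open_vimage_hor\<close>)

text \<open>Transition maps of product charts act on the horizontal part by those of
  \<open>M\<close> and fix the vertical coordinate, on which the warping factor depends. Each chart
  condition therefore reduces to the one for \<open>M\<close>.\<close>

theorem riemannian_warped: "riemannian_manifold (warped M)"
  unfolding riemannian_manifold_def
proof (intro conjI)
  show "Hausdorff_space (space_of (warped M))"
    using Hausdorff by (simp add: Hausdorff_space_prod_topology)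
  show "second_countable (space_of (warped M))"
    using second_countable by (simp add: second_countable_prod_topology second_countable_euclideanreal)
  show "smooth_atlas (space_of (warped M)) (atlas (warped M))"
    unfolding smooth_atlas_def
  proof (intro conjI ballI)
    show "(\<Union>d\<in>atlas (warped M). cdom d) = topspace (space_of (warped M))"
      using charts_cover by auto
  next
    fix d assume "d \<in> atlas (warped M)"
    then obtain c where c: "c \<in> atlas M" "d = ext c" by auto
    show "openin (space_of (warped M)) (cdom d)"
      using c openin_cdom[OF c(1)] by (simp add: openin_prod_Times_iff)
    show "open (cmap d ` cdom d)"
      using c open_img[OF c(1)] by (simp add: img_ext open_vimage_hor)
    show "homeomorphic_map (subtopology (space_of (warped M)) (cdom d)) (top_of_set (cmap d ` cdom d)) (cmap d)"
      using homeomorphic_ext[OF c(1)] c by simp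
  next
    fix d d' assume "d \<in> atlas (warped M)" "d' \<in> atlas (warped M)"
    then obtain c c' where c: "c \<in> atlas M" "c' \<in> atlas M" and d: "d = ext c" "d' = ext c'" by auto
    have o: "open {y. hor y \<in> overlap c c'}" by (intro open_vimage_hor open_overlap c)
    show "smooth_on (cmap d ` (cdom d \<inter> cdom d')) (cmap d' \<circ> cinv d)"
      unfolding d image_overlap_ext
    proof (rule smooth_on_cong[OF o transition_ext[OF c, symmetric]])
      show "smooth_on {y. hor y \<in> overlap c c'} (\<lambda>y. emb (transition c c' (hor y)) (ver y))"
        by (intro smooth_on_emb o smooth_on_bounded_linear[OF bounded_linear_ver]
            smooth_on_compose_linear[OF bounded_linear_hor _ _ smooth_trans[OF c]]) auto
    qed simp
  qed
  show "\<forall>d\<in>atlas (warped M). smooth_on (cmap d ` cdom d) (local_metric (warped M) d) \<and>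
      (\<forall>p\<in>cdom d. transpose (metric (warped M) d p) = metric (warped M) d p \<and>
         (\<forall>v. v \<noteq> 0 \<longrightarrow> 0 < inner_at (warped M) d p v v))"
  proof (intro ballI conjI)
    fix d assume "d \<in> atlas (warped M)"
    then obtain c where c: "c \<in> atlas M" and d: "d = ext c" by auto
    have o: "open {y. hor y \<in> img c}" by (intro open_vimage_hor open_img c)
    show "smooth_on (cmap d ` cdom d) (local_metric (warped M) d)"
      unfolding d cdom_ext img_ext
    proof (rule smooth_on_cong[OF o local_metric_ext[OF c, symmetric]])
      show "smooth_on {y. hor y \<in> img c} (\<lambda>y. blk (local_metric M c (hor y)) (ver y))"
        by (intro smooth_on_blk o smooth_on_bounded_linear[OF bounded_linear_ver]
            smooth_on_compose_linear[OF bounded_linear_hor _ _ smooth_local_metric[OF c]]) auto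
    qed simp
    fix z assume "z \<in> cdom d"
    then obtain p s where "z = (p, s)" "p \<in> cdom c" by (auto simp: d)
    then have "spd (metric (warped M) d z)" using spd_blk[OF spd_metric[OF c]] by (simp add: d)
    then show "transpose (metric (warped M) d z) = metric (warped M) d z"
      "\<forall>v. v \<noteq> 0 \<longrightarrow> 0 < inner_at (warped M) d z v v" by (auto simp: spd_def inner_at_def)
  qed
  show "\<forall>d\<in>atlas (warped M). \<forall>d'\<in>atlas (warped M). \<forall>z\<in>cdom d \<inter> cdom d'. \<forall>u v.
      let J = fderiv (cmap d' \<circ> cinv d) (cmap d z)
      in inner_at (warped M) d z u v = inner_at (warped M) d' z (J u) (J v)"
  proof (intro ballI allI)
    fix d d' z u v assume "d \<in> atlas (warped M)" "d' \<in> atlas (warped M)" "z \<in> cdom d \<inter> cdom d'"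
    then obtain c c' p s where c: "c \<in> atlas M" "c' \<in> atlas M" and d: "d = ext c" "d' = ext c'"
      and p: "z = (p, s)" "p \<in> cdom c" "p \<in> cdom c'" by auto
    have x: "cmap c p \<in> overlap c c'" using p by (auto simp: overlap_def)
    let ?J = "fderiv (transition c c') (cmap c p)"
    have J: "fderiv (cmap d' \<circ> cinv d) (cmap d z) w = emb (?J (hor w)) (ver w)" for w
      using fderiv_eq[OF has_derivative_transition_ext[OF c, of "emb (cmap c p) s"]] x by (simp add: d p)
    have "hor u \<bullet> (metric M c p *v hor v) = ?J (hor u) \<bullet> (metric M c' p *v ?J (hor v))"
      using pullback_trans[OF c, unfolded pullback_on_def, rule_format, OF x, of "hor u" "hor v"] p c
      by (simp add: local_metric_def trans_cmap)
    then have "emb (hor u) (ver u) \<bullet> (blk (metric M c p) s *v emb (hor v) (ver v))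
        = emb (?J (hor u)) (ver u) \<bullet> (blk (metric M c' p) s *v emb (?J (hor v)) (ver v))"
      unfolding inner_blk by simp
    then show "let J = fderiv (cmap d' \<circ> cinv d) (cmap d z)
      in inner_at (warped M) d z u v = inner_at (warped M) d' z (J u) (J v)"
      unfolding Let_def J inner_at_def by (simp add: d p)
  qed
qed

section \<open>The slice as an isometric embedding\<close>

definition slice :: "'a \<Rightarrow> 'a \<times> real" where "slice p = (p, 0)"

lemma local_rep_slice:
  assumes c: "c \<in> atlas M" "c' \<in> atlas M"
  shows "cmap c ` (cdom c \<inter> slice -` cdom (ext c')) = overlap c c'"
    and "x \<in> overlap c c' \<Longrightarrow> local_rep c (ext c') slice x = emb (transition c c' x) 0"
  using c by (auto simp: slice_def overlap_def local_rep_def transition_def vimage_def Int_def)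

lemma smooth_slice: "smooth_map M (warped M) slice"
  unfolding smooth_map_def
proof (intro conjI ballI)
  show "continuous_map (space_of M) (space_of (warped M)) slice"
    unfolding slice_def by (auto intro!: continuous_map_pairedI)
  fix c d assume c: "c \<in> atlas M" "d \<in> atlas (warped M)"
  then obtain c' where c': "c' \<in> atlas M" "d = ext c'" by auto
  show "smooth_on (cmap c ` (cdom c \<inter> slice -` cdom d)) (local_rep c d slice)"
    unfolding c' local_rep_slice(1)[OF c(1) c'(1)]
  proof (rule smooth_on_cong[OF open_overlap[OF c(1) c'(1)] local_rep_slice(2)[OF c(1) c'(1), symmetric]])
    show "smooth_on (overlap c c') (\<lambda>x. emb (transition c c' x) 0)"
      by (intro smooth_on_emb open_overlap smooth_trans smooth_on_const c c')
  qed
qed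

text \<open>The projection to the first factor is a continuous left inverse, which makes the slice a
  topological embedding. The metric pulls back correctly because \<open>warp 0\<close> is 1.\<close>

theorem isometric_slice: "isometric_embedding M (warped M) slice"
  unfolding isometric_embedding_def
proof (intro conjI smooth_slice ballI allI)
  have "retraction_maps (space_of (warped M)) (space_of M) fst slice"
    unfolding retraction_maps_def using smooth_slice
    by (auto simp: smooth_map_def slice_def continuous_map_fst)
  then show "embedding_map (space_of M) (space_of (warped M)) slice"
    by (intro section_imp_embedding_map) (auto simp: section_map_def)
  fix c d p u v assume c: "c \<in> atlas M" "d \<in> atlas (warped M)" "p \<in> cdom c \<inter> slice -` cdom d"
  then obtain c' where c': "c' \<in> atlas M" "d = ext c'" "p \<in> cdom c'" by (auto simp: slice_def)
  let ?F = "transition c c'" and ?x = "cmap c p"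
  have x: "?x \<in> overlap c c'" using c c' by (auto simp: overlap_def)
  have "((\<lambda>x. emb (?F x) 0) has_derivative (\<lambda>v. emb (fderiv ?F ?x v) 0)) (at ?x)"
    by (intro has_derivative_emb has_fderiv smooth_on_differentiable[OF smooth_trans[OF c(1) c'(1)] x]) simp
  then have "(local_rep c d slice has_derivative (\<lambda>v. emb (fderiv ?F ?x v) 0)) (at ?x)"
    by (rule has_derivative_cong_open[OF _ open_overlap[OF c(1) c'(1)] x])
      (simp add: c' local_rep_slice(2)[OF c(1) c'(1)])
  then have D: "fderiv (local_rep c d slice) ?x = (\<lambda>v. emb (fderiv ?F ?x v) 0)" by (rule fderiv_eq)
  have "u \<bullet> (metric M c p *v v) = fderiv ?F ?x u \<bullet> (metric M c' p *v fderiv ?F ?x v)"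
    using pullback_trans[OF c(1) c'(1), unfolded pullback_on_def, rule_format, OF x, of u v] c c'
    by (simp add: local_metric_def trans_cmap)
  then show "let D = fderiv (local_rep c d slice) ?x
      in inner_at M c p u v = inner_at (warped M) d (slice p) (D u) (D v)"
    unfolding Let_def D inner_at_def by (simp add: c' slice_def inner_blk warp_def)
qed

end

section \<open>Smooth families of maps\<close>

lemma C1_on_christoffel:
  fixes h :: "real^'n \<Rightarrow> real^'n^'n"
  assumes V: "open V" "smooth_on V h" "\<And>y. y \<in> V \<Longrightarrow> invertible (h y)"
  shows "C1_on V (\<lambda>y. christoffel h y k i j)"
proof (rule C1_on_cong[OF V(1)])
  show "C1_on V (\<lambda>y. (\<Sum>l\<in>UNIV. matrix_inv (h y) $ k $ l *
     (fderiv h y (axis i 1) $ j $ l + fderiv h y (axis j 1) $ i $ l - fderiv h y (axis l 1) $ i $ j)) / 2)"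
    using V by (intro C1_on_divide C1_on_sum C1_on_mult C1_on_add C1_on_diff C1_on_matrix_inv C1_on_vec_nth
        smooth_on_C1 smooth_on_fderiv C1_on_const) auto
qed (simp add: christoffel_def partial_component smooth_on_differentiable[OF V(2)])

lemma chr_axis: "chr g x (axis i 1) (axis j 1) $ k = christoffel g x k i j"
proof -
  have "chr g x (axis i 1) (axis j 1) $ k =
      (\<Sum>a\<in>UNIV. \<Sum>b\<in>UNIV. if b = j then (if a = i then christoffel g x k a b else 0) else 0)"
    unfolding chr_def vec_lambda_beta by (intro sum.cong refl) (simp add: axis_def)
  then show ?thesis by simp
qed

lemma has_derivative_slice:
  assumes "(G has_derivative G') (at (x, t))"
  shows "((\<lambda>x. G (x, t)) has_derivative (\<lambda>v. G' (v, 0))) (at x)"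
    and "((\<lambda>t. G (x, t)) has_derivative (\<lambda>s. G' (0, s))) (at t)"
proof -
  have "((\<lambda>x. (x, t)) has_derivative (\<lambda>v. (v, 0))) (at x)" "((\<lambda>t. (x, t)) has_derivative (\<lambda>s. (0, s))) (at t)"
    by (auto intro!: derivative_eq_intros)
  then show "((\<lambda>x. G (x, t)) has_derivative (\<lambda>v. G' (v, 0))) (at x)"
    "((\<lambda>t. G (x, t)) has_derivative (\<lambda>s. G' (0, s))) (at t)"
    using assms by (auto intro: has_derivative_compose)
qed

lemma has_derivative_time:
  fixes G :: "'a::real_normed_vector \<times> real \<Rightarrow> 'b::real_normed_vector"
  assumes "(G has_derivative G') (at (x, t))"
  shows "((\<lambda>t. G (x, t)) has_derivative (\<lambda>s. s *\<^sub>R G' (0, 1))) (at t)"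
proof -
  have "G' (0, s) = s *\<^sub>R G' (0, 1)" for s
    using linear_cmul[OF has_derivative_linear[OF assms], of s "(0, 1)"] by simp
  then have "(\<lambda>s. G' (0, s)) = (\<lambda>s. s *\<^sub>R G' (0, 1))" by (rule ext)
  then show ?thesis using has_derivative_slice(2)[OF assms] by metis
qed

lemma has_real_derivative_time:
  assumes "(G has_derivative G') (at (x, t))"
  shows "((\<lambda>t. G (x, t)) has_real_derivative G' (0, 1)) (at t)"
  using has_derivative_time[OF assms] by (simp add: has_field_derivative_def mult_commute_abs)

lemma open_slice: "open \<Omega> \<Longrightarrow> open {x. (x, t) \<in> \<Omega>}" "open \<Omega> \<Longrightarrow> open {t. (x, t) \<in> \<Omega>}"
proof -
  assume "open \<Omega>"
  then have "open ((\<lambda>x. (x, t)) -` \<Omega>)" "open ((\<lambda>t. (x, t)) -` \<Omega>)"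
    using open_vimage[OF _ continuous_on_Pair[OF continuous_on_id continuous_on_const]]
      open_vimage[OF _ continuous_on_Pair[OF continuous_on_const continuous_on_id]] by blast+
  then show "open {x. (x, t) \<in> \<Omega>}" "open {t. (x, t) \<in> \<Omega>}" by (simp_all add: vimage_def)
qed

lemma smooth_slice_fun:
  assumes "open \<Omega>" "smooth_on \<Omega> G"
  shows "smooth_on {x. (x, t) \<in> \<Omega>} (\<lambda>x. G (x, t))"
proof -
  have "bounded_linear (\<lambda>x. (x, 0))"
    by (intro bounded_linear_Pair bounded_linear_ident bounded_linear_zero)
  from smooth_on_compose_affine[OF this open_slice(1)[OF assms(1)], of "(0, t)" t \<Omega> G] assms(2)
  show ?thesis by auto
qed

context
  fixes F :: "(real^'n) \<times> real \<Rightarrow> real^'m" and \<Omega> :: "((real^'n) \<times> real) set"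
  assumes \<Omega>: "open \<Omega>" and F: "smooth_on \<Omega> F"
begin

lemma fderiv_slice: "(x, t) \<in> \<Omega> \<Longrightarrow> fderiv (\<lambda>x. F (x, t)) x v = fderiv F (x, t) (v, 0)"
  by (rule fun_cong[OF fderiv_eq[OF has_derivative_slice(1)]]) (rule has_fderiv[OF smooth_on_differentiable[OF F]])

lemma fderiv2_slice:
  assumes z: "(x, t) \<in> \<Omega>"
  shows "fderiv2 (\<lambda>x. F (x, t)) x u v = fderiv2 F (x, t) (u, 0) (v, 0)"
proof -
  have "fderiv (\<lambda>y. fderiv (\<lambda>x. F (x, t)) y v) x = fderiv (\<lambda>y. fderiv F (y, t) (v, 0)) x"
    by (rule fderiv_cong_open[OF open_slice(1)[OF \<Omega>]]) (use z in \<open>auto simp: fderiv_slice\<close>)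
  also have "\<dots> = (\<lambda>u. fderiv (\<lambda>z. fderiv F z (v, 0)) (x, t) (u, 0))"
    by (rule fderiv_eq[OF has_derivative_slice(1)])
      (rule has_fderiv[OF smooth_on_differentiable[OF smooth_on_fderiv[OF F] z]])
  finally show ?thesis by (simp add: fderiv2_def)
qed

text \<open>The tension of each time slice in terms of derivatives of the space-time map
  \<open>F\<close>. In this form its joint regularity in \<open>x\<close> and \<open>t\<close> can
  be read off.\<close>

lemma tension_slice:
  assumes z: "(x, t) \<in> \<Omega>"
  shows "local_tension g h (\<lambda>x. F (x, t)) x $ k = (\<Sum>i\<in>UNIV. \<Sum>j\<in>UNIV. matrix_inv (g x) $ i $ j *
    (fderiv2 F (x, t) (axis i 1, 0) (axis j 1, 0) $ k
      + (\<Sum>a\<in>UNIV. \<Sum>b\<in>UNIV. christoffel h (F (x, t)) k a b * fderiv F (x, t) (axis i 1, 0) $ a * fderiv F (x, t) (axis j 1, 0) $ b)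
      - (\<Sum>l\<in>UNIV. christoffel g x l i j * fderiv F (x, t) (axis l 1, 0) $ k)))"
proof -
  have lin: "linear (\<lambda>v. fderiv F (x, t) (v, 0))"
    using linear_compose[OF _ linear_fderiv[OF smooth_on_differentiable[OF F z]], of "\<lambda>v. (v, 0)"]
    by (simp add: comp_def linear_iff)
  have "fderiv F (x, t) (chr g x (axis i 1) (axis j 1), 0) $ k
      = (\<Sum>l\<in>UNIV. christoffel g x l i j * fderiv F (x, t) (axis l 1, 0) $ k)" for i j
    by (subst linear_expand[OF lin]) (simp add: chr_axis)
  then show ?thesis
    unfolding local_tension_sff by (simp add: sff_def fderiv_slice[OF z] fderiv2_slice[OF z] chr_def)
qed

lemma C1_on_tension:
  assumes U: "open U" "smooth_on U g" "\<And>x. x \<in> U \<Longrightarrow> invertible (g x)"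
    and V: "open V" "smooth_on V h" "\<And>y. y \<in> V \<Longrightarrow> invertible (h y)"
    and sub: "fst ` \<Omega> \<subseteq> U" "F ` \<Omega> \<subseteq> V"
  shows "C1_on \<Omega> (\<lambda>(x, t). local_tension g h (\<lambda>x. F (x, t)) x $ k)"
proof (rule C1_on_cong[OF \<Omega>])
  let ?f = "\<lambda>z. \<Sum>i\<in>UNIV. \<Sum>j\<in>UNIV. matrix_inv (g (fst z)) $ i $ j *
    (fderiv2 F z (axis i 1, 0) (axis j 1, 0) $ k
      + (\<Sum>a\<in>UNIV. \<Sum>b\<in>UNIV. christoffel h (F z) k a b * fderiv F z (axis i 1, 0) $ a * fderiv F z (axis j 1, 0) $ b)
      - (\<Sum>l\<in>UNIV. christoffel g (fst z) l i j * fderiv F z (axis l 1, 0) $ k))"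
  have C1U: "C1_on \<Omega> (\<lambda>z. q (fst z))" if "C1_on U q" for q :: "real^'n \<Rightarrow> real"
    by (rule C1_on_compose[OF \<Omega> that _ sub(1)]) (intro C1_on_linear bounded_linear_fst \<Omega>)
  have C1V: "C1_on \<Omega> (\<lambda>z. q (F z))" if "C1_on V q" for q :: "real^'m \<Rightarrow> real"
    by (rule C1_on_compose[OF \<Omega> that smooth_on_C1[OF F] sub(2)])
  show "C1_on \<Omega> ?f"
    unfolding fderiv2_def
    by (intro C1_on_sum C1_on_mult C1_on_add C1_on_diff \<Omega> C1U[OF C1_on_matrix_inv] C1U[OF C1_on_christoffel]
        C1V[OF C1_on_christoffel] C1_on_vec_nth smooth_on_C1 smooth_on_fderiv F U V) (auto intro: U V)
  show "?f z = (case z of (x, t) \<Rightarrow> local_tension g h (\<lambda>x. F (x, t)) x $ k)" if "z \<in> \<Omega>" for z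
    using that tension_slice[of "fst z" "snd z"] by (cases z) auto
qed

end

text \<open>Contractions of the metric with its inverse. They turn metric traces into the ordinary
  traces that occur in coordinate divergences.\<close>

lemma trace_metric:
  fixes A :: "real^'n^'n" and w :: "'n \<Rightarrow> real^'n"
  assumes A: "spd A"
  shows "(\<Sum>i\<in>UNIV. \<Sum>j\<in>UNIV. matrix_inv A $ i $ j * (w i \<bullet> (A *v axis j 1))) = (\<Sum>i\<in>UNIV. w i $ i)"
    and "(\<Sum>i\<in>UNIV. \<Sum>j\<in>UNIV. matrix_inv A $ i $ j * (axis i 1 \<bullet> (A *v w j))) = (\<Sum>i\<in>UNIV. w i $ i)"
    and "(\<Sum>i\<in>UNIV. \<Sum>j\<in>UNIV. matrix_inv A $ i $ j * (A *v w i) $ j) = (\<Sum>i\<in>UNIV. w i $ i)"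
    and "matrix_inv A $ i $ j = matrix_inv A $ j $ i"
proof -
  have tA: "transpose A = A" using A by (simp add: spd_def)
  note inv = matrix_inv_works[OF spd_invertible[OF A]]
  have "transpose (A ** matrix_inv A) = mat 1" by (simp add: inv transpose_mat)
  then have "transpose (matrix_inv A) ** A = mat 1" by (simp add: matrix_transpose_mul tA)
  then have "A ** transpose (matrix_inv A) = mat 1" by (simp add: matrix_left_right_inverse)
  then have sym: "transpose (matrix_inv A) = matrix_inv A" by (rule matrix_inv_unique[symmetric])
  show symc: "matrix_inv A $ i $ j = matrix_inv A $ j $ i" for i j
    using arg_cong[OF sym, of "\<lambda>B. B $ j $ i"] by (simp add: transpose_def)
  have 3: "(\<Sum>j\<in>UNIV. matrix_inv A $ i $ j * (A *v u) $ j) = u $ i" for i u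
  proof -
    have "(\<Sum>j\<in>UNIV. matrix_inv A $ i $ j * (A *v u) $ j) = (matrix_inv A *v (A *v u)) $ i"
      by (simp add: matrix_vector_mult_def)
    then show ?thesis by (simp add: matrix_vector_mul_assoc inv)
  qed
  then show "(\<Sum>i\<in>UNIV. \<Sum>j\<in>UNIV. matrix_inv A $ i $ j * (A *v w i) $ j) = (\<Sum>i\<in>UNIV. w i $ i)" by simp
  have ax: "axis j 1 \<bullet> u = u $ j" for j and u :: "real^'n" by (simp add: inner_axis')
  have "w i \<bullet> (A *v axis j 1) = (A *v w i) $ j" for i j by (simp add: spd_symmetric[OF A, of "w i"] ax)
  then show "(\<Sum>i\<in>UNIV. \<Sum>j\<in>UNIV. matrix_inv A $ i $ j * (w i \<bullet> (A *v axis j 1))) = (\<Sum>i\<in>UNIV. w i $ i)"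
    using 3 by simp
  have "(\<Sum>i\<in>UNIV. \<Sum>j\<in>UNIV. matrix_inv A $ i $ j * (axis i 1 \<bullet> (A *v w j)))
      = (\<Sum>j\<in>UNIV. \<Sum>i\<in>UNIV. matrix_inv A $ j $ i * (A *v w j) $ i)"
    by (subst sum.swap) (simp add: ax symc)
  then show "(\<Sum>i\<in>UNIV. \<Sum>j\<in>UNIV. matrix_inv A $ i $ j * (axis i 1 \<bullet> (A *v w j))) = (\<Sum>i\<in>UNIV. w i $ i)"
    using 3 by simp
qed

text \<open>\<open>Y\<close> is the gradient of \<open>v\<close>. Differentiating \<open>g Y = dv\<close> avoids the derivative of the inverse
  matrix.\<close>

lemma divergence_formula:
  fixes g :: "real^'n \<Rightarrow> real^'n^'n" and v :: "real^'n \<Rightarrow> real" and V :: "real^'n \<Rightarrow> real^'n"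
  assumes U: "open U" "x \<in> U" and g: "smooth_on U g" "\<And>x. x \<in> U \<Longrightarrow> spd (g x)"
    and v: "smooth_on U v" and V: "smooth_on U V"
  defines "Y \<equiv> \<lambda>x. matrix_inv (g x) *v (\<chi> l. fderiv v x (axis l 1))"
  shows "sqrt (det (g x)) * (\<Sum>i\<in>UNIV. \<Sum>j\<in>UNIV. matrix_inv (g x) $ i $ j *
      (fderiv2 v x (axis i 1) (axis j 1) - fderiv v x (chr g x (axis i 1) (axis j 1))
       - (fderiv V x (axis i 1) \<bullet> (g x *v axis j 1) + axis i 1 \<bullet> (fderiv g x (V x) *v axis j 1)
          + axis i 1 \<bullet> (g x *v fderiv V x (axis j 1))) / 2))
    = (\<Sum>i\<in>UNIV. fderiv (\<lambda>y. sqrt (det (g y)) * (Y y - V y) $ i) x (axis i 1))"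
    and "C1_on U Y"
proof -
  let ?G = "matrix_inv (g x)" and ?e = "\<lambda>i. axis i (1::real)" and ?\<rho> = "\<lambda>x. sqrt (det (g x))"
  have inv: "\<And>x. x \<in> U \<Longrightarrow> invertible (g x)" using g(2) by (rule spd_invertible)
  have "C1_on U (\<lambda>x. \<chi> k. \<Sum>l\<in>UNIV. matrix_inv (g x) $ k $ l * fderiv v x (?e l))"
    using U inv by (intro C1_on_vec_lambda C1_on_sum C1_on_mult C1_on_matrix_inv C1_on_vec_nth
        smooth_on_C1[OF g(1)] smooth_on_C1 smooth_on_fderiv v) auto
  then show C1Y: "C1_on U Y" unfolding Y_def by (simp add: matrix_vector_mult_def)
  have dY: "(Y has_derivative fderiv Y x) (at x)" using C1_on_has_derivative[OF C1Y U(2)] .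
  have dg: "(g has_derivative fderiv g x) (at x)" by (rule has_fderiv[OF smooth_on_differentiable[OF g(1) U(2)]])
  have dV: "(V has_derivative fderiv V x) (at x)" by (rule has_fderiv[OF smooth_on_differentiable[OF V U(2)]])
  have dv: "v differentiable (at x)" by (rule smooth_on_differentiable[OF v U(2)])
  have gY: "g y *v Y y = (\<chi> l. fderiv v y (?e l))" if "y \<in> U" for y
    unfolding Y_def by (simp add: matrix_vector_mul_assoc matrix_inv_works inv that)
  have key: "fderiv g x w *v Y x + g x *v fderiv Y x w = (\<chi> l. fderiv2 v x w (?e l))" for w
  proof -
    have "((\<lambda>y. g y *v Y y) has_derivative (\<lambda>w. g x *v fderiv Y x w + fderiv g x w *v Y x)) (at x)"
      by (rule has_derivative_matrix_vector[OF dg dY])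
    then have 1: "((\<lambda>y. \<chi> l. fderiv v y (?e l)) has_derivative (\<lambda>w. g x *v fderiv Y x w + fderiv g x w *v Y x)) (at x)"
      by (rule has_derivative_cong_open[OF _ U]) (rule gY)
    have "((\<lambda>y. fderiv v y (?e l)) has_derivative (\<lambda>w. fderiv2 v x w (?e l))) (at x)" for l
      unfolding fderiv2_def by (rule has_fderiv[OF smooth_on_differentiable[OF smooth_on_fderiv[OF v] U(2)]])
    moreover have "((\<lambda>y. fderiv v y (?e l)) has_derivative (\<lambda>w. (g x *v fderiv Y x w + fderiv g x w *v Y x) $ l)) (at x)" for l
      using bounded_linear.has_derivative[OF bounded_linear_vec_nth 1, of l] by simp
    ultimately have "(\<lambda>w. fderiv2 v x w (?e l)) = (\<lambda>w. (g x *v fderiv Y x w + fderiv g x w *v Y x) $ l)" for l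
      by (rule has_derivative_unique)
    then show ?thesis by (simp add: vec_eq_iff fun_eq_iff add.commute)
  qed
  have dvY: "fderiv v x w = w \<bullet> (g x *v Y x)" for w
  proof -
    have "fderiv v x w = (\<Sum>l\<in>UNIV. w $ l *\<^sub>R fderiv v x (?e l))" by (rule linear_expand[OF linear_fderiv[OF dv]])
    then show ?thesis by (simp add: gY[OF U(2)] inner_vec_def)
  qed
  have symDg: "a \<bullet> (fderiv g x w *v b) = b \<bullet> (fderiv g x w *v a)" for a b w
  proof -
    have d: "((\<lambda>y. a \<bullet> (g y *v b)) has_derivative (\<lambda>w. a \<bullet> (fderiv g x w *v b))) (at x)" for a b
      using has_derivative_inner_right[OF has_derivative_matrix_vector[OF dg has_derivative_const], of a b] by simp
    have "((\<lambda>y. b \<bullet> (g y *v a)) has_derivative (\<lambda>w. a \<bullet> (fderiv g x w *v b))) (at x)"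
      by (rule has_derivative_cong_open[OF d U]) (rule spd_symmetric[OF g(2)])
    from fun_cong[OF has_derivative_unique[OF this d]] show ?thesis .
  qed
  define tr where "tr q = (\<Sum>i\<in>UNIV. \<Sum>j\<in>UNIV. ?G $ i $ j * q i j)" for q :: "'n \<Rightarrow> 'n \<Rightarrow> real"
  have tr_lin: "tr (\<lambda>i j. p i j + q i j) = tr p + tr q" "tr (\<lambda>i j. p i j - q i j) = tr p - tr q"
    "tr (\<lambda>i j. q i j / 2) = tr q / 2" for p q
    by (simp_all add: tr_def distrib_left right_diff_distrib sum.distrib sum_subtractf sum_divide_distrib)
  have tr_sym: "tr (\<lambda>i j. q j i) = tr q" for q
    unfolding tr_def by (subst sum.swap) (simp add: trace_metric(4)[OF g(2)[OF U(2)]])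
  \<comment> \<open>The metric trace of the derivative of \<open>g\<close> in direction
    \<open>w\<close>. By Jacobi's formula it is twice the logarithmic derivative of the volume
    density.\<close>
  define \<beta> where "\<beta> w = tr (\<lambda>i j. ?e i \<bullet> (fderiv g x w *v ?e j))" for w
  have chr: "tr (\<lambda>i j. fderiv v x (chr g x (?e i) (?e j))) = tr (\<lambda>i j. ?e j \<bullet> (fderiv g x (?e i) *v Y x)) - \<beta> (Y x) / 2"
  proof -
    have "fderiv v x (chr g x (?e i) (?e j)) = chr1 g x (?e i) (?e j) (Y x)" for i j
      unfolding dvY spd_symmetric[OF g(2)[OF U(2)], of _ "Y x"]
      by (rule inner_metric_chr[OF smooth_on_differentiable[OF g(1) U(2)] inv[OF U(2)]])
    then have "tr (\<lambda>i j. fderiv v x (chr g x (?e i) (?e j)))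
        = tr (\<lambda>i j. (?e j \<bullet> (fderiv g x (?e i) *v Y x) + ?e i \<bullet> (fderiv g x (?e j) *v Y x)
             - ?e i \<bullet> (fderiv g x (Y x) *v ?e j)) / 2)"
      by (simp only: chr1_def)
    also have "\<dots> = (tr (\<lambda>i j. ?e j \<bullet> (fderiv g x (?e i) *v Y x))
         + tr (\<lambda>i j. ?e i \<bullet> (fderiv g x (?e j) *v Y x)) - \<beta> (Y x)) / 2"
      unfolding \<beta>_def by (simp only: tr_lin)
    also have "tr (\<lambda>i j. ?e i \<bullet> (fderiv g x (?e j) *v Y x)) = tr (\<lambda>i j. ?e j \<bullet> (fderiv g x (?e i) *v Y x))"
      by (rule tr_sym)
    finally show ?thesis by simp
  qed
  \<comment> \<open>The last trace also occurs in \<open>chr\<close> with the matching sign. It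
    cancels in the Laplacian of \<open>v\<close>, which becomes \<open>div Y\<close> in the naive
    coordinate sense plus the density term \<open>\<beta> (Y x) / 2\<close>.\<close>
  have divY: "(\<Sum>i\<in>UNIV. fderiv Y x (?e i) $ i) = tr (\<lambda>i j. fderiv2 v x (?e i) (?e j)) - tr (\<lambda>i j. ?e j \<bullet> (fderiv g x (?e i) *v Y x))"
  proof -
    have "(g x *v fderiv Y x (?e i)) $ j = fderiv2 v x (?e i) (?e j) - ?e j \<bullet> (fderiv g x (?e i) *v Y x)" for i j
      using arg_cong[OF key[of "?e i"], of "\<lambda>a. a $ j"] by (simp add: inner_axis')
    then have "tr (\<lambda>i j. (g x *v fderiv Y x (?e i)) $ j) = tr (\<lambda>i j. fderiv2 v x (?e i) (?e j)) - tr (\<lambda>i j. ?e j \<bullet> (fderiv g x (?e i) *v Y x))"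
      by (simp only: tr_lin)
    then show ?thesis unfolding tr_def trace_metric(3)[OF g(2)[OF U(2)]] by simp
  qed
  have divV: "tr (\<lambda>i j. fderiv V x (?e i) \<bullet> (g x *v ?e j)) = (\<Sum>i\<in>UNIV. fderiv V x (?e i) $ i)"
    "tr (\<lambda>i j. ?e i \<bullet> (g x *v fderiv V x (?e j))) = (\<Sum>i\<in>UNIV. fderiv V x (?e i) $ i)"
    unfolding tr_def by (rule trace_metric[OF g(2)[OF U(2)]])+
  have lhs: "(\<Sum>i\<in>UNIV. \<Sum>j\<in>UNIV. ?G $ i $ j *
      (fderiv2 v x (?e i) (?e j) - fderiv v x (chr g x (?e i) (?e j))
       - (fderiv V x (?e i) \<bullet> (g x *v ?e j) + ?e i \<bullet> (fderiv g x (V x) *v ?e j)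
          + ?e i \<bullet> (g x *v fderiv V x (?e j))) / 2))
    = (\<Sum>i\<in>UNIV. fderiv Y x (?e i) $ i) + \<beta> (Y x) / 2 - (\<Sum>i\<in>UNIV. fderiv V x (?e i) $ i) - \<beta> (V x) / 2"
    unfolding tr_def[symmetric] tr_lin chr divY divV \<beta>_def[of "V x", symmetric] by (simp add: field_simps)
  have d\<rho>: "(?\<rho> has_derivative (\<lambda>w. ?\<rho> x * \<beta> w / 2)) (at x)"
  proof -
    have pos: "det (g x) > 0" by (rule spd_det_pos[OF g(2)[OF U(2)]])
    have "(\<Sum>i\<in>UNIV. (?G ** fderiv g x w) $ i $ i) = \<beta> w" for w
    proof -
      have "?e i \<bullet> (fderiv g x w *v ?e j) = fderiv g x w $ j $ i" for i j
        by (subst symDg) (simp add: inner_axis' matrix_vector_mult_basis column_def)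
      then show ?thesis by (simp add: \<beta>_def tr_def matrix_matrix_mult_def)
    qed
    with has_derivative_det[OF dg inv[OF U(2)]]
    have "((\<lambda>x. det (g x)) has_derivative (\<lambda>w. det (g x) * \<beta> w)) (at x)" by simp
    from has_derivative_real_sqrt[OF pos this]
    have "(?\<rho> has_derivative (\<lambda>w. det (g x) * \<beta> w * (inverse (?\<rho> x) / 2))) (at x)"
      by (simp add: field_simps)
    moreover have "det (g x) * \<beta> w * (inverse (?\<rho> x) / 2) = ?\<rho> x * \<beta> w / 2" for w
    proof -
      define r where "r = ?\<rho> x"
      have "r > 0" "det (g x) = r * r" using pos by (simp_all add: r_def)
      then show ?thesis unfolding r_def[symmetric] by (simp add: field_simps)
    qed
    ultimately show ?thesis by (simp only:)
  qed
  have dprod: "fderiv (\<lambda>y. ?\<rho> y * (Y y - V y) $ i) x w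
      = ?\<rho> x * (fderiv Y x w - fderiv V x w) $ i + ?\<rho> x * \<beta> w / 2 * (Y x - V x) $ i" for i w
  proof -
    have "((\<lambda>y. (Y y - V y) $ i) has_derivative (\<lambda>w. (fderiv Y x w - fderiv V x w) $ i)) (at x)"
      by (rule bounded_linear.has_derivative[OF bounded_linear_vec_nth has_derivative_diff[OF dY dV]])
    from fderiv_eq[OF has_derivative_mult[OF d\<rho> this]] show ?thesis by simp
  qed
  have "\<beta> u = (\<Sum>i\<in>UNIV. u $ i *\<^sub>R \<beta> (?e i))" for u
  proof (rule linear_expand)
    show "linear \<beta>"
      using linear_fderiv[OF smooth_on_differentiable[OF g(1) U(2)]]
      unfolding linear_iff \<beta>_def tr_def
      by (simp add: matrix_vector_mult_add_rdistrib scaleR_matrix_vector_assoc[symmetric] inner_add_right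
          distrib_left sum.distrib sum_distrib_left mult_ac)
  qed
  from this[of "Y x - V x"]
  have exp: "(\<Sum>i\<in>UNIV. \<beta> (?e i) * (Y x - V x) $ i) = \<beta> (Y x - V x)" by (simp add: mult.commute)
  have \<beta>diff: "\<beta> (Y x - V x) = \<beta> (Y x) - \<beta> (V x)"
    using linear_diff[OF linear_fderiv[OF smooth_on_differentiable[OF g(1) U(2)]]]
    unfolding \<beta>_def by (simp add: matrix_vector_mult_diff_rdistrib inner_diff_right tr_lin)
  have "(\<Sum>i\<in>UNIV. fderiv (\<lambda>y. ?\<rho> y * (Y y - V y) $ i) x (?e i))
      = (\<Sum>i\<in>UNIV. ?\<rho> x * (fderiv Y x (?e i) $ i - fderiv V x (?e i) $ i + \<beta> (?e i) * (Y x - V x) $ i / 2))"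
    unfolding dprod by (intro sum.cong refl) (simp add: field_simps)
  also have "\<dots> = ?\<rho> x * ((\<Sum>i\<in>UNIV. fderiv Y x (?e i) $ i) - (\<Sum>i\<in>UNIV. fderiv V x (?e i) $ i)
        + (\<Sum>i\<in>UNIV. \<beta> (?e i) * (Y x - V x) $ i) / 2)"
    by (simp only: sum_distrib_left[symmetric] sum.distrib sum_subtractf sum_divide_distrib[symmetric])
  also have "\<dots> = ?\<rho> x * ((\<Sum>i\<in>UNIV. fderiv Y x (?e i) $ i) + \<beta> (Y x) / 2 - (\<Sum>i\<in>UNIV. fderiv V x (?e i) $ i) - \<beta> (V x) / 2)"
    unfolding exp \<beta>diff by (simp add: field_simps)
  finally show "?\<rho> x * (\<Sum>i\<in>UNIV. \<Sum>j\<in>UNIV. ?G $ i $ j *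
      (fderiv2 v x (?e i) (?e j) - fderiv v x (chr g x (?e i) (?e j))
       - (fderiv V x (?e i) \<bullet> (g x *v ?e j) + ?e i \<bullet> (fderiv g x (V x) *v ?e j)
          + ?e i \<bullet> (g x *v fderiv V x (?e j))) / 2))
    = (\<Sum>i\<in>UNIV. fderiv (\<lambda>y. ?\<rho> y * (Y y - V y) $ i) x (?e i))"
    unfolding lhs by (rule sym)
qed

section \<open>The first variation in a chart\<close>

lemma fderiv_linear_compose:
  assumes "bounded_linear l" "f differentiable (at x)"
  shows "fderiv (\<lambda>x. l (f x)) x v = l (fderiv f x v)"
  using fderiv_eq[OF bounded_linear.has_derivative[OF assms(1) has_fderiv[OF assms(2)]]] by simp

lemma fderiv2_linear_compose:
  assumes l: "bounded_linear l" and f: "open S" "x \<in> S" "smooth_on S f"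
  shows "fderiv2 (\<lambda>x. l (f x)) x u v = l (fderiv2 f x u v)"
proof -
  have "fderiv (\<lambda>y. fderiv (\<lambda>x. l (f x)) y v) x = fderiv (\<lambda>y. l (fderiv f y v)) x"
    by (rule fderiv_cong_open[OF f(1,2)]) (rule fderiv_linear_compose[OF l smooth_on_differentiable[OF f(3)]])
  then show ?thesis
    unfolding fderiv2_def
    using fderiv_linear_compose[OF l smooth_on_differentiable[OF smooth_on_fderiv[OF f(3)] f(2)]] by simp
qed

lemma trace_spd_self:
  fixes A :: "real^'n^'n"
  assumes "spd A"
  shows "(\<Sum>i\<in>UNIV. \<Sum>j\<in>UNIV. matrix_inv A $ i $ j * (axis i 1 \<bullet> (A *v axis j 1))) = CARD('n)"
  using trace_metric(2)[OF assms, of "\<lambda>j. axis j 1"] by simp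

definition warp' :: "real \<Rightarrow> real" where "warp' s = 1 + 4 * s ^ 3"

lemma has_derivative_warp: "(warp has_real_derivative warp' s) (at s)"
  unfolding warp_def[abs_def] warp'_def by (auto intro!: derivative_eq_intros)

lemma has_derivative_warp': "(warp' has_real_derivative 12 * s ^ 2) (at s)"
  unfolding warp'_def[abs_def] by (auto intro!: derivative_eq_intros)

definition velocity ::
    "('a::real_normed_vector \<times> real \<Rightarrow> 'b::real_normed_vector) \<Rightarrow> 'a \<Rightarrow> 'b"
  where "velocity F x = fderiv F (x, 0) (0, 1)"

context coords
begin

lemma inner_blk1: "a \<bullet> (blk1 A *v b) = hor a \<bullet> (A *v hor b)"
  unfolding inner_vec_def matrix_vector_mult_def blk1_def hor_def by (simp add: sum_e)

lemma hor_linear: "linear hor" and ver_linear: "linear ver"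
  using bounded_linear_hor bounded_linear_ver by (auto dest: bounded_linear.linear)

end

context warped_product
begin

text \<open>With \<open>v\<close> and \<open>V\<close> the vertical and horizontal parts of the
  velocity, this is the metric trace of the Hessian of \<open>v\<close> minus half the trace of the
  Lie derivative of the metric along \<open>V\<close>, in other words the divergence of
  \<open>grad v - V\<close>.\<close>

definition tension_rate ::
    "('a, 'n) chart \<Rightarrow> ((real^'n) \<times> real \<Rightarrow> real^'m) \<Rightarrow> real^'n \<Rightarrow> real" where
  "tension_rate c F x = (\<Sum>i\<in>UNIV. \<Sum>j\<in>UNIV. matrix_inv (local_metric M c x) $ i $ j *
      (fderiv2 (\<lambda>x. ver (velocity F x)) x (axis i 1) (axis j 1) - fderiv (\<lambda>x. ver (velocity F x)) x (chr (local_metric M c) x (axis i 1) (axis j 1))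
       - (fderiv (\<lambda>x. hor (velocity F x)) x (axis i 1) \<bullet> (local_metric M c x *v axis j 1) + axis i 1 \<bullet> (fderiv (local_metric M c) x (hor (velocity F x)) *v axis j 1)
          + axis i 1 \<bullet> (local_metric M c x *v fderiv (\<lambda>x. hor (velocity F x)) x (axis j 1))) / 2))"

context
  fixes c assumes c: "c \<in> atlas M"
begin

abbreviation g where "g \<equiv> local_metric M c"
abbreviation h where "h \<equiv> local_metric (warped M) (ext c)"
abbreviation V where "V \<equiv> {y. hor y \<in> img c}"

lemma open_V: "open V"
  by (intro open_vimage_hor open_img c)

lemma smooth_h: "smooth_on V h"
proof (rule smooth_on_cong[OF open_V local_metric_ext[OF c, symmetric]])
  show "smooth_on V (\<lambda>y. blk (g (hor y)) (ver y))"
    by (intro smooth_on_blk open_V smooth_on_bounded_linear[OF bounded_linear_ver]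
        smooth_on_compose_linear[OF bounded_linear_hor _ _ smooth_local_metric[OF c]]) auto
qed simp

lemma spd_h: "y \<in> V \<Longrightarrow> spd (h y)"
  using spd_blk[OF spd_local_metric[OF c]] local_metric_ext[OF c] by simp

lemma fderiv_h:
  assumes y: "y \<in> V"
  shows "fderiv h y w = (warp' (ver y) * ver w) *\<^sub>R blk1 (g (hor y)) + warp (ver y) *\<^sub>R blk1 (fderiv g (hor y) (hor w))"
proof -
  have ver: "(ver has_derivative ver) (at y)" and hor: "(hor has_derivative hor) (at y)"
    by (rule bounded_linear_imp_has_derivative[OF bounded_linear_ver]) (rule bounded_linear_imp_has_derivative[OF bounded_linear_hor])
  have w: "((\<lambda>y. warp (ver y)) has_derivative (\<lambda>w. warp' (ver y) * ver w)) (at y)"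
    by (rule has_derivative_compose[OF ver]) (rule has_derivative_warp[unfolded has_field_derivative_def])
  have "(g has_derivative fderiv g (hor y)) (at (hor y))"
    using y by (intro has_fderiv differentiable_local_metric c) simp
  from bounded_linear.has_derivative[OF bounded_linear_blk1 has_derivative_compose[OF hor this]]
  have "((\<lambda>y. blk1 (g (hor y))) has_derivative (\<lambda>w. blk1 (fderiv g (hor y) (hor w)))) (at y)" .
  from has_derivative_add[OF has_derivative_scaleR[OF w this] has_derivative_const[of blk0]]
  have "((\<lambda>y. blk (g (hor y)) (ver y)) has_derivative (\<lambda>w. warp (ver y) *\<^sub>R blk1 (fderiv g (hor y) (hor w))
      + (warp' (ver y) * ver w) *\<^sub>R blk1 (g (hor y)))) (at y)"
    unfolding blk_def by simp
  then have "(h has_derivative (\<lambda>w. warp (ver y) *\<^sub>R blk1 (fderiv g (hor y) (hor w))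
      + (warp' (ver y) * ver w) *\<^sub>R blk1 (g (hor y)))) (at y)"
    by (rule has_derivative_cong_open[OF _ open_V y]) (simp add: local_metric_ext[OF c])
  then show ?thesis by (simp add: fderiv_eq add.commute)
qed

lemma inner_fderiv_h:
  "y \<in> V \<Longrightarrow> a \<bullet> (fderiv h y w *v b) = warp' (ver y) * ver w * (hor a \<bullet> (g (hor y) *v hor b))
     + warp (ver y) * (hor a \<bullet> (fderiv g (hor y) (hor w) *v hor b))"
  by (simp add: fderiv_h matrix_vector_mult_add_rdistrib scaleR_matrix_vector_assoc[symmetric] inner_add_right inner_blk1)

lemma inner_h: "y \<in> V \<Longrightarrow> a \<bullet> (h y *v b) = warp (ver y) * (hor a \<bullet> (g (hor y) *v hor b)) + ver a * ver b"
  using inner_blk[of "hor a" "ver a" "g (hor y)" "ver y" "hor b" "ver b"] by (simp add: local_metric_ext[OF c])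

text \<open>The vertical component is read by pairing with the unit vertical vector, which is
  orthogonal to the slices. Of the three derivatives in \<open>chr1\<close> only the vertical
  derivative of the warped block survives.\<close>

lemma ver_chr:
  assumes y: "y \<in> V"
  shows "ver (chr h y a b) = - (warp' (ver y) * (hor a \<bullet> (g (hor y) *v hor b)) / 2)"
proof -
  have "ver (chr h y a b) = emb 0 1 \<bullet> (h y *v chr h y a b)" by (simp add: inner_h[OF y])
  also have "\<dots> = chr1 h y a b (emb 0 1)"
    by (rule inner_metric_chr[OF smooth_on_differentiable[OF smooth_h y] spd_invertible[OF spd_h[OF y]]])
  also have "\<dots> = - (warp' (ver y) * (hor a \<bullet> (g (hor y) *v hor b)) / 2)"
  proof -
    have "linear (fderiv g (hor y))"
      using y by (intro linear_fderiv differentiable_local_metric c) simp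
    then have "fderiv g (hor y) 0 = 0" by (rule linear_0)
    then show ?thesis by (simp add: chr1_def inner_fderiv_h[OF y])
  qed
  finally show ?thesis .
qed

text \<open>On the slice the warping factor is 1, so the first-kind symbols on horizontal vectors
  are those of \<open>g\<close>. Hence the second fundamental form of the slice has no tangential
  part.\<close>

lemma hor_chr_0:
  assumes x: "x \<in> img c"
  shows "hor (chr h (emb x 0) (emb u 0) (emb v 0)) = chr g x u v"
proof -
  let ?y = "emb x 0"
  have y: "?y \<in> V" using x by simp
  have w0: "warp 0 = 1" by (simp add: warp_def)
  have "w \<bullet> (g x *v hor (chr h ?y (emb u 0) (emb v 0))) = w \<bullet> (g x *v chr g x u v)" for w
  proof -
    have "w \<bullet> (g x *v hor (chr h ?y (emb u 0) (emb v 0))) = emb w 0 \<bullet> (h ?y *v chr h ?y (emb u 0) (emb v 0))"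
      by (simp add: inner_h[OF y] w0)
    also have "\<dots> = chr1 h ?y (emb u 0) (emb v 0) (emb w 0)"
      by (rule inner_metric_chr[OF smooth_on_differentiable[OF smooth_h y] spd_invertible[OF spd_h[OF y]]])
    also have "\<dots> = chr1 g x u v w"
      by (simp add: chr1_def inner_fderiv_h[OF y] w0)
    also have "\<dots> = w \<bullet> (g x *v chr g x u v)"
      by (rule inner_metric_chr[OF differentiable_local_metric[OF c x] spd_invertible[OF spd_local_metric[OF c x]], symmetric])
    finally show ?thesis .
  qed
  then have "g x *v hor (chr h ?y (emb u 0) (emb v 0)) = g x *v chr g x u v" by (metis vector_eq_ldot)
  then show ?thesis
    using inj_matrix_vector_mult[OF spd_invertible[OF spd_local_metric[OF c x]]] by (simp add: inj_eq)
qed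

section \<open>Families of maps in one pair of charts\<close>

context
  fixes F :: "(real^'n) \<times> real \<Rightarrow> real^'m" and \<Omega> :: "((real^'n) \<times> real) set"
  assumes \<Omega>: "open \<Omega>" and F: "smooth_on \<Omega> F"
    and sub: "fst ` \<Omega> \<subseteq> img c" "F ` \<Omega> \<subseteq> V"
begin

abbreviation ei :: "'n \<Rightarrow> real^'n" where "ei i \<equiv> axis i 1"
abbreviation \<tau> where "\<tau> x t \<equiv> local_tension g h (\<lambda>x. F (x, t)) x"

text \<open>The only component of the tension whose time derivative is computed. The Christoffel
  symbols of the warped metric have been eliminated, so only derivatives of \<open>F\<close>, the
  metric \<open>g\<close> and the warping factor remain to be differentiated.\<close>

lemma ver_tension:
  assumes z: "(x, t) \<in> \<Omega>"
  shows "ver (\<tau> x t) = (\<Sum>i\<in>UNIV. \<Sum>j\<in>UNIV. matrix_inv (g x) $ i $ j *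
    (ver (fderiv2 F (x, t) (ei i, 0) (ei j, 0))
     - warp' (ver (F (x, t))) * (hor (fderiv F (x, t) (ei i, 0)) \<bullet> (g (hor (F (x, t))) *v hor (fderiv F (x, t) (ei j, 0)))) / 2
     - ver (fderiv F (x, t) (chr g x (ei i) (ei j), 0))))"
proof -
  have y: "F (x, t) \<in> V" using z sub(2) by blast
  show ?thesis
    unfolding local_tension_sff sff_def
    by (simp add: linear_sum[OF ver_linear] linear_cmul[OF ver_linear] linear_add[OF ver_linear] linear_diff[OF ver_linear]
        fderiv_slice[OF \<Omega> F z] fderiv2_slice[OF \<Omega> F z] ver_chr[OF y])
qed

text \<open>Joint regularity in space and time. It provides the existence of the time derivative of
  the density and the Lipschitz bound needed under the integral.\<close>

lemma C1_bienergy_density: "C1_on \<Omega> (\<lambda>(x, t). \<tau> x t \<bullet> (h (F (x, t)) *v \<tau> x t))"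
proof -
  have \<tau>: "C1_on \<Omega> (\<lambda>z. (case z of (x, t) \<Rightarrow> \<tau> x t $ k))" for k
    by (rule C1_on_tension[OF \<Omega> F open_img[OF c] smooth_local_metric[OF c] _ open_V smooth_h _ sub])
      (auto intro: spd_invertible spd_local_metric[OF c] spd_h)
  have hF: "C1_on \<Omega> (\<lambda>z. h (F z) $ k $ l)" for k l
    by (rule C1_on_compose[OF \<Omega> _ smooth_on_C1[OF F] sub(2), of "\<lambda>y. h y $ k $ l"])
      (intro C1_on_vec_nth open_V smooth_on_C1 smooth_h)
  have "C1_on \<Omega> (\<lambda>z. \<Sum>k\<in>UNIV. (case z of (x, t) \<Rightarrow> \<tau> x t $ k) * (\<Sum>l\<in>UNIV. h (F z) $ k $ l * (case z of (x, t) \<Rightarrow> \<tau> x t $ l)))"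
    by (intro C1_on_sum C1_on_mult \<Omega> \<tau> hF)
  moreover have "a \<bullet> (A *v a) = (\<Sum>k\<in>UNIV. a $ k * (\<Sum>l\<in>UNIV. A $ k $ l * a $ l))" for a :: "real^'m" and A
    by (simp add: inner_vec_def matrix_vector_mult_def)
  ultimately show ?thesis by (simp only: case_prod_unfold prod.collapse)
qed

context
  assumes F0: "\<And>x. x \<in> img c \<Longrightarrow> (x, 0) \<in> \<Omega> \<and> F (x, 0) = emb x 0"
begin

lemma
  assumes x: "x \<in> img c"
  shows fderiv_F0: "fderiv F (x, 0) (v, 0) = emb v 0"
    and fderiv2_F0: "fderiv2 F (x, 0) (u, 0) (v, 0) = 0"
proof -
  have z: "(x, 0) \<in> \<Omega>" using F0 x by blast
  have d: "fderiv (\<lambda>x. emb x 0) y v = emb v 0" for y v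
    using fderiv_eq[OF has_derivative_emb[OF has_derivative_ident has_derivative_const]] by simp
  have eq: "fderiv (\<lambda>x. F (x, 0)) y v = emb v 0" if "y \<in> img c" for y v
    using fderiv_cong_open[OF open_img[OF c] that, of "\<lambda>x. F (x, 0)" "\<lambda>x. emb x 0"] F0 d by simp
  show "fderiv F (x, 0) (v, 0) = emb v 0" using fderiv_slice[OF \<Omega> F z] eq[OF x] by simp
  have "fderiv (\<lambda>y. fderiv (\<lambda>x. F (x, 0)) y v) x = fderiv (\<lambda>y. emb v 0) x"
    by (rule fderiv_cong_open[OF open_img[OF c] x]) (rule eq)
  then show "fderiv2 F (x, 0) (u, 0) (v, 0) = 0"
    using fderiv2_slice[OF \<Omega> F z, of u v] by (simp add: fderiv2_def)
qed

lemma smooth_velocity: "smooth_on (img c) (velocity F)"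
proof -
  have "smooth_on {x. (x, 0) \<in> \<Omega>} (velocity F)"
    unfolding velocity_def[abs_def] by (rule smooth_slice_fun[OF \<Omega> smooth_on_fderiv[OF F]])
  then show ?thesis by (rule smooth_on_subset[rotated]) (use F0 in auto)
qed

lemma smooth_hor_velocity: "smooth_on (img c) (\<lambda>x. hor (velocity F x))"
  and smooth_ver_velocity: "smooth_on (img c) (\<lambda>x. ver (velocity F x))"
  by (rule smooth_on_linear_compose[OF bounded_linear_hor open_img[OF c] smooth_velocity]
      smooth_on_linear_compose[OF bounded_linear_ver open_img[OF c] smooth_velocity])+

text \<open>The slice is totally umbilical: its second fundamental form is minus half the metric
  times the vertical unit vector, and the metric has trace \<open>CARD('n)\<close>.\<close>

lemma tension_0:
  assumes x: "x \<in> img c"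
  shows "hor (\<tau> x 0) = 0" "ver (\<tau> x 0) = - (CARD('n) / 2)"
proof -
  have z: "(x, 0) \<in> \<Omega>" and F0x: "F (x, 0) = emb x 0" using F0 x by auto
  have "hor (sff g h (\<lambda>x. F (x, 0)) x u v) = 0" for u v
    unfolding sff_def fderiv_slice[OF \<Omega> F z] fderiv2_slice[OF \<Omega> F z]
    by (simp add: fderiv_F0[OF x] fderiv2_F0[OF x] F0x linear_diff[OF hor_linear] hor_chr_0[OF x])
  then show "hor (\<tau> x 0) = 0"
    unfolding local_tension_sff by (simp add: linear_sum[OF hor_linear] linear_cmul[OF hor_linear])
  have "ver (\<tau> x 0) = (\<Sum>i\<in>UNIV. \<Sum>j\<in>UNIV. - (matrix_inv (g x) $ i $ j * (ei i \<bullet> (g x *v ei j)) / 2))"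
    unfolding ver_tension[OF z]
    by (simp add: fderiv_F0[OF x] fderiv2_F0[OF x] F0x linear_0[OF ver_linear] warp'_def)
  also have "\<dots> = - (CARD('n) / 2)"
    using trace_spd_self[OF spd_local_metric[OF c x]] by (simp add: sum_negf sum_divide_distrib[symmetric])
  finally show "ver (\<tau> x 0) = - (CARD('n) / 2)" .
qed

lemma has_derivative_time_0:
  "smooth_on \<Omega> G \<Longrightarrow> x \<in> img c \<Longrightarrow>
   ((\<lambda>t. G (x, t)) has_derivative (\<lambda>s. s *\<^sub>R fderiv G (x, 0) (0, 1))) (at 0)"
  by (rule has_derivative_time[OF has_fderiv[OF smooth_on_differentiable]]) (use F0 in auto)

text \<open>The time derivative commutes with the space derivatives. The derivative of the warping factor
  contributes nothing because \<open>warp'' 0 = 0\<close>; this is what makes the slice biharmonic.\<close>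

lemma ver_tension_derivative:
  assumes x: "x \<in> img c"
  shows "((\<lambda>t. ver (\<tau> x t)) has_real_derivative tension_rate c F x) (at 0)"
proof -
  have z: "(x, 0) \<in> \<Omega>" and F0x: "F (x, 0) = emb x 0" using F0 x by auto
  \<comment> \<open>The time derivative on the whole space-time domain, of which
    \<open>velocity F\<close> is the restriction to time 0. Derivatives are interchanged in
    space-time and restricted only afterwards.\<close>
  define T where "T z = fderiv F z (0, 1)" for z
  have T: "smooth_on \<Omega> T" unfolding T_def[abs_def] by (rule smooth_on_fderiv[OF F])
  have velT: "velocity F = (\<lambda>x. T (x, 0))" by (simp add: velocity_def T_def fun_eq_iff)
  have c1: "fderiv (\<lambda>z. fderiv F z (a, 0)) z' (0, 1) = fderiv T z' (a, 0)" if "z' \<in> \<Omega>" for a z'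
    unfolding T_def by (rule smooth_second_derivative_symmetric[OF \<Omega> that F])
  \<comment> \<open>The time direction is moved inward past two space directions, by one application
    of symmetry for each.\<close>
  have c2: "fderiv (\<lambda>z. fderiv2 F z (a, 0) (b, 0)) (x, 0) (0, 1) = fderiv2 T (x, 0) (a, 0) (b, 0)" for a b
  proof -
    have "fderiv (\<lambda>z. fderiv2 F z (a, 0) (b, 0)) (x, 0) (0, 1)
        = fderiv (\<lambda>z. fderiv (\<lambda>z. fderiv F z (b, 0)) z (0, 1)) (x, 0) (a, 0)"
      unfolding fderiv2_def by (rule smooth_second_derivative_symmetric[OF \<Omega> z smooth_on_fderiv[OF F]])
    also have "\<dots> = fderiv (\<lambda>z. fderiv T z (b, 0)) (x, 0) (a, 0)"
      by (rule fun_cong[OF fderiv_cong_open[OF \<Omega> z]]) (rule c1)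
    finally show ?thesis by (simp add: fderiv2_def)
  qed
  have dvel: "velocity F differentiable (at x)" by (rule smooth_on_differentiable[OF smooth_velocity x])
  have s1: "fderiv T (x, 0) (a, 0) = fderiv (velocity F) x a" for a
    unfolding velT by (rule fderiv_slice[OF \<Omega> T z, symmetric])
  have s2: "fderiv2 T (x, 0) (a, 0) (b, 0) = fderiv2 (velocity F) x a b" for a b
    unfolding velT by (rule fderiv2_slice[OF \<Omega> T z, symmetric])
  note sv = fderiv_linear_compose[OF bounded_linear_ver dvel] fderiv_linear_compose[OF bounded_linear_hor dvel]
    fderiv2_linear_compose[OF bounded_linear_ver open_img[OF c] x smooth_velocity]
  have dF: "((\<lambda>t. F (x, t)) has_derivative (\<lambda>s. s *\<^sub>R velocity F x)) (at 0)"
    using has_derivative_time_0[OF F x] by (simp add: velocity_def)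
  have d1: "((\<lambda>t. fderiv F (x, t) (a, 0)) has_derivative (\<lambda>s. s *\<^sub>R fderiv (velocity F) x a)) (at 0)" for a
    using has_derivative_time_0[OF smooth_on_fderiv[OF F, of "(a, 0)"] x] by (simp add: c1[OF z] s1)
  have d2: "((\<lambda>t. fderiv2 F (x, t) (a, 0) (b, 0)) has_derivative (\<lambda>s. s *\<^sub>R fderiv2 (velocity F) x a b)) (at 0)" for a b
    using has_derivative_time_0[of "\<lambda>z. fderiv2 F z (a, 0) (b, 0)", OF _ x]
      smooth_on_fderiv[OF smooth_on_fderiv[OF F, of "(b, 0)"], of "(a, 0)"]
    unfolding c2 s2 by (simp add: fderiv2_def)
  have dw: "((\<lambda>t. warp' (ver (F (x, t)))) has_derivative (\<lambda>s. 0)) (at 0)"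
  proof -
    have "(*) (0::real) = (\<lambda>h. 0)" by (simp add: fun_eq_iff)
    then have "(warp' has_derivative (\<lambda>h. 0)) (at (ver (F (x, 0))))"
      using has_derivative_warp'[of 0] by (simp add: F0x has_field_derivative_def)
    from has_derivative_compose[OF bounded_linear.has_derivative[OF bounded_linear_ver dF] this] show ?thesis .
  qed
  have dh: "((\<lambda>t. hor (fderiv F (x, t) (a, 0))) has_derivative (\<lambda>s. s *\<^sub>R hor (fderiv (velocity F) x a))) (at 0)" for a
    using bounded_linear.has_derivative[OF bounded_linear_hor d1] by (simp add: linear_cmul[OF hor_linear])
  have dg: "((\<lambda>t. g (hor (F (x, t)))) has_derivative (\<lambda>s. s *\<^sub>R fderiv g x (hor (velocity F x)))) (at 0)"
  proof -
    have d: "(g has_derivative fderiv g x) (at x)" by (rule has_fderiv[OF differentiable_local_metric[OF c x]])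
    have "(g has_derivative fderiv g x) (at (hor (F (x, 0))))" using d by (simp add: F0x)
    from has_derivative_compose[OF bounded_linear.has_derivative[OF bounded_linear_hor dF] this]
    show ?thesis by (simp add: linear_cmul[OF hor_linear] linear_cmul[OF has_derivative_linear[OF d]])
  qed
  \<comment> \<open>The components of the Lie derivative of the metric along the horizontal
    velocity.\<close>
  define P where "P i j = fderiv (\<lambda>x. hor (velocity F x)) x (ei i) \<bullet> (g x *v ei j)
      + ei i \<bullet> (fderiv g x (hor (velocity F x)) *v ei j) + ei i \<bullet> (g x *v fderiv (\<lambda>x. hor (velocity F x)) x (ei j))" for i j
  have dB: "((\<lambda>t. hor (fderiv F (x, t) (ei i, 0)) \<bullet> (g (hor (F (x, t))) *v hor (fderiv F (x, t) (ei j, 0))))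
      has_derivative (\<lambda>s. s * P i j)) (at 0)" for i j
    using has_derivative_inner[OF dh[of "ei i"] has_derivative_matrix_vector[OF dg dh[of "ei j"]]]
    by (simp add: F0x fderiv_F0[OF x] P_def sv matrix_vector_mult_scaleR scaleR_matrix_vector_assoc[symmetric] inner_add_right algebra_simps)
  have dterm: "((\<lambda>t. ver (fderiv2 F (x, t) (ei i, 0) (ei j, 0))
     - warp' (ver (F (x, t))) * (hor (fderiv F (x, t) (ei i, 0)) \<bullet> (g (hor (F (x, t))) *v hor (fderiv F (x, t) (ei j, 0)))) / 2
     - ver (fderiv F (x, t) (chr g x (ei i) (ei j), 0))) has_derivative
     (\<lambda>s. ver (s *\<^sub>R fderiv2 (velocity F) x (ei i) (ei j)) - (s * P i j) / 2
       - ver (s *\<^sub>R fderiv (velocity F) x (chr g x (ei i) (ei j))))) (at 0)" for i j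
  proof -
    have "((\<lambda>t. warp' (ver (F (x, t))) * (hor (fderiv F (x, t) (ei i, 0)) \<bullet> (g (hor (F (x, t))) *v hor (fderiv F (x, t) (ei j, 0)))))
        has_derivative (\<lambda>s. s * P i j)) (at 0)"
      using has_derivative_mult[OF dw dB] by (simp add: F0x warp'_def)
    then show ?thesis
      by (intro has_derivative_diff bounded_linear.has_derivative[OF bounded_linear_ver] d1 d2
          bounded_linear.has_derivative[OF bounded_linear_divide])
  qed
  have "((\<lambda>t. \<Sum>i\<in>UNIV. \<Sum>j\<in>UNIV. matrix_inv (g x) $ i $ j *
    (ver (fderiv2 F (x, t) (ei i, 0) (ei j, 0))
     - warp' (ver (F (x, t))) * (hor (fderiv F (x, t) (ei i, 0)) \<bullet> (g (hor (F (x, t))) *v hor (fderiv F (x, t) (ei j, 0)))) / 2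
     - ver (fderiv F (x, t) (chr g x (ei i) (ei j), 0)))) has_derivative
     (\<lambda>s. \<Sum>i\<in>UNIV. \<Sum>j\<in>UNIV. matrix_inv (g x) $ i $ j * (ver (s *\<^sub>R fderiv2 (velocity F) x (ei i) (ei j)) - (s * P i j) / 2
       - ver (s *\<^sub>R fderiv (velocity F) x (chr g x (ei i) (ei j)))))) (at 0)"
    by (intro has_derivative_sum has_derivative_mult_right dterm)
  moreover have "(\<Sum>i\<in>UNIV. \<Sum>j\<in>UNIV. matrix_inv (g x) $ i $ j * (ver (s *\<^sub>R fderiv2 (velocity F) x (ei i) (ei j)) - (s * P i j) / 2
       - ver (s *\<^sub>R fderiv (velocity F) x (chr g x (ei i) (ei j))))) = tension_rate c F x * s" for s
    unfolding tension_rate_def P_def sv sum_distrib_right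
    by (intro sum.cong refl) (simp add: linear_cmul[OF ver_linear] algebra_simps)
  ultimately have "((\<lambda>t. \<Sum>i\<in>UNIV. \<Sum>j\<in>UNIV. matrix_inv (g x) $ i $ j *
    (ver (fderiv2 F (x, t) (ei i, 0) (ei j, 0))
     - warp' (ver (F (x, t))) * (hor (fderiv F (x, t) (ei i, 0)) \<bullet> (g (hor (F (x, t))) *v hor (fderiv F (x, t) (ei j, 0)))) / 2
     - ver (fderiv F (x, t) (chr g x (ei i) (ei j), 0)))) has_derivative (\<lambda>s. tension_rate c F x * s)) (at 0)"
    by (simp only:)
  moreover have "open {t. (x, t) \<in> \<Omega>}" by (rule open_slice(2)[OF \<Omega>])
  ultimately have "((\<lambda>t. ver (\<tau> x t)) has_derivative (\<lambda>s. tension_rate c F x * s)) (at 0)"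
  proof (rule has_derivative_cong_open)
    show "0 \<in> {t. (x, t) \<in> \<Omega>}" using z by simp
  qed (rule ver_tension[symmetric], simp)
  then show ?thesis by (simp add: has_field_derivative_def)
qed

text \<open>The tangential part of \<open>|\<tau>|\<^sup>2\<close> is nonnegative and vanishes at time \<open>0\<close>, so its derivative does, too.\<close>

lemma bienergy_density_derivative:
  assumes x: "x \<in> img c"
  shows "((\<lambda>t. \<tau> x t \<bullet> (h (F (x, t)) *v \<tau> x t)) has_real_derivative - (CARD('n) * tension_rate c F x)) (at 0)"
proof -
  let ?e = "\<lambda>t. \<tau> x t \<bullet> (h (F (x, t)) *v \<tau> x t)"
  have z: "(x, 0) \<in> \<Omega>" using F0 x by auto
  have "((\<lambda>(x, t). \<tau> x t \<bullet> (h (F (x, t)) *v \<tau> x t)) has_derivative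
      fderiv (\<lambda>(x, t). \<tau> x t \<bullet> (h (F (x, t)) *v \<tau> x t)) (x, 0)) (at (x, 0))" (is "(?E has_derivative ?E') _")
    by (rule C1_on_has_derivative[OF C1_bienergy_density z])
  \<comment> \<open>Joint regularity yields only that a derivative \<open>e'\<close> exists. Its
    value is found by comparison with the vertical part, from which the density differs by a
    function with a minimum at time 0.\<close>
  from has_real_derivative_time[OF this]
  obtain e' where e': "(?e has_real_derivative e') (at 0)" by auto
  have da: "((\<lambda>t. (ver (\<tau> x t))\<^sup>2) has_real_derivative - (CARD('n) * tension_rate c F x)) (at 0)"
    using DERIV_power[OF ver_tension_derivative[OF x], of 2] by (simp add: tension_0[OF x] mult.commute)
  have dr: "((\<lambda>t. ?e t - (ver (\<tau> x t))\<^sup>2) has_real_derivative e' - - (CARD('n) * tension_rate c F x)) (at 0)"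
    by (rule DERIV_diff[OF e' da])
  have "\<exists>d>0. \<forall>t. dist t 0 < d \<longrightarrow> t \<in> {t. (x, t) \<in> \<Omega>}"
    using open_slice(2)[OF \<Omega>, of x] z unfolding open_dist by blast
  then obtain d where d: "d > 0" "\<And>t. \<bar>t\<bar> < d \<Longrightarrow> (x, t) \<in> \<Omega>" by auto
  have form: "?e t - (ver (\<tau> x t))\<^sup>2 = warp (ver (F (x, t))) * (hor (\<tau> x t) \<bullet> (g (hor (F (x, t))) *v hor (\<tau> x t)))"
    if "(x, t) \<in> \<Omega>" for t
  proof -
    have "F (x, t) \<in> V" using that sub(2) by blast
    then show ?thesis by (simp add: inner_h power2_eq_square)
  qed
  have r0: "?e 0 - (ver (\<tau> x 0))\<^sup>2 = 0" unfolding form[OF z] by (simp add: tension_0(1)[OF x])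
  have "e' - - (CARD('n) * tension_rate c F x) = 0"
  proof (rule DERIV_local_min[OF dr d(1)], intro allI impI)
    fix t assume "\<bar>0 - t\<bar> < d"
    then have t: "(x, t) \<in> \<Omega>" using d by simp
    have "hor (F (x, t)) \<in> img c" using t sub(2) by blast
    then have "0 \<le> warp (ver (F (x, t))) * (hor (\<tau> x t) \<bullet> (g (hor (F (x, t))) *v hor (\<tau> x t)))"
      using warp_pos[of "ver (F (x, t))"] spd_nonneg[OF spd_local_metric[OF c]] by (intro mult_nonneg_nonneg) auto
    then show "?e 0 - (ver (\<tau> x 0))\<^sup>2 \<le> ?e t - (ver (\<tau> x t))\<^sup>2"
      using form[OF t] r0 by linarith
  qed
  then have "e' = - (CARD('n) * tension_rate c F x)" by linarith
  then show ?thesis using e' by (simp only:)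
qed

end

end

end

end

section \<open>The first variation of the bienergy\<close>

lemma gradient_pairing:
  fixes A :: "real^'n^'n"
  assumes "invertible A" "linear l"
  shows "l w = w \<bullet> (A *v (matrix_inv A *v (\<chi> i. l (axis i 1))))"
  using linear_expand[OF assms(2), of w]
  by (simp add: matrix_vector_mul_assoc matrix_inv_works[OF assms(1)] inner_vec_def)

section \<open>Integrability and uniform estimates near a compact set\<close>

context nonempty_riemannian
begin

text \<open>The function is controlled only near \<open>K\<close>. Continuity on the open union of
  the neighbourhoods gives measurability there and boundedness on \<open>K\<close>, and
  \<open>K\<close> has finite volume.\<close>

lemma set_integrable_locally_continuous:
  fixes f :: "'a \<Rightarrow> real"
  assumes K: "compactin X K" "K \<subseteq> \<Union>\<U>"
    and U: "\<And>U. U \<in> \<U> \<Longrightarrow> openin X U" "\<And>U. U \<in> \<U> \<Longrightarrow> continuous_map (subtopology X U) euclideanreal f"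
  shows "set_integrable vol K f"
proof -
  let ?W = "\<Union>\<U>"
  have W: "openin X ?W" using U(1) by blast
  have op: "openin X {p \<in> ?W. f p \<in> S}" if "open S" for S
  proof -
    have "openin X {p \<in> U. f p \<in> S}" if "U \<in> \<U>" for U
    proof -
      have "openin (subtopology X U) {p \<in> topspace (subtopology X U). f p \<in> S}"
        using U(2)[OF that] \<open>open S\<close> by (intro openin_continuous_map_preimage) auto
      moreover have "topspace (subtopology X U) = U" using U(1)[OF that] openin_subset by force
      ultimately show ?thesis using U(1)[OF that] openin_trans_full by metis
    qed
    then have "openin X (\<Union>U\<in>\<U>. {p \<in> U. f p \<in> S})" by blast
    moreover have "(\<Union>U\<in>\<U>. {p \<in> U. f p \<in> S}) = {p \<in> ?W. f p \<in> S}" by blast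
    ultimately show ?thesis by simp
  qed
  have Wm: "?W \<in> sets vol" using openin_borelM[OF W] by (simp add: sets_vol)
  have Wt: "topspace (subtopology X ?W) = ?W" using openin_subset[OF W] by auto
  have "continuous_map (subtopology X ?W) euclideanreal f"
    unfolding continuous_map Wt
  proof (intro conjI allI impI)
    fix S :: "real set" assume "openin euclideanreal S"
    then have "openin X {p \<in> ?W. f p \<in> S}" by (intro op) simp
    moreover have "{p \<in> ?W. f p \<in> S} \<subseteq> ?W" by blast
    ultimately show "openin (subtopology X ?W) {p \<in> ?W. f p \<in> S}"
      by (metis (no_types, lifting) openin_open_subtopology[OF W])
  qed simp
  moreover have "compactin (subtopology X ?W) K" using K by (simp add: compactin_subtopology)
  ultimately have "compactin euclideanreal (f ` K)" by (rule image_compactin[rotated])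
  then have "bounded (f ` K)" by (simp add: compact_imp_bounded)
  then obtain B where B: "\<And>p. p \<in> K \<Longrightarrow> \<bar>f p\<bar> \<le> B" unfolding bounded_iff by auto
  have "f \<in> borel_measurable (restrict_space vol ?W)"
  proof (rule borel_measurableI)
    fix S :: "real set" assume S: "open S"
    have "f -` S \<inter> space (restrict_space vol ?W) = {p \<in> ?W. f p \<in> S}"
      using openin_subset[OF W] by (auto simp: space_restrict_space space_vol)
    moreover have "{p \<in> ?W. f p \<in> S} \<in> sets vol" using openin_borelM[OF op[OF S]] by (simp add: sets_vol)
    ultimately show "f -` S \<inter> space (restrict_space vol ?W) \<in> sets (restrict_space vol ?W)"
      using Wm by (auto simp: sets_restrict_space_iff)
  qed
  then have "(\<lambda>p. f p * indicator ?W p) \<in> borel_measurable vol"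
    using Wm by (subst (asm) borel_measurable_restrict_space_iff) (simp_all add: mult.commute)
  moreover have Km: "K \<in> sets vol" using compact_borelM[OF K(1)] by (simp add: sets_vol)
  ultimately have "(\<lambda>p. indicator K p * (f p * indicator ?W p)) \<in> borel_measurable vol" by measurable
  moreover have "indicator K p * (f p * indicator ?W p) = indicator K p *\<^sub>R f p" for p
    using K(2) by (auto simp: indicator_def)
  ultimately have "(\<lambda>p. indicator K p *\<^sub>R f p) \<in> borel_measurable vol" by (simp only:)
  then show ?thesis
    unfolding set_integrable_def
    by (rule integrableI_bounded_set[OF Km _ emeasure_compact_finite[OF K(1)], where B=B])
      (use B in \<open>auto simp: indicator_def\<close>)
qed

end

text \<open>The time derivative is bounded on a closed space-time ball, and the mean value theorem
  in time turns this bound into a Lipschitz constant uniform in space.\<close>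

lemma C1_locally_Lipschitz_time:
  fixes E :: "'a::euclidean_space \<times> real \<Rightarrow> real"
  assumes \<Omega>: "open \<Omega>" "(x0, 0) \<in> \<Omega>" and E: "C1_on \<Omega> E"
  obtains r C where "r > 0" "C \<ge> 0" "\<And>x t. x \<in> ball x0 r \<Longrightarrow> \<bar>t\<bar> < r \<Longrightarrow> (x, t) \<in> \<Omega>"
    "\<And>x t. x \<in> ball x0 r \<Longrightarrow> \<bar>t\<bar> < r \<Longrightarrow> \<bar>E (x, t) - E (x, 0)\<bar> \<le> C * \<bar>t\<bar>"
proof -
  obtain \<rho> where \<rho>: "\<rho> > 0" "cball (x0, 0) \<rho> \<subseteq> \<Omega>"
    using \<Omega> open_contains_cball by metis
  have "bounded ((\<lambda>z. fderiv E z (0, 1)) ` cball (x0, 0) \<rho>)"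
    by (intro compact_imp_bounded compact_continuous_image continuous_on_subset[OF C1_on_fderiv[OF E] \<rho>(2)]) auto
  then obtain C where C: "C > 0" "\<And>z. z \<in> cball (x0, 0) \<rho> \<Longrightarrow> \<bar>fderiv E z (0, 1)\<bar> \<le> C"
    unfolding bounded_pos by auto
  \<comment> \<open>Half the radius in each factor keeps the product of ball and interval inside the
    space-time ball.\<close>
  have mem: "(x, t) \<in> cball (x0, 0) \<rho>" if "x \<in> ball x0 (\<rho> / 2)" "\<bar>t\<bar> < \<rho> / 2" for x t
  proof -
    have "dist (x0, 0) (x, t) \<le> dist x0 x + dist 0 t"
      unfolding dist_Pair_Pair by (rule sqrt_sum_squares_le_sum) auto
    then show ?thesis using that by (simp add: dist_real_def)
  qed
  show ?thesis
  proof (rule that[of "\<rho> / 2" C])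
    fix x t assume x: "x \<in> ball x0 (\<rho> / 2)" and t: "\<bar>t\<bar> < \<rho> / 2"
    have d: "((\<lambda>t. E (x, t)) has_real_derivative fderiv E (x, s) (0, 1)) (at s)" if "\<bar>s\<bar> < \<rho> / 2" for s
      using mem[OF x that] \<rho>(2) by (intro has_real_derivative_time C1_on_has_derivative[OF E]) auto
    have "norm (E (x, t) - E (x, 0)) \<le> C * norm (t - 0)"
    proof (rule field_differentiable_bound[of "{- \<rho> / 2<..<\<rho> / 2}" "\<lambda>t. E (x, t)" "\<lambda>s. fderiv E (x, s) (0, 1)"])
      fix s assume "s \<in> {- \<rho> / 2<..<\<rho> / 2}"
      then have s: "\<bar>s\<bar> < \<rho> / 2" by auto
      show "((\<lambda>t. E (x, t)) has_field_derivative fderiv E (x, s) (0, 1)) (at s within {- \<rho> / 2<..<\<rho> / 2})"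
        by (rule has_field_derivative_at_within[OF d[OF s]])
      show "norm (fderiv E (x, s) (0, 1)) \<le> C" using C(2)[OF mem[OF x s]] by simp
    qed (use t \<rho> in auto)
    then show "\<bar>E (x, t) - E (x, 0)\<bar> \<le> C * \<bar>t\<bar>" by simp
    show "(x, t) \<in> \<Omega>" using mem[OF x t] \<rho>(2) by blast
  qed (use \<rho> C in auto)
qed

context warped_product
begin

lemma pair: "riemannian_pair M (warped M)"
  by (unfold_locales) (rule riemannian_warped)

theorem not_minimal_slice: "\<not> minimal M (warped M) slice"
proof
  assume min: "minimal M (warped M) slice"
  obtain p where "p \<in> topspace X" using nonempty by blast
  then obtain c where c: "c \<in> atlas M" "p \<in> cdom c" using chart_exists by blast
  \<comment> \<open>The constant family at the slice: its value at time 0 gives the tension of the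
    slice from the formula for families.\<close>
  let ?F = "\<lambda>z::(real^'n) \<times> real. emb (fst z) (0::real)" and ?\<Omega> = "img c \<times> (UNIV :: real set)"
  have \<Omega>: "open ?\<Omega>" by (intro open_Times open_img c open_UNIV)
  have F: "smooth_on ?\<Omega> ?F"
    by (rule smooth_on_emb[OF \<Omega> smooth_on_bounded_linear[OF bounded_linear_fst \<Omega>] smooth_on_const])
  have x: "cmap c p \<in> img c" using c by blast
  have "ver (local_tension (local_metric M c) (local_metric (warped M) (ext c)) (\<lambda>x. ?F (x, 0)) (cmap c p)) = - (CARD('n) / 2)"
    by (rule tension_0(2)[OF c(1) \<Omega> F _ _ _ x]) auto
  moreover have "local_tension (local_metric M c) (local_metric (warped M) (ext c)) (\<lambda>x. ?F (x, 0)) (cmap c p)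
      = tension M (warped M) slice c (ext c) p"
    unfolding tension_def
    by (rule local_tension_cong[OF open_img[OF c(1)] x]) (use c in \<open>auto simp: local_rep_def slice_def\<close>)
  moreover have "tension M (warped M) slice c (ext c) p = 0"
    using min c unfolding minimal_def by (simp add: slice_def)
  ultimately show False using linear_0[OF ver_linear] by simp
qed

end

section \<open>A compactly supported variation of the slice\<close>

locale slice_variation = warped_product e M
  for e :: "'n::finite option \<Rightarrow> 'm::finite" and M :: "('a, 'n) riem" +
  fixes K :: "'a set" and \<epsilon> :: real and \<Phi> :: "real \<Rightarrow> 'a \<Rightarrow> 'a \<times> real"
  assumes K: "compactin X K" and \<epsilon>: "\<epsilon> > 0" and var: "smooth_variation M (warped M) slice K \<epsilon> \<Phi>"
begin

definition Om where "Om c d = {(x, t). x \<in> img c \<and> t \<in> {-\<epsilon><..<\<epsilon>} \<and> \<Phi> t (cinv c x) \<in> cdom d}"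
definition rep where "rep c d = (\<lambda>(x, t). local_rep c d (\<Phi> t) x)"

lemma \<Phi>_continuous: "continuous_map (prod_topology X (top_of_set {-\<epsilon><..<\<epsilon>})) (space_of (warped M)) (\<lambda>(p, t). \<Phi> t p)"
  using var by (simp add: smooth_variation_def)

lemma \<Phi>_0: "p \<in> topspace X \<Longrightarrow> \<Phi> 0 p = (p, 0)"
  using var by (simp add: smooth_variation_def slice_def)

lemma \<Phi>_outside: "t \<in> {-\<epsilon><..<\<epsilon>} \<Longrightarrow> p \<in> topspace X - K \<Longrightarrow> \<Phi> t p = (p, 0)"
  using var unfolding smooth_variation_def slice_def by blast

lemma smooth_rep: "c \<in> atlas M \<Longrightarrow> d \<in> atlas (warped M) \<Longrightarrow> smooth_on (Om c d) (rep c d)"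
  using var unfolding smooth_variation_def Om_def rep_def by blast

lemma open_Om:
  assumes c: "c \<in> atlas M" and d: "d \<in> atlas (warped M)"
  shows "open (Om c d)"
proof -
  let ?I = "{-\<epsilon><..<\<epsilon>}"
  have "continuous_map (top_of_set (img c \<times> ?I)) (prod_topology X (top_of_set ?I)) (\<lambda>z. (cinv c (fst z), snd z))"
  proof (rule continuous_map_pairedI)
    have "continuous_map (top_of_set (img c \<times> ?I)) (top_of_set (img c)) fst"
      by (auto simp: continuous_map_in_subtopology intro: continuous_intros)
    from continuous_map_compose[OF this continuous_cinv[OF c]]
    show "continuous_map (top_of_set (img c \<times> ?I)) X (\<lambda>z. cinv c (fst z))" by (simp add: comp_def)
    show "continuous_map (top_of_set (img c \<times> ?I)) (top_of_set ?I) snd"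
      by (auto simp: continuous_map_in_subtopology intro: continuous_intros)
  qed
  from continuous_map_compose[OF this \<Phi>_continuous]
  have cm: "continuous_map (top_of_set (img c \<times> ?I)) (space_of (warped M)) (\<lambda>z. \<Phi> (snd z) (cinv c (fst z)))"
    by (simp add: comp_def case_prod_unfold)
  interpret P: riemannian_pair M "warped M" by (rule pair)
  have "openin (top_of_set (img c \<times> ?I)) {z \<in> topspace (top_of_set (img c \<times> ?I)). \<Phi> (snd z) (cinv c (fst z)) \<in> cdom d}"
    by (rule openin_continuous_map_preimage[OF cm P.N.openin_cdom[OF d]])
  moreover have "{z \<in> topspace (top_of_set (img c \<times> ?I)). \<Phi> (snd z) (cinv c (fst z)) \<in> cdom d} = Om c d"
    by (auto simp: Om_def)
  moreover have "open (img c \<times> ?I)" by (intro open_Times open_img c) simp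
  ultimately show ?thesis using openin_open_eq by metis
qed

lemma smooth_\<Phi>:
  assumes t: "t \<in> {-\<epsilon><..<\<epsilon>}"
  shows "smooth_map M (warped M) (\<Phi> t)"
  unfolding smooth_map_def
proof (intro conjI ballI)
  have "continuous_map X (prod_topology X (top_of_set {-\<epsilon><..<\<epsilon>})) (\<lambda>p. (p, t))"
    using t by (intro continuous_map_pairedI) auto
  from continuous_map_compose[OF this \<Phi>_continuous]
  show "continuous_map (space_of M) (space_of (warped M)) (\<Phi> t)" by (simp add: comp_def)
  fix c d assume c: "c \<in> atlas M" and d: "d \<in> atlas (warped M)"
  have "smooth_on {x. (x, t) \<in> Om c d} (\<lambda>x. rep c d (x, t))"
    by (rule smooth_slice_fun[OF open_Om[OF c d] smooth_rep[OF c d]])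
  moreover have "{x. (x, t) \<in> Om c d} = cmap c ` (cdom c \<inter> \<Phi> t -` cdom d)"
    using t unfolding cmap_image[OF c] by (auto simp: Om_def)
  ultimately show "smooth_on (cmap c ` (cdom c \<inter> \<Phi> t -` cdom d)) (local_rep c d (\<Phi> t))"
    by (simp add: rep_def)
qed

definition en :: "real \<Rightarrow> 'a \<Rightarrow> real" where "en t p = tension_norm_sq M (warped M) (\<Phi> t) p"
text \<open>Normalised so that the energy density has time derivative \<open>- CARD('n) * D\<close>
  and \<open>D\<close> is the divergence of \<open>grad v - V\<close>. Defining it through
  \<open>deriv\<close> makes it a function on the manifold without reference to charts.\<close>

definition D :: "'a \<Rightarrow> real" where "D p = - (deriv (\<lambda>t. en t p) 0 / CARD('n))"

definition bidensity where "bidensity c z = (case z of (x, t) \<Rightarrow>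
  local_tension (local_metric M c) (local_metric (warped M) (ext c)) (\<lambda>x. rep c (ext c) (x, t)) x \<bullet>
  (local_metric (warped M) (ext c) (rep c (ext c) (x, t)) *v
   local_tension (local_metric M c) (local_metric (warped M) (ext c)) (\<lambda>x. rep c (ext c) (x, t)) x))"

definition vel where "vel c = velocity (rep c (ext c))"
definition grad where "grad c x =
  matrix_inv (local_metric M c x) *v (\<chi> l. fderiv (\<lambda>x. ver (vel c x)) x (axis l 1))"

context
  fixes c assumes c: "c \<in> atlas M"
begin

abbreviation \<Omega> where "\<Omega> \<equiv> Om c (ext c)"
abbreviation F where "F \<equiv> rep c (ext c)"

lemma ext_atlas: "ext c \<in> atlas (warped M)" using c by simp

lemmas open_\<Omega> = open_Om[OF c ext_atlas] and smooth_F = smooth_rep[OF c ext_atlas]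

lemma \<Omega>_sub: "fst ` \<Omega> \<subseteq> img c" "F ` \<Omega> \<subseteq> {y. hor y \<in> img c}"
  by (auto simp: Om_def rep_def local_rep_def)

lemma F_0: "x \<in> img c \<Longrightarrow> (x, 0) \<in> \<Omega> \<and> F (x, 0) = emb x 0"
  using \<epsilon> c cdom_subset[OF c] by (auto simp: Om_def rep_def local_rep_def \<Phi>_0 subset_iff)

lemma C1_bidensity: "C1_on \<Omega> (bidensity c)"
  unfolding bidensity_def[abs_def] by (rule C1_bienergy_density[OF c open_\<Omega> smooth_F \<Omega>_sub])

lemma en_eq_bidensity:
  assumes z: "(x, t) \<in> \<Omega>"
  shows "en t (cinv c x) = bidensity c (x, t)"
proof -
  interpret P: riemannian_pair M "warped M" by (rule pair)
  have x: "x \<in> img c" and t: "t \<in> {-\<epsilon><..<\<epsilon>}" and d: "\<Phi> t (cinv c x) \<in> cdom (ext c)"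
    using z by (auto simp: Om_def)
  have "F (x, t) = cmap (ext c) (\<Phi> t (cinv c x))" by (simp add: rep_def local_rep_def)
  then have "local_metric (warped M) (ext c) (F (x, t)) = metric (warped M) (ext c) (\<Phi> t (cinv c x))"
    using P.N.cinv_cmap[OF ext_atlas d] by (simp add: local_metric_def del: cmap_ext)
  then show ?thesis
    unfolding en_def P.tension_norm_sq_chart[OF smooth_\<Phi>[OF t] c ext_atlas cinv_in[OF c x] d] bidensity_def
    using x c by (simp add: inner_at_def tension_def rep_def cong: if_cong)
qed

lemma has_derivative_en:
  assumes x: "x \<in> img c"
  shows "((\<lambda>t. en t (cinv c x)) has_real_derivative - (CARD('n) * tension_rate c F x)) (at 0)"
proof (rule has_field_derivative_transform_within_open)
  show "((\<lambda>t. bidensity c (x, t)) has_real_derivative - (CARD('n) * tension_rate c F x)) (at 0)"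
    unfolding bidensity_def prod.case
    by (rule bienergy_density_derivative[OF c open_\<Omega> smooth_F \<Omega>_sub F_0 x])
  show "open {t. (x, t) \<in> \<Omega>}" by (rule open_slice(2)[OF open_\<Omega>])
qed (use F_0[OF x] en_eq_bidensity in auto)

lemma D_eq: "x \<in> img c \<Longrightarrow> D (cinv c x) = tension_rate c F x"
  unfolding D_def using DERIV_imp_deriv[OF has_derivative_en] by simp

lemma smooth_vel: "smooth_on (img c) (\<lambda>x. hor (vel c x))" "smooth_on (img c) (\<lambda>x. ver (vel c x))"
  unfolding vel_def
  by (rule smooth_hor_velocity[OF c open_\<Omega> smooth_F \<Omega>_sub F_0] smooth_ver_velocity[OF c open_\<Omega> smooth_F \<Omega>_sub F_0]; assumption)+

lemma divergence_D:
  "x \<in> img c \<Longrightarrow> dens c x * D (cinv c x) = (\<Sum>i\<in>UNIV. fderiv (\<lambda>y. dens c y * (grad c y - hor (vel c y)) $ i) x (axis i 1))"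
  and C1_grad: "C1_on (img c) (grad c)"
proof -
  note df = divergence_formula[OF open_img[OF c] _ smooth_local_metric[OF c] spd_local_metric[OF c] smooth_vel(2,1)]
  show "dens c x * D (cinv c x) = (\<Sum>i\<in>UNIV. fderiv (\<lambda>y. dens c y * (grad c y - hor (vel c y)) $ i) x (axis i 1))"
    if "x \<in> img c"
    unfolding D_eq[OF that] tension_rate_def vel_def[symmetric] dens_def grad_def
    by (rule df(1)[OF that])
  show "C1_on (img c) (grad c)"
  proof (cases "img c = {}")
    case False
    then obtain x where "x \<in> img c" by blast
    then show ?thesis unfolding grad_def[abs_def] by (rule df(2))
  qed (simp add: C1_on_def)
qed

text \<open>Since \<open>K\<close> is closed, the variation is constant in time on a whole
  neighbourhood of such a point. Hence both the velocity and the space derivative of its vertical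
  part are 0.\<close>

lemma vel_outside:
  assumes x: "x \<in> img c" "cinv c x \<notin> K"
  shows "vel c x = 0" "grad c x = 0"
proof -
  let ?W = "cmap c ` (cdom c \<inter> (topspace X - K))" and ?I = "{-\<epsilon><..<\<epsilon>}"
  have "closedin X K" using Hausdorff compactin_imp_closedin K by blast
  then have W: "open ?W" by (intro open_cmap_image[OF c]) (auto simp: closedin_def)
  have WI: "open (?W \<times> ?I)" by (intro open_Times W) simp
  have Weq: "?W = {y \<in> img c. cinv c y \<in> topspace X - K}" by (rule cmap_image[OF c])
  have xW: "x \<in> ?W" using x cdom_subset[OF c] c unfolding Weq by (auto simp del: cmap_cinv)
  have v0: "vel c y = 0" if y: "y \<in> ?W" for y
  proof -
    have "F (y', t) = emb y' 0" if "y' \<in> ?W" "t \<in> ?I" for y' t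
      using that c \<Phi>_outside[of t "cinv c y'"] unfolding Weq by (simp add: rep_def local_rep_def)
    then have "fderiv F (y, 0) = fderiv (\<lambda>z. emb (fst z) 0) (y, 0)"
      using y \<epsilon> by (intro fderiv_cong_open[OF WI]) auto
    also have "\<dots> = (\<lambda>z. emb (fst z) 0)"
      by (rule fderiv_eq[OF has_derivative_emb[OF bounded_linear_imp_has_derivative[OF bounded_linear_fst] has_derivative_const]])
    finally show ?thesis by (simp add: vel_def velocity_def emb_zero)
  qed
  then show "vel c x = 0" using xW by blast
  have "fderiv (\<lambda>x. ver (vel c x)) x = fderiv (\<lambda>x. 0) x"
    by (rule fderiv_cong_open[OF W xW]) (simp add: v0 linear_0[OF ver_linear])
  then show "grad c x = 0" by (simp add: grad_def vec_eq_iff matrix_vector_mult_def)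
qed

end

text \<open>The two representations of the curve \<open>\<Phi> t p\<close> differ by the transition
  map on the horizontal part and agree vertically. Differentiating this relation at time 0 gives
  both transformation rules.\<close>

lemma vel_transform:
  assumes c: "c \<in> atlas M" "c' \<in> atlas M" and y: "y \<in> overlap c c'"
  shows "hor (vel c' (transition c c' y)) = fderiv (transition c c') y (hor (vel c y))"
    and "ver (vel c' (transition c c' y)) = ver (vel c y)"
proof -
  let ?T = "transition c c'"
  have y1: "y \<in> img c" using y overlap_iff[OF c] by blast
  have y2: "?T y \<in> img c'" using trans_in[OF c y] overlap_iff[OF c(2,1)] by blast
  note F1 = F_0[OF c(1) y1] and F2 = F_0[OF c(2) y2]
  have d1: "((\<lambda>t. rep c (ext c) (y, t)) has_derivative (\<lambda>s. s *\<^sub>R vel c y)) (at 0)"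
    unfolding vel_def velocity_def
    by (rule has_derivative_time[OF has_fderiv[OF smooth_on_differentiable[OF smooth_F[OF c(1)] conjunct1[OF F1]]]])
  have d2: "((\<lambda>t. rep c' (ext c') (?T y, t)) has_derivative (\<lambda>s. s *\<^sub>R vel c' (?T y))) (at 0)"
    unfolding vel_def velocity_def
    by (rule has_derivative_time[OF has_fderiv[OF smooth_on_differentiable[OF smooth_F[OF c(2)] conjunct1[OF F2]]]])
  have dT: "(?T has_derivative fderiv ?T y) (at (hor (rep c (ext c) (y, 0))))"
    using has_fderiv[OF smooth_on_differentiable[OF smooth_trans[OF c] y]] F1 by simp
  have "((\<lambda>t. emb (?T (hor (rep c (ext c) (y, t)))) (ver (rep c (ext c) (y, t)))) has_derivative
      (\<lambda>s. emb (fderiv ?T y (hor (s *\<^sub>R vel c y))) (ver (s *\<^sub>R vel c y)))) (at 0)"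
    by (rule has_derivative_emb[OF has_derivative_compose[OF bounded_linear.has_derivative[OF bounded_linear_hor d1] dT]
          bounded_linear.has_derivative[OF bounded_linear_ver d1]])
  moreover have "open ({t. (y, t) \<in> Om c (ext c)} \<inter> {t. (?T y, t) \<in> Om c' (ext c')})"
    by (intro open_Int open_slice(2) open_\<Omega> c)
  ultimately have "((\<lambda>t. rep c' (ext c') (?T y, t)) has_derivative
      (\<lambda>s. emb (fderiv ?T y (hor (s *\<^sub>R vel c y))) (ver (s *\<^sub>R vel c y)))) (at 0)"
  proof (rule has_derivative_cong_open)
    fix t assume t: "t \<in> {t. (y, t) \<in> Om c (ext c)} \<inter> {t. (?T y, t) \<in> Om c' (ext c')}"
    obtain p s where ps: "\<Phi> t (cinv c y) = (p, s)" by force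
    have "p \<in> cdom c" "\<Phi> t (cinv c' (?T y)) = (p, s)"
      using t ps by (auto simp: Om_def cinv_trans[OF c y])
    then show "emb (?T (hor (rep c (ext c) (y, t)))) (ver (rep c (ext c) (y, t))) = rep c' (ext c') (?T y, t)"
      using ps by (simp add: rep_def local_rep_def trans_cmap[OF c])
  qed (use F1 F2 in auto)
  from fun_cong[OF has_derivative_unique[OF this d2], of 1]
  have eq: "vel c' (?T y) = emb (fderiv ?T y (hor (vel c y))) (ver (vel c y))" by simp
  show "hor (vel c' (?T y)) = fderiv ?T y (hor (vel c y))" "ver (vel c' (?T y)) = ver (vel c y)"
    by (simp_all add: eq)
qed

text \<open>The gradient is characterised by its pairing with all vectors. The transition map
  preserves inner products and its differential is onto, so the characterisation transfers without
  computing an inverse matrix.\<close>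

lemma grad_transform:
  assumes c: "c \<in> atlas M" "c' \<in> atlas M" and x: "x \<in> overlap c c'"
  shows "grad c' (transition c c' x) = fderiv (transition c c') x (grad c x)"
proof -
  let ?T = "transition c c'" and ?g = "local_metric M c x" and ?g' = "local_metric M c' (transition c c' x)"
  let ?D = "fderiv ?T x"
  have x1: "x \<in> img c" using x overlap_iff[OF c] by blast
  have x2: "?T x \<in> img c'" using trans_in[OF c x] overlap_iff[OF c(2,1)] by blast
  have dT: "?T differentiable (at x)" by (rule smooth_on_differentiable[OF smooth_trans[OF c] x])
  have pb: "u \<bullet> (?g *v w) = ?D u \<bullet> (?g' *v ?D w)" for u w
    using pullback_trans[OF c] x by (simp add: pullback_on_def)
  note spd = spd_local_metric[OF c(1) x1] spd_local_metric[OF c(2) x2]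
  have "inj ?D"
  proof (rule linear_injective_0[THEN iffD2, OF linear_fderiv[OF dT]], safe)
    fix a assume "?D a = 0"
    then have "a \<bullet> (?g *v a) = 0" using pb by simp
    then show "a = 0" using spd_eq_0[OF spd(1)] by simp
  qed
  then have surj: "surj ?D" by (rule linear_injective_imp_surjective[OF linear_fderiv[OF dT]]) simp
  let ?v = "\<lambda>x. ver (vel c x)" and ?v' = "\<lambda>x. ver (vel c' x)"
  have dv': "?v' differentiable (at (?T x))" by (rule smooth_on_differentiable[OF smooth_vel(2)[OF c(2)] x2])
  have dv: "?v differentiable (at x)" by (rule smooth_on_differentiable[OF smooth_vel(2)[OF c(1)] x1])
  have "fderiv ?v x w = fderiv ?v' (?T x) (?D w)" for w
  proof -
    have "fderiv ?v x = fderiv (\<lambda>x. ?v' (?T x)) x"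
      by (rule fderiv_cong_open[OF open_overlap[OF c] x]) (simp add: vel_transform[OF c])
    then show ?thesis using fderiv_compose[OF dT dv'] by simp
  qed
  moreover have "fderiv ?v x w = w \<bullet> (?g *v grad c x)" for w
    unfolding grad_def by (rule gradient_pairing[OF spd_invertible[OF spd(1)] linear_fderiv[OF dv]])
  moreover have "fderiv ?v' (?T x) w = w \<bullet> (?g' *v grad c' (?T x))" for w
    unfolding grad_def by (rule gradient_pairing[OF spd_invertible[OF spd(2)] linear_fderiv[OF dv']])
  ultimately have "?D w \<bullet> (?g' *v grad c' (?T x)) = ?D w \<bullet> (?g' *v ?D (grad c x))" for w
    using pb by metis
  then have "u \<bullet> (?g' *v grad c' (?T x)) = u \<bullet> (?g' *v ?D (grad c x))" for u
  proof -
    obtain w where "u = ?D w" using surjD[OF surj] by blast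
    then show ?thesis using \<open>\<And>w. ?D w \<bullet> (?g' *v grad c' (?T x)) = ?D w \<bullet> (?g' *v ?D (grad c x))\<close> by (simp only:)
  qed
  then have "?g' *v grad c' (?T x) = ?g' *v ?D (grad c x)" by (metis vector_eq_ldot)
  then show ?thesis
    using inj_matrix_vector_mult[OF spd_invertible[OF spd(2)]] by (simp add: inj_eq)
qed

lemma integral_D: "(LINT p:K|vol. D p) = 0"
proof -
  interpret div_field M K D "\<lambda>c x. grad c x - hor (vel c x)"
  proof
    fix c assume c: "c \<in> atlas M"
    show "C1_on (img c) (\<lambda>x. grad c x - hor (vel c x))"
      by (intro C1_on_diff open_img c C1_grad smooth_on_C1 smooth_vel)
    fix x assume x: "x \<in> img c"
    show "dens c x * D (cinv c x) = (\<Sum>i\<in>UNIV. fderiv (\<lambda>y. dens c y * (grad c y - hor (vel c y)) $ i) x (axis i 1))"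
      by (rule divergence_D[OF c x])
    show "grad c x - hor (vel c x) = 0" if "cinv c x \<notin> K"
      using vel_outside[OF c x that] by (simp add: linear_0[OF hor_linear])
  next
    fix c c' x assume c: "c \<in> atlas M" "c' \<in> atlas M" and x: "x \<in> overlap c c'"
    have "linear (fderiv (transition c c') x)"
      by (rule linear_fderiv[OF smooth_on_differentiable[OF smooth_trans[OF c] x]])
    then show "grad c' (transition c c' x) - hor (vel c' (transition c c' x))
        = fderiv (transition c c') x (grad c x - hor (vel c x))"
      by (simp add: linear_diff grad_transform[OF c x] vel_transform[OF c x])
  qed (rule K)
  show ?thesis by (rule integral_divergence)
qed

text \<open>The local data, continuity in space for small times and a bound linear in time, that are
  made uniform on \<open>K\<close> by a finite cover.\<close>

definition locally_Lipschitz :: "'a set \<Rightarrow> real \<Rightarrow> real \<Rightarrow> bool"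
  where "locally_Lipschitz U \<delta> C \<longleftrightarrow> \<delta> > 0 \<and> C \<ge> 0 \<and>
    (\<forall>t. \<bar>t\<bar> < \<delta> \<longrightarrow> continuous_map (subtopology X U) euclideanreal (en t)) \<and>
    (\<forall>q\<in>U. \<forall>t. \<bar>t\<bar> < \<delta> \<longrightarrow> \<bar>en t q - en 0 q\<bar> \<le> C * \<bar>t\<bar>)"

lemma en_locally_Lipschitz:
  assumes p: "p \<in> topspace X"
  shows "\<exists>U. openin X U \<and> p \<in> U \<and> (\<exists>\<delta> C. locally_Lipschitz U \<delta> C)"
proof -
  obtain c where c: "c \<in> atlas M" "p \<in> cdom c" using p chart_exists by blast
  have x0: "cmap c p \<in> img c" using c by blast
  obtain r C where r: "r > 0" "C \<ge> 0" "\<And>x t. x \<in> ball (cmap c p) r \<Longrightarrow> \<bar>t\<bar> < r \<Longrightarrow> (x, t) \<in> Om c (ext c)"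
    "\<And>x t. x \<in> ball (cmap c p) r \<Longrightarrow> \<bar>t\<bar> < r \<Longrightarrow> \<bar>bidensity c (x, t) - bidensity c (x, 0)\<bar> \<le> C * \<bar>t\<bar>"
    by (rule C1_locally_Lipschitz_time[OF open_\<Omega>[OF c(1)] conjunct1[OF F_0[OF c(1) x0]] C1_bidensity[OF c(1)]]) (rule that)
  let ?B = "ball (cmap c p) r"
  let ?U = "cdom c \<inter> cmap c -` ?B"
  have en: "en t q = bidensity c (cmap c q, t)" if "q \<in> ?U" "\<bar>t\<bar> < r" for t q
    using en_eq_bidensity[OF c(1) r(3), of "cmap c q" t] that c(1) by simp
  have U: "openin X ?U" by (intro openin_cmap_vimage c) simp
  have "continuous_map (subtopology X ?U) euclideanreal (en t)" if t: "\<bar>t\<bar> < r" for t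
  proof (rule continuous_map_eq)
    have "continuous_on ?B (\<lambda>x. bidensity c (x, t))"
      by (rule continuous_on_compose2[OF C1_on_continuous_on[OF C1_bidensity[OF c(1)]]])
        (use r(3) t in \<open>auto intro!: continuous_intros\<close>)
    then have "continuous_map (top_of_set ?B) euclideanreal (\<lambda>x. bidensity c (x, t))" by simp
    moreover have "continuous_map (subtopology X ?U) (top_of_set ?B) (cmap c)"
      using continuous_map_from_subtopology_mono[OF continuous_cmap[OF c(1)], of ?U]
      by (auto simp: continuous_map_in_subtopology)
    ultimately show "continuous_map (subtopology X ?U) euclideanreal ((\<lambda>x. bidensity c (x, t)) \<circ> cmap c)"
      by (rule continuous_map_compose[rotated])
    show "((\<lambda>x. bidensity c (x, t)) \<circ> cmap c) q = en t q" if "q \<in> topspace (subtopology X ?U)" for q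
      using en[of q t] that t by simp
  qed
  moreover have "\<bar>en t q - en 0 q\<bar> \<le> C * \<bar>t\<bar>" if q: "q \<in> ?U" and t: "\<bar>t\<bar> < r" for q t
    using en[OF q t] en[OF q, of 0] r(1) r(4)[OF _ t, of "cmap c q"] q by simp
  ultimately have "locally_Lipschitz ?U r C" using r by (simp add: locally_Lipschitz_def)
  moreover have "p \<in> ?U" using c r by simp
  ultimately show ?thesis using U by blast
qed

theorem bienergy_derivative:
  "((\<lambda>t. bienergy_on M (warped M) K (\<Phi> t)) has_real_derivative 0) (at 0)"
proof -
  have near: "\<exists>U. openin X U \<and> p \<in> U \<and> (\<exists>\<delta> C. locally_Lipschitz U \<delta> C)" if "p \<in> K" for p
    using en_locally_Lipschitz compactin_subset_topspace[OF K] that by blast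
  obtain \<U> where \<U>: "finite \<U>" "\<And>U. U \<in> \<U> \<Longrightarrow> openin X U \<and> (\<exists>\<delta> C. locally_Lipschitz U \<delta> C)" "K \<subseteq> \<Union>\<U>"
    by (rule compactin_finite_cover[OF K near], assumption) (rule that)
  have "\<forall>U\<in>\<U>. \<exists>z. locally_Lipschitz U (fst z) (snd z)" using \<U>(2) by force
  from bchoice[OF this] obtain z where z: "\<forall>U\<in>\<U>. locally_Lipschitz U (fst (z U)) (snd (z U))" by blast
  \<comment> \<open>The inserted 1, like the inserted 0 in \<open>C\<close>, keeps the extremum
    meaningful when the cover is empty, as it may be for empty \<open>K\<close>.\<close>
  define \<delta> where "\<delta> = Min (insert 1 ((\<lambda>U. fst (z U)) ` \<U>))"
  define C where "C = Max (insert 0 ((\<lambda>U. snd (z U)) ` \<U>))"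
  have \<delta>: "\<delta> > 0" "\<And>U. U \<in> \<U> \<Longrightarrow> \<delta> \<le> fst (z U)"
    using \<U>(1) z by (auto simp: \<delta>_def locally_Lipschitz_def)
  have C: "\<And>U. U \<in> \<U> \<Longrightarrow> snd (z U) \<le> C" using \<U>(1) by (auto simp: C_def)
  have int: "set_integrable vol K (en t)" if t: "\<bar>t\<bar> < \<delta>" for t
  proof (rule set_integrable_locally_continuous[OF K \<U>(3)])
    show "openin X U" if "U \<in> \<U>" for U using \<U>(2) that by blast
    show "continuous_map (subtopology X U) euclideanreal (en t)" if "U \<in> \<U>" for U
      using z that t \<delta>(2)[OF that] by (auto simp: locally_Lipschitz_def)
  qed
  have lip: "\<bar>en t q - en 0 q\<bar> \<le> C * \<bar>t\<bar>" if q: "q \<in> K" and t: "\<bar>t\<bar> < \<delta>" for q t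
  proof -
    obtain U where U: "U \<in> \<U>" "q \<in> U" using \<U>(3) q by blast
    then have "\<bar>en t q - en 0 q\<bar> \<le> snd (z U) * \<bar>t\<bar>"
      using z t \<delta>(2)[OF U(1)] by (auto simp: locally_Lipschitz_def)
    also have "\<dots> \<le> C * \<bar>t\<bar>" using C[OF U(1)] by (intro mult_right_mono) auto
    finally show ?thesis .
  qed
  have der: "((\<lambda>t. en t q) has_real_derivative - CARD('n) * D q) (at 0)" if q: "q \<in> K" for q
  proof -
    obtain c where c: "c \<in> atlas M" "q \<in> cdom c"
      using compactin_subset_topspace[OF K] q chart_exists by blast
    then have x: "cmap c q \<in> img c" by blast
    show ?thesis
      using has_derivative_en[OF c(1) x] D_eq[OF c(1) x] c by simp
  qed
  have "((\<lambda>t. LINT p:K|vol. en t p) has_real_derivative (LINT p:K|vol. - CARD('n) * D p)) (at 0)"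
    by (rule has_derivative_set_integral[OF _ emeasure_compact_finite[OF K] \<delta>(1) int lip der])
      (use compact_borelM[OF K] sets_vol in auto)
  moreover have "(LINT p:K|vol. - CARD('n) * D p) = 0"
    by (subst set_integral_mult_right) (simp add: integral_D)
  ultimately have "((\<lambda>t. LINT p:K|vol. en t p) has_real_derivative 0) (at 0)" by simp
  from DERIV_cdivide[OF this, of 2] show ?thesis
    by (simp add: bienergy_on_def en_def)
qed

end

theorem (in warped_product) biharmonic_slice: "biharmonic M (warped M) slice"
  unfolding biharmonic_def
proof (intro conjI allI impI smooth_slice)
  fix K \<epsilon> \<Phi>
  assume "compactin (space_of M) K" "\<epsilon> > 0" "smooth_variation M (warped M) slice K \<epsilon> \<Phi>"
  then interpret slice_variation e M K \<epsilon> \<Phi> by unfold_locales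
  show "((\<lambda>t. bienergy_on M (warped M) K (\<Phi> t)) has_real_derivative 0) (at 0)"
    by (rule bienergy_derivative)
qed

theorem theorem2p3:
  fixes M :: "('a, 'n::finite) riem"
  assumes "riemannian_manifold M"
    and "topspace (space_of M) \<noteq> {}"
    and "CARD('m::finite) = CARD('n) + 1"
  shows "\<exists>(N :: ('a \<times> real, 'm) riem) \<iota>.
           riemannian_manifold N \<and>
           isometric_embedding M N \<iota> \<and>
           biharmonic M N \<iota> \<and>
           \<not> minimal M N \<iota>"
proof -
  have "card (UNIV :: 'n option set) = card (UNIV :: 'm set)"
    using assms(3) by (simp add: UNIV_option_conv card_image)
  then obtain e :: "'n option \<Rightarrow> 'm" where "bij e"
    using finite_same_card_bij[of "UNIV :: 'n option set" "UNIV :: 'm set"] by auto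
  then interpret warped_product e M using assms by unfold_locales
  show ?thesis using riemannian_warped isometric_slice biharmonic_slice not_minimal_slice by blast
qed

end
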